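(* Let $n\ge 2$ and let $\Pi_0,\dots,\Pi_n\subset\mathbb{P}^n$ be general linear subspaces of codimension $2$. Let $T_n$ be the closure of the union of all lines transversal to $\Pi_0,\dots,\Pi_n$, and let $R_n=Q_0\cap\dots\cap Q_n$. Then $T_n=R_n$ in $\mathbb{P}^n$.
   Context: $\mathbb{P}^n$ is projective space over a ground field $K$ of characteristic $0$; points and lines are understood geometrically (i.e. over an algebraic closure if $K$ is not algebraically closed). "General" means: for all choices in some dense Zariski-open subset of the parameter space. A line is transversal to $\Pi_0,\dots,\Pi_n$ if it meets every $\Pi_i$. For each $j=0,\dots,n$ there is a unique hypersurface of degree $n-1$ in $\mathbb{P}^n$ containing the $n$ subspaces $\Pi_i$, $i\neq j$; it is denoted $Q_j$. The equality is an equality of closed subsets of $\mathbb{P}^n$. *)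

theory Defs
  imports
    "HOL-Analysis.Analysis"
    "HOL-Algebra.Algebraic_Closure_Type"
    "HOL-Library.Poly_Mapping"
    "HOL-Library.Function_Algebras"
begin

section \<open>Projective space and its linear subspaces\<close>

text \<open>
  A vector of \<open>L\<^sup>n\<^sup>+\<^sup>1\<close> is a function on \<open>nat\<close> vanishing above \<open>n\<close>. All dimensions are taken
  in the vector space of all functions on \<open>nat\<close> with pointwise operations.
\<close>

definition fscale :: "'a::field \<Rightarrow> (nat \<Rightarrow> 'a) \<Rightarrow> nat \<Rightarrow> 'a" where
  "fscale c x = (\<lambda>i. c * x i)"

interpretation fvs: vector_space fscale
  by unfold_locales (auto simp: fscale_def fun_eq_iff algebra_simps)

definition vecs :: "nat \<Rightarrow> (nat \<Rightarrow> 'a::field) set" where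
  "vecs n = {x. \<forall>i>n. x i = 0}"

definition linear_subspaces :: "nat \<Rightarrow> nat \<Rightarrow> (nat \<Rightarrow> 'a::field) set set" where
  "linear_subspaces n d = {W. fvs.subspace W \<and> W \<subseteq> vecs n \<and> fvs.dim W = d}"

text \<open>The points of \<open>P\<^sup>n\<close> are the lines through the origin of \<open>L\<^sup>n\<^sup>+\<^sup>1\<close>.\<close>

type_synonym 'a point = "(nat \<Rightarrow> 'a) set"

definition proj_space :: "nat \<Rightarrow> 'a::field point set" where
  "proj_space n = linear_subspaces n 1"

definition proj :: "nat \<Rightarrow> (nat \<Rightarrow> 'a::field) set \<Rightarrow> 'a point set" where
  "proj n W = {p \<in> proj_space n. p \<subseteq> W}"

definition proj_lines :: "nat \<Rightarrow> 'a::field point set set" where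
  "proj_lines n = proj n ` linear_subspaces n 2"

text \<open>Codimension 2 in \<open>P\<^sup>n\<close> means vector space dimension \<open>(n + 1) - 2\<close>.\<close>

definition codim2_subspaces :: "nat \<Rightarrow> 'a::field point set set" where
  "codim2_subspaces n = proj n ` linear_subspaces n (n - 1)"


section \<open>Polynomials and hypersurfaces\<close>

type_synonym ('v, 'a) multipoly = "('v \<Rightarrow>\<^sub>0 nat) \<Rightarrow>\<^sub>0 'a"

definition eval_poly :: "('v, 'a::comm_semiring_1) multipoly \<Rightarrow> ('v \<Rightarrow> 'a) \<Rightarrow> 'a" where
  "eval_poly F x =
     (\<Sum>m\<in>Poly_Mapping.keys F. Poly_Mapping.lookup F m *
        (\<Prod>v\<in>Poly_Mapping.keys m. x v ^ Poly_Mapping.lookup m v))"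

definition forms :: "nat \<Rightarrow> nat \<Rightarrow> (nat, 'a::comm_semiring_1) multipoly set" where
  "forms n d =
     {F. \<forall>m\<in>Poly_Mapping.keys F. Poly_Mapping.keys m \<subseteq> {..n} \<and>
           (\<Sum>v\<in>Poly_Mapping.keys m. Poly_Mapping.lookup m v) = d}"

text \<open>
  A hypersurface of degree \<open>d\<close> is a nonzero form of degree \<open>d\<close> up to nonzero scalars (so that
  multiplicities are remembered and the degree is well defined).
\<close>

definition hypersurfaces :: "nat \<Rightarrow> nat \<Rightarrow> (nat, 'a::field) multipoly set set" where
  "hypersurfaces n d =
     (\<lambda>F. {Poly_Mapping.map ((*) c) F | c. c \<noteq> 0}) ` (forms n d - {0})"

definition locus :: "nat \<Rightarrow> (nat, 'a::field) multipoly set \<Rightarrow> 'a point set" where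
  "locus n H = {p \<in> proj_space n. \<forall>F\<in>H. \<forall>x\<in>p. eval_poly F x = 0}"

definition zariski_proj :: "nat \<Rightarrow> 'a::field point topology" where
  "zariski_proj n =
     topology_generated_by {proj_space n - locus n {F} | F d. F \<in> forms n d}"


section \<open>General families of subspaces of codimension 2\<close>

text \<open>
  The parameter space is the product of \<open>n + 1\<close> copies of the Grassmannian of subspaces of
  codimension 2 of \<open>P\<^sup>n\<close>, regarded as a variety over the ground field \<open>'k\<close>. Its
  geometric points are the families below, over the algebraic closure of \<open>'k\<close>; the families
  defined over \<open>'k\<close> are among them.
\<close>

definition families :: "nat \<Rightarrow> (nat \<Rightarrow> 'a::field point set) set" where
  "families n = (\<Pi>\<^sub>E i\<in>{..n}. codim2_subspaces n)"

text \<open>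
  The Zariski topology of the parameter space is the quotient topology from the space of
  equations: \<open>e (i, r, k)\<close> is the coefficient of the coordinate \<open>x\<^sub>k\<close> in the \<open>r\<close>-th equation
  (\<open>r = 0, 1\<close>) of the \<open>i\<close>-th subspace.
\<close>

type_synonym eqvar = "nat \<times> nat \<times> nat"

definition eq_space :: "nat \<Rightarrow> (eqvar \<Rightarrow> 'a::field) set" where
  "eq_space n = {e. \<forall>v. v \<notin> {..n} \<times> {..<2} \<times> {..n} \<longrightarrow> e v = 0}"

definition family_of :: "nat \<Rightarrow> (eqvar \<Rightarrow> 'a::field) \<Rightarrow> nat \<Rightarrow> 'a point set" where
  "family_of n e =
     (\<lambda>i\<in>{..n}. proj n {x \<in> vecs n. \<forall>r<2. (\<Sum>k\<le>n. e (i, r, k) * x k) = 0})"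

text \<open>The two equations of each subspace have to be independent, as the codimension is exactly 2.\<close>

definition indep_eqs :: "nat \<Rightarrow> (eqvar \<Rightarrow> 'a::field) set" where
  "indep_eqs n = {e \<in> eq_space n. family_of n e \<in> families n}"

text \<open>Open sets are those defined over \<open>'k\<close>, by polynomials with coefficients in \<open>'k\<close>.\<close>

definition zariski_eqs :: "nat \<Rightarrow> (eqvar \<Rightarrow> 'k::field alg_closure) topology" where
  "zariski_eqs n =
     subtopology
       (topology_generated_by
          (range (\<lambda>f :: (eqvar, 'k) multipoly.
             {e \<in> eq_space n. eval_poly (Poly_Mapping.map to_ac f) e \<noteq> 0})))
       (indep_eqs n)"

definition zariski_families :: "nat \<Rightarrow> (nat \<Rightarrow> 'k::field alg_closure point set) topology" where
  "zariski_families n =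
     topology (\<lambda>U. U \<subseteq> families n \<and>
       openin (zariski_eqs n) {e \<in> indep_eqs n. family_of n e \<in> U})"

lemma openin_zariski_families:
  "openin (zariski_families n) U \<longleftrightarrow>
     U \<subseteq> families n \<and> openin (zariski_eqs n) {e \<in> indep_eqs n. family_of n e \<in> U}"
proof -
  define pre where "pre U = {e \<in> indep_eqs n. family_of n e \<in> U}"
    for U :: "(nat \<Rightarrow> 'a alg_closure point set) set"
  have Int: "pre (S \<inter> T) = pre S \<inter> pre T" for S T
    unfolding pre_def by blast
  have Un: "pre (\<Union>\<K>) = (\<Union>U\<in>\<K>. pre U)" for \<K>
    unfolding pre_def by blast
  have "istopology (\<lambda>U. U \<subseteq> families n \<and> openin (zariski_eqs n) (pre U))"
    unfolding istopology_def Int Un by (blast intro: openin_Int openin_Union)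
  then show ?thesis
    by (simp add: zariski_families_def pre_def)
qed

definition for_general_family ::
    "nat \<Rightarrow> ((nat \<Rightarrow> 'k::field alg_closure point set) \<Rightarrow> bool) \<Rightarrow> bool" where
  "for_general_family n P \<longleftrightarrow>
     (\<exists>U. openin (zariski_families n) U \<and>
          zariski_families n closure_of U = families n \<and> (\<forall>S\<in>U. P S))"


section \<open>The two loci\<close>

definition transversal_lines ::
    "nat \<Rightarrow> (nat \<Rightarrow> 'a::field point set) \<Rightarrow> 'a point set set" where
  "transversal_lines n S = {l \<in> proj_lines n. \<forall>i\<le>n. l \<inter> S i \<noteq> {}}"

definition T_locus :: "nat \<Rightarrow> (nat \<Rightarrow> 'a::field point set) \<Rightarrow> 'a point set" where
  "T_locus n S = zariski_proj n closure_of \<Union>(transversal_lines n S)"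

definition is_Q ::
    "nat \<Rightarrow> (nat \<Rightarrow> 'a::field point set) \<Rightarrow> nat \<Rightarrow> (nat, 'a) multipoly set \<Rightarrow> bool" where
  "is_Q n S j H \<longleftrightarrow>
     H \<in> hypersurfaces n (n - 1) \<and> (\<forall>i\<in>{..n} - {j}. S i \<subseteq> locus n H)"

definition Q_hyp :: "nat \<Rightarrow> (nat \<Rightarrow> 'a::field point set) \<Rightarrow> nat \<Rightarrow> (nat, 'a) multipoly set" where
  "Q_hyp n S j = (THE H. is_Q n S j H)"

definition R_locus :: "nat \<Rightarrow> (nat \<Rightarrow> 'a::field point set) \<Rightarrow> 'a point set" where
  "R_locus n S = (\<Inter>j\<le>n. locus n (Q_hyp n S j))"

end

theory Submission
  imports Defs "Jordan_Normal_Form.Determinant"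
begin

text \<open>
  Let \<open>a\<^sub>i = b\<^sub>i = 0\<close> be the equations of \<open>\<Pi>\<^sub>i\<close>. The line through two points \<open>p\<close> and \<open>x\<close> meets
  \<open>\<Pi>\<^sub>i\<close> exactly if the vectors \<open>(a\<^sub>i(p), b\<^sub>i(p))\<close> and \<open>(a\<^sub>i(x), b\<^sub>i(x))\<close> are linearly dependent, that
  is, if the linear form \<open>h\<^sub>i = a\<^sub>i(p) b\<^sub>i - b\<^sub>i(p) a\<^sub>i\<close> vanishes at \<open>x\<close>. So \<open>p\<close> lies on a transversal
  line exactly if \<open>h\<^sub>0, ..., h\<^sub>n\<close> have a common zero other than \<open>p\<close>. All these forms vanish at
  \<open>p\<close>; they are therefore \<open>n + 1\<close> linear forms of rank at most \<open>n\<close>, one of them is redundant, and \<open>p\<close>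
  lies on a transversal line exactly if for every \<open>j\<close> the \<open>n\<close> forms \<open>h\<^sub>i\<close> with \<open>i \<noteq> j\<close> have a common
  zero other than \<open>p\<close>. The latter condition is the vanishing at \<open>p\<close> of a determinant \<open>q\<^sub>j\<close>, which is
  a form of degree \<open>n - 1\<close> and vanishes on \<open>\<Pi>\<^sub>i\<close> for \<open>i \<noteq> j\<close>. Hence for every family the union of
  the transversal lines is the common zero locus of \<open>q\<^sub>0, ..., q\<^sub>n\<close>, and in particular it is closed
  (\<open>transversal_point_iff\<close>, \<open>transversal_form_eq_0_iff\<close>, \<open>all_transversal_forms_eq_0_iff\<close>).

  It remains to show that for a general family \<open>q\<^sub>j\<close> defines the only hypersurface of degree \<open>n - 1\<close>
  that contains the \<open>n\<close> subspaces \<open>\<Pi>\<^sub>i\<close> with \<open>i \<noteq> j\<close>. Call a point \<open>p\<close> regular if \<open>q\<^sub>j(p) \<noteq> 0\<close> and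
  if each of the \<open>n\<close> lines through \<open>p\<close> that meet all but one of these subspaces meets them in
  distinct points. Let a form \<open>F\<close> of degree \<open>n - 1\<close> vanish on the subspaces and at a regular point
  \<open>p\<close>. On each of the \<open>n\<close> lines it has the \<open>n - 1\<close> zeros on the subspaces and the zero \<open>p\<close>, so it
  vanishes on the line. All but finitely many points of the line are again regular, so the argument
  can be repeated at these points; the linear spaces obtained in this way have growing dimension and
  finally fill the projective space, and \<open>F = 0\<close> (\<open>form_vanishes_on_common_kernel\<close>). Applied to
  \<open>q\<^sub>j(p) F - F(p) q\<^sub>j\<close> this shows that every form of degree \<open>n - 1\<close> that vanishes on the subspaces
  is a multiple of \<open>q\<^sub>j\<close> (\<open>forms_proportional\<close>).

  The families for which the point \<open>(1 : 0 : ... : 0)\<close> is regular for every \<open>j\<close> are given by the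
  nonvanishing of finitely many determinants in the coefficients of the equations, so they form an
  open set over the ground field. It is dense: each determinant is nonzero for suitable coordinate
  subspaces, and two nonempty open sets of equations meet because the line through a point of the
  one and a point of the other lies in both of them up to finitely many points
  (\<open>general_family_is_regular\<close>).
\<close>

section \<open>Rings of functions and determinants\<close>

text \<open>
  The same determinants are used as forms in the coordinates of a point, as polynomials in the
  coefficients of the equations, and as polynomials in the parameter of a line. All that is needed of
  such a class of functions is closure under the operations in the Leibniz formula, together with
  the bookkeeping of degrees.
\<close>

locale graded_functions =
  fixes A :: "nat \<Rightarrow> ('x \<Rightarrow> 'a::comm_ring_1) set"
  assumes zero: "(\<lambda>x. 0) \<in> A d"
    and one: "(\<lambda>x. 1) \<in> A 0"
    and uminus: "f \<in> A d \<Longrightarrow> (\<lambda>x. - f x) \<in> A d"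
    and add: "f \<in> A d \<Longrightarrow> g \<in> A d \<Longrightarrow> (\<lambda>x. f x + g x) \<in> A d"
    and mult: "f \<in> A d \<Longrightarrow> g \<in> A d' \<Longrightarrow> (\<lambda>x. f x * g x) \<in> A (d + d')"
begin

lemma diff: "f \<in> A d \<Longrightarrow> g \<in> A d \<Longrightarrow> (\<lambda>x. f x - g x) \<in> A d"
  using add[OF _ uminus, of f d g] by simp

lemma if_cond:
  "(P \<Longrightarrow> f \<in> A d) \<Longrightarrow> (\<not> P \<Longrightarrow> g \<in> A d) \<Longrightarrow> (\<lambda>x. if P then f x else g x) \<in> A d"
  by (cases P) simp_all

lemma sum:
  assumes "\<And>s. s \<in> S \<Longrightarrow> f s \<in> A d"
  shows "(\<lambda>x. \<Sum>s\<in>S. f s x) \<in> A d"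
  using assms by (induction S rule: infinite_finite_induct) (auto intro: zero add)

lemma prod:
  assumes "\<And>s. s \<in> S \<Longrightarrow> f s \<in> A (d s)"
  shows "(\<lambda>x. \<Prod>s\<in>S. f s x) \<in> A (\<Sum>s\<in>S. d s)"
  using assms by (induction S rule: infinite_finite_induct) (auto intro: one mult)

end

text \<open>
  The determinant of a square system of linear equations whose rows and columns are indexed by
  arbitrary finite sets. It depends on the enumeration of the index sets only by a sign.
\<close>

definition system_det :: "'r set \<Rightarrow> 'c set \<Rightarrow> ('r \<Rightarrow> 'c \<Rightarrow> 'a) \<Rightarrow> 'a::comm_ring_1" where
  "system_det R C M =
     det (mat (card C) (card C) (\<lambda>(i, j). M (from_nat_into R i) (from_nat_into C j)))"

lemma system_det_eq_0_iff:
  fixes M :: "'r \<Rightarrow> 'c \<Rightarrow> 'a::field"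
  assumes "finite R" "finite C" "card R = card C"
  shows "system_det R C M = 0 \<longleftrightarrow>
    (\<exists>x. (\<exists>c\<in>C. x c \<noteq> 0) \<and> (\<forall>r\<in>R. (\<Sum>c\<in>C. M r c * x c) = 0))"
proof -
  define N where "N = card C"
  define Mt where "Mt = mat N N (\<lambda>(i, j). M (from_nat_into R i) (from_nat_into C j))"
  have Mt: "Mt \<in> carrier_mat N N"
    by (simp add: Mt_def)
  have bR: "bij_betw (from_nat_into R) {..<N} R" and bC: "bij_betw (from_nat_into C) {..<N} C"
    using bij_betw_from_nat_into_finite[OF assms(1)] bij_betw_from_nat_into_finite[OF assms(2)]
    unfolding N_def assms(3) by blast+
  have row: "(Mt *\<^sub>v v) $ i = (\<Sum>j<N. M (from_nat_into R i) (from_nat_into C j) * v $ j)"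
    if "v \<in> carrier_vec N" "i < N" for v i
    using that by (simp add: Mt_def scalar_prod_def atLeast0LessThan)
  have sumC: "(\<Sum>c\<in>C. M r c * x c) = (\<Sum>j<N. M r (from_nat_into C j) * x (from_nat_into C j))" for r x
    using sum.reindex_bij_betw[OF bC, of "\<lambda>c. M r c * x c"] by simp
  have ballR: "(\<forall>r\<in>R. Q r) \<longleftrightarrow> (\<forall>i<N. Q (from_nat_into R i))" for Q
    using bij_betw_imp_surj_on[OF bR] by (metis image_iff imageI lessThan_iff)
  have bexC: "(\<exists>c\<in>C. Q c) \<longleftrightarrow> (\<exists>i<N. Q (from_nat_into C i))" for Q
    using bij_betw_imp_surj_on[OF bC] by (metis image_iff imageI lessThan_iff)
  have "system_det R C M = 0 \<longleftrightarrow> (\<exists>v. v \<in> carrier_vec N \<and> v \<noteq> 0\<^sub>v N \<and> Mt *\<^sub>v v = 0\<^sub>v N)"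
    using det_0_iff_vec_prod_zero_field[OF Mt] by (simp add: system_det_def Mt_def N_def)
  also have "\<dots> \<longleftrightarrow> (\<exists>x. (\<exists>c\<in>C. x c \<noteq> 0) \<and> (\<forall>r\<in>R. (\<Sum>c\<in>C. M r c * x c) = 0))" (is "?l = ?r")
  proof
    assume ?l
    then obtain v where v: "v \<in> carrier_vec N" "v \<noteq> 0\<^sub>v N" "Mt *\<^sub>v v = 0\<^sub>v N"
      by blast
    define x where "x c = v $ the_inv_into {..<N} (from_nat_into C) c" for c
    have x: "x (from_nat_into C j) = v $ j" if "j < N" for j
      using that bC by (simp add: x_def the_inv_into_f_f bij_betw_def)
    have "\<exists>j<N. v $ j \<noteq> 0"
      using v(1,2) by (metis carrier_vecD eq_vecI index_zero_vec(1) index_zero_vec(2))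
    moreover have "(\<Sum>j<N. M (from_nat_into R i) (from_nat_into C j) * x (from_nat_into C j)) = 0"
      if "i < N" for i
      using row[OF v(1) that] that by (simp add: v(3) x)
    ultimately show ?r
      unfolding bexC ballR sumC using x by (intro exI[of _ x]) auto
  next
    assume ?r
    then obtain x where x: "\<exists>j<N. x (from_nat_into C j) \<noteq> 0"
      "\<And>i. i < N \<Longrightarrow> (\<Sum>j<N. M (from_nat_into R i) (from_nat_into C j) * x (from_nat_into C j)) = 0"
      unfolding bexC ballR sumC by blast
    define v where "v = vec N (\<lambda>j. x (from_nat_into C j))"
    have "v \<in> carrier_vec N" by (simp add: v_def)
    moreover have "v \<noteq> 0\<^sub>v N"
      using x(1) by (auto simp: v_def vec_eq_iff)
    moreover have "Mt *\<^sub>v v = 0\<^sub>v N"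
    proof (rule eq_vecI)
      fix i assume "i < dim_vec (0\<^sub>v N :: 'a vec)"
      then show "(Mt *\<^sub>v v) $ i = 0\<^sub>v N $ i"
        using row[OF \<open>v \<in> carrier_vec N\<close>, of i] x(2)[of i] by (simp add: v_def)
    qed (simp add: Mt_def)
    ultimately show ?l by blast
  qed
  finally show ?thesis .
qed

text \<open>
  In the Leibniz formula each product takes one entry from each column, so the degrees of the columns
  add up.
\<close>

lemma (in graded_functions) system_det:
  assumes "finite R" "finite C" "card R = card C"
    and entry: "\<And>r c. r \<in> R \<Longrightarrow> c \<in> C \<Longrightarrow> (\<lambda>x. M x r c) \<in> A (d c)"
  shows "(\<lambda>x. system_det R C (M x)) \<in> A (\<Sum>c\<in>C. d c)"
proof -
  define N where "N = card C"
  let ?r = "from_nat_into R" and ?c = "from_nat_into C"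
  have bR: "bij_betw ?r {..<N} R" and bC: "bij_betw ?c {..<N} C"
    using bij_betw_from_nat_into_finite[OF assms(1)] bij_betw_from_nat_into_finite[OF assms(2)]
    unfolding N_def assms(3) by blast+
  have eq: "system_det R C (M x) =
      (\<Sum>p | p permutes {..<N}. signof p * (\<Prod>i<N. M x (?r i) (?c (p i))))" for x
  proof -
    have "(\<Prod>i = 0..<N. mat N N (\<lambda>(i, j). M x (?r i) (?c j)) $$ (i, p i)) =
        (\<Prod>i<N. M x (?r i) (?c (p i)))" if "p permutes {..<N}" for p
    proof -
      have "p i < N" if "i < N" for i
        using permutes_in_image[OF \<open>p permutes {..<N}\<close>, of i] that by simp
      then show ?thesis
        unfolding atLeast0LessThan by (intro prod.cong) simp_all
    qed
    moreover have "system_det R C (M x) = (\<Sum>p | p permutes {0..<N}. signof p *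
        (\<Prod>i = 0..<N. mat N N (\<lambda>(i, j). M x (?r i) (?c j)) $$ (i, p i)))"
      unfolding system_det_def N_def[symmetric] by (rule det_def') simp
    ultimately show ?thesis
      unfolding atLeast0LessThan by (auto intro!: sum.cong)
  qed
  have summand: "(\<lambda>x. signof p * (\<Prod>i<N. M x (?r i) (?c (p i)))) \<in> A (\<Sum>c\<in>C. d c)"
    if p: "p permutes {..<N}" for p
  proof -
    have in_R: "?r i \<in> R" and in_C: "?c (p i) \<in> C" if "i < N" for i
      using that bR bC permutes_in_image[OF p, of i] unfolding bij_betw_def by auto
    have "(\<lambda>x. \<Prod>i<N. M x (?r i) (?c (p i))) \<in> A (\<Sum>i<N. d (?c (p i)))"
      using entry[OF in_R in_C] by (intro prod) auto
    moreover have "(\<Sum>i<N. d (?c (p i))) = (\<Sum>c\<in>C. d c)"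
      using sum.reindex_bij_betw[OF bij_betw_trans[OF permutes_imp_bij[OF p] bC], of d]
      by (simp add: o_def)
    moreover have "signof p = (1 :: 'a) \<or> signof p = (- 1 :: 'a)"
      by (simp add: sign_def)
    ultimately show ?thesis
      using uminus[of "\<lambda>x. \<Prod>i<N. M x (?r i) (?c (p i))" "\<Sum>c\<in>C. d c"] by auto
  qed
  then show ?thesis
    unfolding eq by (intro sum) simp
qed

section \<open>Polynomial functions\<close>

definition monomial_value :: "('v \<Rightarrow>\<^sub>0 nat) \<Rightarrow> ('v \<Rightarrow> 'a::comm_semiring_1) \<Rightarrow> 'a" where
  "monomial_value m x = (\<Prod>v\<in>Poly_Mapping.keys m. x v ^ Poly_Mapping.lookup m v)"

lemma monomial_value_superset:
  assumes "finite V" "Poly_Mapping.keys m \<subseteq> V"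
  shows "monomial_value m x = (\<Prod>v\<in>V. x v ^ Poly_Mapping.lookup m v)"
  unfolding monomial_value_def
  using assms by (intro prod.mono_neutral_left) (auto simp: in_keys_iff)

lemma keys_add_nat:
  "Poly_Mapping.keys (m + m' :: 'v \<Rightarrow>\<^sub>0 nat) = Poly_Mapping.keys m \<union> Poly_Mapping.keys m'"
  by (auto simp: in_keys_iff lookup_add)

lemma monomial_value_0 [simp]: "monomial_value 0 x = 1"
  by (simp add: monomial_value_def)

lemma monomial_value_single [simp]: "monomial_value (Poly_Mapping.single v 1) x = x v"
  by (simp add: monomial_value_def)

lemma monomial_value_add: "monomial_value (m + m') x = monomial_value m x * monomial_value m' x"
proof -
  let ?V = "Poly_Mapping.keys m \<union> Poly_Mapping.keys m'"
  have "monomial_value m'' x = (\<Prod>v\<in>?V. x v ^ Poly_Mapping.lookup m'' v)"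
    if "m'' \<in> {m, m', m + m'}" for m''
    using that by (intro monomial_value_superset) (auto simp: keys_add_nat)
  then show ?thesis
    by (simp add: lookup_add power_add prod.distrib)
qed

lemma eval_poly_superset:
  assumes "finite M" "Poly_Mapping.keys F \<subseteq> M"
  shows "eval_poly F x = (\<Sum>m\<in>M. Poly_Mapping.lookup F m * monomial_value m x)"
  unfolding eval_poly_def monomial_value_def[symmetric]
  using assms by (intro sum.mono_neutral_left) (auto simp: in_keys_iff)

lemma eval_poly_0 [simp]: "eval_poly 0 x = 0"
  by (simp add: eval_poly_def)

lemma eval_poly_single [simp]: "eval_poly (Poly_Mapping.single m c) x = c * monomial_value m x"
  by (subst eval_poly_superset[of "{m}"]) auto

lemma eval_poly_add: "eval_poly (F + G) x = eval_poly F x + eval_poly G x"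
proof -
  let ?M = "Poly_Mapping.keys F \<union> Poly_Mapping.keys G"
  have "eval_poly H x = (\<Sum>m\<in>?M. Poly_Mapping.lookup H m * monomial_value m x)"
    if "H \<in> {F, G, F + G}" for H
    using that by (intro eval_poly_superset) (auto simp: in_keys_iff lookup_add)
  then show ?thesis
    by (simp add: lookup_add algebra_simps sum.distrib)
qed

lemma eval_poly_sum: "eval_poly (\<Sum>s\<in>S. F s) x = (\<Sum>s\<in>S. eval_poly (F s) x)"
  by (induction S rule: infinite_finite_induct) (auto simp: eval_poly_add)

lemma lookup_map_0:
  "\<phi> 0 = 0 \<Longrightarrow> Poly_Mapping.lookup (Poly_Mapping.map \<phi> F) m = \<phi> (Poly_Mapping.lookup F m)"
  by (simp add: map.rep_eq when_def)

lemma eval_poly_map: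
  assumes "\<phi> 0 = 0"
  shows "eval_poly (Poly_Mapping.map \<phi> F) x =
    (\<Sum>m\<in>Poly_Mapping.keys F. \<phi> (Poly_Mapping.lookup F m) * monomial_value m x)"
  by (subst eval_poly_superset[of "Poly_Mapping.keys F"])
    (auto simp: lookup_map_0[of \<phi>, OF assms] in_keys_iff assms)

text \<open>
  Polynomial functions with coefficients from the image of \<open>\<phi>\<close> and monomials from \<open>M\<close>. For
  \<open>\<phi> = to_ac\<close> these are the functions that define the Zariski topology over the ground field; for the
  identity and the monomials of degree \<open>d\<close> these are the forms of degree \<open>d\<close>.
\<close>

definition poly_functions ::
    "('k::comm_ring_1 \<Rightarrow> 'a::comm_ring_1) \<Rightarrow> ('v \<Rightarrow>\<^sub>0 nat) set \<Rightarrow> (('v \<Rightarrow> 'a) \<Rightarrow> 'a) set" where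
  "poly_functions \<phi> M = {eval_poly (Poly_Mapping.map \<phi> F) | F. Poly_Mapping.keys F \<subseteq> M}"

context comm_ring_hom
begin

text \<open>
  Allowing repeated monomials makes closure under products a matter of multiplying out two finite
  sums, without a product of formal polynomials.
\<close>

lemma poly_functions_sum:
  assumes "finite S" "\<And>s. s \<in> S \<Longrightarrow> m s \<in> M"
  shows "(\<lambda>x. \<Sum>s\<in>S. hom (c s) * monomial_value (m s) x) \<in> poly_functions hom M"
proof -
  define F where "F = (\<Sum>s\<in>S. Poly_Mapping.single (m s) (c s))"
  have "Poly_Mapping.map hom F = (\<Sum>s\<in>S. Poly_Mapping.single (m s) (hom (c s)))"
    by (rule poly_mapping_eqI)
      (auto simp: lookup_map_0 F_def lookup_sum hom_sum lookup_single when_def intro!: sum.cong)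
  then have "eval_poly (Poly_Mapping.map hom F) = (\<lambda>x. \<Sum>s\<in>S. hom (c s) * monomial_value (m s) x)"
    by (simp add: eval_poly_sum fun_eq_iff)
  moreover have "Poly_Mapping.keys F \<subseteq> M"
    unfolding F_def using keys_sum[of "\<lambda>s. Poly_Mapping.single (m s) (c s)" S] assms(2)
    by (fastforce split: if_splits)
  ultimately show ?thesis
    unfolding poly_functions_def by (intro CollectI exI[of _ F]) simp
qed

lemma poly_functionsE:
  assumes "f \<in> poly_functions hom M"
  obtains S c where "finite S" "S \<subseteq> M" "f = (\<lambda>x. \<Sum>m\<in>S. hom (c m) * monomial_value m x)"
proof -
  obtain F where "f = eval_poly (Poly_Mapping.map hom F)" "Poly_Mapping.keys F \<subseteq> M"
    using assms by (auto simp: poly_functions_def)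
  then show ?thesis
    by (intro that[of "Poly_Mapping.keys F" "Poly_Mapping.lookup F"])
      (auto simp: eval_poly_map fun_eq_iff)
qed

lemma poly_functions_0: "(\<lambda>x. 0) \<in> poly_functions hom M"
  using poly_functions_sum[of "{}" "\<lambda>_. 0" M] by simp

lemma poly_functions_monomial: "m \<in> M \<Longrightarrow> (\<lambda>x. hom c * monomial_value m x) \<in> poly_functions hom M"
  using poly_functions_sum[of "{()}" "\<lambda>_. m" M "\<lambda>_. c"] by simp

lemma poly_functions_const: "0 \<in> M \<Longrightarrow> (\<lambda>x. hom c) \<in> poly_functions hom M"
  using poly_functions_monomial[of 0 M c] by simp

lemma poly_functions_var: "Poly_Mapping.single v 1 \<in> M \<Longrightarrow> (\<lambda>x. x v) \<in> poly_functions hom M"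
  using poly_functions_monomial[of "Poly_Mapping.single v 1" M 1] by (simp del: One_nat_def)

lemma poly_functions_add:
  assumes "f \<in> poly_functions hom M" "g \<in> poly_functions hom M"
  shows "(\<lambda>x. f x + g x) \<in> poly_functions hom M"
proof -
  obtain S c where f: "finite S" "S \<subseteq> M" "f = (\<lambda>x. \<Sum>m\<in>S. hom (c m) * monomial_value m x)"
    using poly_functionsE[OF assms(1)] .
  obtain T d where g: "finite T" "T \<subseteq> M" "g = (\<lambda>x. \<Sum>m\<in>T. hom (d m) * monomial_value m x)"
    using poly_functionsE[OF assms(2)] .
  have "(\<lambda>x. \<Sum>s\<in>Inl ` S \<union> Inr ` T. hom (case s of Inl m \<Rightarrow> c m | Inr m \<Rightarrow> d m) *
      monomial_value (case s of Inl m \<Rightarrow> m | Inr m \<Rightarrow> m) x) \<in> poly_functions hom M"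
    using f g by (intro poly_functions_sum) auto
  then show ?thesis
    by (subst (asm) sum.union_disjoint) (use f g in \<open>auto simp: sum.reindex\<close>)
qed

lemma poly_functions_mult:
  assumes "f \<in> poly_functions hom M" "g \<in> poly_functions hom M'"
    and "\<And>m m'. m \<in> M \<Longrightarrow> m' \<in> M' \<Longrightarrow> m + m' \<in> M''"
  shows "(\<lambda>x. f x * g x) \<in> poly_functions hom M''"
proof -
  obtain S c where f: "finite S" "S \<subseteq> M" "f = (\<lambda>x. \<Sum>m\<in>S. hom (c m) * monomial_value m x)"
    using poly_functionsE[OF assms(1)] .
  obtain T d where g: "finite T" "T \<subseteq> M'" "g = (\<lambda>x. \<Sum>m\<in>T. hom (d m) * monomial_value m x)"
    using poly_functionsE[OF assms(2)] .
  have "(\<lambda>x. \<Sum>s\<in>S \<times> T. hom (c (fst s) * d (snd s)) * monomial_value (fst s + snd s) x)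
      \<in> poly_functions hom M''"
    using f(1,2) g(1,2) assms(3) by (intro poly_functions_sum) (auto simp: subset_iff)
  also have "(\<lambda>x. \<Sum>s\<in>S \<times> T. hom (c (fst s) * d (snd s)) * monomial_value (fst s + snd s) x) =
      (\<lambda>x. f x * g x)"
    by (simp add: f(3) g(3) sum_product sum.cartesian_product hom_mult monomial_value_add
        case_prod_unfold algebra_simps)
  finally show ?thesis .
qed

lemma graded_poly_functions:
  assumes "0 \<in> M 0" "\<And>d d' m m'. m \<in> M d \<Longrightarrow> m' \<in> M d' \<Longrightarrow> m + m' \<in> M (d + d')"
  shows "graded_functions (\<lambda>d. poly_functions hom (M d))"
proof
  show "(\<lambda>x. 0) \<in> poly_functions hom (M d)" for d
    by (rule poly_functions_0)
  show "(\<lambda>x. 1) \<in> poly_functions hom (M 0)"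
    using poly_functions_const[OF assms(1), of 1] by simp
  show "(\<lambda>x. f x + g x) \<in> poly_functions hom (M d)"
    if "f \<in> poly_functions hom (M d)" "g \<in> poly_functions hom (M d)" for f g d
    using that by (rule poly_functions_add)
  show mult: "(\<lambda>x. f x * g x) \<in> poly_functions hom (M (d + d'))"
    if "f \<in> poly_functions hom (M d)" "g \<in> poly_functions hom (M d')" for f g d d'
    using that assms(2) by (rule poly_functions_mult)
  show "(\<lambda>x. - f x) \<in> poly_functions hom (M d)" if "f \<in> poly_functions hom (M d)" for f d
    using mult[OF poly_functions_const[OF assms(1), of "- 1"] that] by (simp add: hom_uminus)
qed

end

section \<open>Restriction to lines\<close>

definition univariate :: "nat \<Rightarrow> ('a::comm_ring_1 \<Rightarrow> 'a) set" where
  "univariate d = {poly P | P. Polynomial.degree P \<le> d}"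

lemma univariateI: "Polynomial.degree P \<le> d \<Longrightarrow> (\<And>s. f s = poly P s) \<Longrightarrow> f \<in> univariate d"
  unfolding univariate_def by (auto simp: fun_eq_iff)

interpretation univariate: graded_functions univariate
proof
  fix f g :: "'a \<Rightarrow> 'a" and d d' :: nat
  show "(\<lambda>x. 0 :: 'a) \<in> univariate d"
    by (rule univariateI[of 0]) auto
  show "(\<lambda>x. 1 :: 'a) \<in> univariate 0"
    by (rule univariateI[of 1]) auto
  assume "f \<in> univariate d"
  then obtain P where P: "Polynomial.degree P \<le> d" "f = poly P"
    unfolding univariate_def by auto
  show "(\<lambda>x. - f x) \<in> univariate d"
    using P by (intro univariateI[of "- P"]) auto
  show "(\<lambda>x. f x + g x) \<in> univariate d" if g: "g \<in> univariate d"
  proof -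
    obtain G where "Polynomial.degree G \<le> d" "g = poly G"
      using g unfolding univariate_def by auto
    then show ?thesis
      using P by (intro univariateI[of "P + G"]) (auto intro: degree_add_le)
  qed
  show "(\<lambda>x. f x * g x) \<in> univariate (d + d')" if g: "g \<in> univariate d'"
  proof -
    obtain G where "Polynomial.degree G \<le> d'" "g = poly G"
      using g unfolding univariate_def by auto
    then show ?thesis
      using P degree_mult_le[of P G] by (intro univariateI[of "P * G"]) auto
  qed
qed

lemma univariate_const [simp]: "(\<lambda>s. c) \<in> univariate d"
  by (rule univariateI[of "[:c:]"]) auto

lemma univariate_linear: "(\<lambda>s. b + s * c) \<in> univariate 1"
  by (rule univariateI[of "[:b, c:]"]) auto

lemma univariate_finite_zeros:
  fixes f :: "'a::idom \<Rightarrow> 'a"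
  assumes "f \<in> univariate d" "f s0 \<noteq> 0"
  shows "finite {s. f s = 0}"
proof -
  obtain P where "f = poly P"
    using assms(1) unfolding univariate_def by auto
  then show ?thesis
    using assms(2) poly_roots_finite[of P] by (cases "P = 0") auto
qed

lemma univariate_eq_0:
  fixes f :: "'a::idom \<Rightarrow> 'a"
  assumes "f \<in> univariate d" "finite Z" "card Z > d" "\<And>s. s \<in> Z \<Longrightarrow> f s = 0"
  shows "f s = 0"
proof -
  obtain P where P: "Polynomial.degree P \<le> d" "f = poly P"
    using assms(1) unfolding univariate_def by auto
  have "P = 0"
  proof (rule ccontr)
    assume "P \<noteq> 0"
    then have "card Z \<le> card {s. poly P s = 0}"
      using assms(4) P(2) poly_roots_finite by (intro card_mono) auto
    also have "\<dots> \<le> Polynomial.degree P"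
      using card_poly_roots_bound[OF \<open>P \<noteq> 0\<close>] .
    finally show False
      using assms(3) P(1) by simp
  qed
  then show ?thesis
    by (simp add: P)
qed

abbreviation monomial_degree :: "('v \<Rightarrow>\<^sub>0 nat) \<Rightarrow> nat" where
  "monomial_degree m \<equiv> \<Sum>v\<in>Poly_Mapping.keys m. Poly_Mapping.lookup m v"

lemma univariate_power:
  assumes "f \<in> univariate 1"
  shows "(\<lambda>s. f s ^ k) \<in> univariate k"
  using univariate.prod[of "{..<k}" "\<lambda>_. f" "\<lambda>_. 1"] assms by simp

lemma univariate_monomial_value:
  assumes "\<And>v. (\<lambda>s. x s v) \<in> univariate 1"
  shows "(\<lambda>s. monomial_value m (x s)) \<in> univariate (monomial_degree m)"
  unfolding monomial_value_def using assms by (intro univariate.prod univariate_power)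

lemma univariate_mono:
  assumes "f \<in> univariate d" "d \<le> d'"
  shows "f \<in> univariate d'"
  using assms unfolding univariate_def by auto

lemma eval_poly_on_line:
  fixes x y :: "'v \<Rightarrow> 'a::comm_ring_1"
  assumes "\<And>m. m \<in> Poly_Mapping.keys F \<Longrightarrow> monomial_degree m \<le> d"
  shows "(\<lambda>s. eval_poly F (\<lambda>v. x v + s * y v)) \<in> univariate d"
  unfolding eval_poly_superset[OF finite_keys subset_refl]
proof (rule univariate.sum)
  fix m assume m: "m \<in> Poly_Mapping.keys F"
  have "(\<lambda>s. monomial_value m (\<lambda>v. x v + s * y v)) \<in> univariate (monomial_degree m)"
    by (intro univariate_monomial_value univariate_linear)
  then have "(\<lambda>s. Poly_Mapping.lookup F m * monomial_value m (\<lambda>v. x v + s * y v))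
      \<in> univariate (0 + monomial_degree m)"
    by (rule univariate.mult[OF univariate_const])
  then show "(\<lambda>s. Poly_Mapping.lookup F m * monomial_value m (\<lambda>v. x v + s * y v)) \<in> univariate d"
    using univariate_mono assms[OF m] by simp
qed

lemma eval_poly_finite_zeros_on_line:
  fixes x y :: "'v \<Rightarrow> 'a::idom"
  assumes "eval_poly F (\<lambda>v. x v + s0 * y v) \<noteq> 0"
  shows "finite {s. eval_poly F (\<lambda>v. x v + s * y v) = 0}"
proof (rule univariate_finite_zeros)
  show "(\<lambda>s. eval_poly F (\<lambda>v. x v + s * y v))
      \<in> univariate (\<Sum>m\<in>Poly_Mapping.keys F. monomial_degree m)"
    by (rule eval_poly_on_line) (auto intro: member_le_sum)
qed (rule assms)

section \<open>Polynomials that vanish identically\<close>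

text \<open>
  The substitution \<open>x\<^sub>v = t\<close> to the power \<open>B ^ v\<close> turns a monomial into a power of \<open>t\<close>. For all but
  finitely many \<open>B\<close> it keeps the given monomials apart, since a coincidence of two exponents is a
  zero \<open>B\<close> of a nonzero univariate polynomial.
\<close>

lemma exists_separating_weights:
  fixes M :: "(nat \<Rightarrow>\<^sub>0 nat) set"
  assumes "finite M"
  obtains B :: nat where
    "inj_on (\<lambda>m. \<Sum>v\<in>Poly_Mapping.keys m. Poly_Mapping.lookup m v * B ^ v) M"
proof -
  define w where "w B m = (\<Sum>v\<in>Poly_Mapping.keys m. Poly_Mapping.lookup m v * B ^ v)"
    for B and m :: "nat \<Rightarrow>\<^sub>0 nat"
  have fin: "finite {B. w B m = w B m'}" if "m \<noteq> m'" for m m'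
  proof -
    define D where "D m = (\<Sum>v\<in>Poly_Mapping.keys m. Polynomial.monom (int (Poly_Mapping.lookup m v)) v)"
      for m :: "nat \<Rightarrow>\<^sub>0 nat"
    have coeff: "Polynomial.coeff (D m) v = int (Poly_Mapping.lookup m v)" for m v
      by (auto simp: D_def coeff_sum in_keys_iff sum.If_cases Int_def)
    have "D m - D m' \<noteq> 0"
      using that coeff by (metis eq_iff_diff_eq_0 of_nat_eq_iff poly_mapping_eqI)
    then have "finite {z. poly (D m - D m') z = 0}"
      by (rule poly_roots_finite)
    then have "finite (int -` {z. poly (D m - D m') z = 0})"
      by (rule finite_vimageI) (simp add: inj_on_def)
    moreover have "poly (D m) (int B) = int (w B m)" for m B
      by (simp add: D_def w_def poly_sum poly_monom)
    then have "{B. w B m = w B m'} \<subseteq> int -` {z. poly (D m - D m') z = 0}"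
      by auto
    ultimately show ?thesis
      using finite_subset by blast
  qed
  have "finite (\<Union>m\<in>M. \<Union>m'\<in>M - {m}. {B. w B m = w B m'})"
    using assms fin by (intro finite_UN_I finite_Diff) auto
  then obtain B where "B \<notin> (\<Union>m\<in>M. \<Union>m'\<in>M - {m}. {B. w B m = w B m'})"
    using ex_new_if_finite[OF infinite_UNIV_nat] by blast
  then have "inj_on (w B) M"
    by (auto simp: inj_on_def)
  then show ?thesis
    using that unfolding w_def by blast
qed

text \<open>
  A polynomial in several variables that vanishes identically is reduced to one variable by
  substituting powers of a single variable that keep its monomials apart.
\<close>

lemma eval_poly_identity:
  fixes F :: "(nat, 'a::idom) multipoly"
  assumes "infinite (UNIV :: 'a set)" "\<And>x. eval_poly F x = 0"
  shows "F = 0"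
proof -
  obtain B where inj:
    "inj_on (\<lambda>m. \<Sum>v\<in>Poly_Mapping.keys m. Poly_Mapping.lookup m v * B ^ v) (Poly_Mapping.keys F)"
    using exists_separating_weights[OF finite_keys] .
  let ?w = "\<lambda>m. \<Sum>v\<in>Poly_Mapping.keys m. Poly_Mapping.lookup m v * B ^ v"
  define P where "P = (\<Sum>m\<in>Poly_Mapping.keys F. Polynomial.monom (Poly_Mapping.lookup F m) (?w m))"
  have val: "monomial_value m (\<lambda>v. t ^ (B ^ v)) = t ^ ?w m" for m and t :: 'a
    unfolding monomial_value_def by (simp add: power_mult[symmetric] power_sum mult.commute)
  have "poly P t = eval_poly F (\<lambda>v. t ^ (B ^ v))" for t
    unfolding eval_poly_superset[OF finite_keys subset_refl] val
    by (simp add: P_def poly_sum poly_monom)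
  then have "poly P t = 0" for t
    by (simp add: assms(2))
  then have "P = 0"
    using assms(1) poly_roots_finite[of P] by auto
  have "Poly_Mapping.lookup F m = 0" if "m \<in> Poly_Mapping.keys F" for m
  proof -
    have "Polynomial.coeff P (?w m) =
        (\<Sum>m'\<in>Poly_Mapping.keys F. if m' = m then Poly_Mapping.lookup F m' else 0)"
      unfolding P_def coeff_sum using inj that
      by (intro sum.cong) (auto simp: inj_on_def)
    then show ?thesis
      using that \<open>P = 0\<close> by simp
  qed
  then show ?thesis
    by (metis in_keys_iff lookup_zero poly_mapping_eqI)
qed

section \<open>Forms\<close>

definition form_functions :: "nat \<Rightarrow> nat \<Rightarrow> ((nat \<Rightarrow> 'a::comm_ring_1) \<Rightarrow> 'a) set" where
  "form_functions n d = eval_poly ` forms n d"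

abbreviation form_monomials :: "nat \<Rightarrow> nat \<Rightarrow> (nat \<Rightarrow>\<^sub>0 nat) set" where
  "form_monomials n d \<equiv> {m. Poly_Mapping.keys m \<subseteq> {..n} \<and> monomial_degree m = d}"

lemma forms_iff: "F \<in> forms n d \<longleftrightarrow> Poly_Mapping.keys F \<subseteq> form_monomials n d"
  unfolding forms_def by auto

lemma monomial_degree_superset:
  assumes "finite V" "Poly_Mapping.keys m \<subseteq> V"
  shows "monomial_degree m = (\<Sum>v\<in>V. Poly_Mapping.lookup m v)"
  using assms by (intro sum.mono_neutral_left) (auto simp: in_keys_iff)

lemma monomial_degree_add: "monomial_degree (m + m') = monomial_degree m + monomial_degree m'"
proof -
  let ?V = "Poly_Mapping.keys m \<union> Poly_Mapping.keys m'"
  have "monomial_degree m = (\<Sum>v\<in>?V. Poly_Mapping.lookup m v)"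
    and "monomial_degree m' = (\<Sum>v\<in>?V. Poly_Mapping.lookup m' v)"
    by (rule monomial_degree_superset; simp)+
  moreover have "monomial_degree (m + m') = (\<Sum>v\<in>?V. Poly_Mapping.lookup (m + m') v)"
    by (rule monomial_degree_superset) (auto simp: keys_add_nat)
  ultimately show ?thesis
    by (simp only: lookup_add sum.distrib)
qed

lemma comm_ring_hom_id: "comm_ring_hom (\<lambda>c. c)"
  by unfold_locales auto

lemma form_functions_eq:
  "(form_functions n d :: ((nat \<Rightarrow> 'a::comm_ring_1) \<Rightarrow> 'a) set) =
    poly_functions (\<lambda>c. c) (form_monomials n d)"
proof -
  have "Poly_Mapping.map (\<lambda>c. c) F = F" for F :: "(nat, 'a) multipoly"
    using lookup_map_0[of "\<lambda>c. c" F] by (intro poly_mapping_eqI) blast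
  then show ?thesis
    unfolding form_functions_def poly_functions_def image_def forms_iff[symmetric]
    by (simp add: Bex_def conj_commute)
qed

interpretation form_functions: graded_functions "form_functions n" for n
proof -
  have "m + m' \<in> form_monomials n (d + d')"
    if m: "m \<in> form_monomials n d" "m' \<in> form_monomials n d'" for d d' m m'
  proof -
    have "Poly_Mapping.keys (m + m') \<subseteq> {..n}"
      using m by (simp add: keys_add_nat)
    moreover have "monomial_degree (m + m') = d + d'"
      using m unfolding monomial_degree_add by simp
    ultimately show ?thesis
      by blast
  qed
  then show "graded_functions (form_functions n)"
    unfolding form_functions_eq by (intro comm_ring_hom.graded_poly_functions[OF comm_ring_hom_id]) simp_all
qed

lemma form_functions_const: "(\<lambda>x. c) \<in> form_functions n 0"
  unfolding form_functions_eq by (rule comm_ring_hom.poly_functions_const[OF comm_ring_hom_id]) simp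

lemma form_functions_coord: "k \<le> n \<Longrightarrow> (\<lambda>x. x k) \<in> form_functions n 1"
  unfolding form_functions_eq by (rule comm_ring_hom.poly_functions_var[OF comm_ring_hom_id]) simp

lemma form_functions_on_line:
  assumes "f \<in> form_functions n d"
  shows "(\<lambda>s. f (\<lambda>i. x i + s * y i)) \<in> univariate d"
  using assms unfolding form_functions_def
  by (auto simp: forms_def intro!: eval_poly_on_line)

lemma monomial_value_scale:
  "monomial_value m (\<lambda>i. c * x i) = c ^ monomial_degree m * monomial_value m x"
  unfolding monomial_value_def by (simp add: power_mult_distrib prod.distrib power_sum)

lemma form_functions_scale:
  assumes "f \<in> form_functions n d"
  shows "f (\<lambda>i. c * x i) = c ^ d * f x"
proof -
  obtain F where F: "F \<in> forms n d" "f = eval_poly F"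
    using assms unfolding form_functions_def by auto
  have "Poly_Mapping.lookup F m * monomial_value m (\<lambda>i. c * x i) =
      c ^ d * (Poly_Mapping.lookup F m * monomial_value m x)" if "m \<in> Poly_Mapping.keys F" for m
  proof -
    have "monomial_degree m = d"
      using that F(1) unfolding forms_def by blast
    then show ?thesis
      unfolding monomial_value_scale by (simp only: mult.left_commute)
  qed
  then show ?thesis
    unfolding F(2) eval_poly_superset[OF finite_keys subset_refl] sum_distrib_left
    by (rule sum.cong[OF refl])
qed

lemma form_eq_0:
  fixes F :: "(nat, 'a::idom) multipoly"
  assumes "infinite (UNIV :: 'a set)" "F \<in> forms n d" "\<And>x. \<forall>i>n. x i = 0 \<Longrightarrow> eval_poly F x = 0"
  shows "F = 0"
proof (rule eval_poly_identity[OF assms(1)])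
  fix x :: "nat \<Rightarrow> 'a"
  let ?y = "\<lambda>i. if i \<le> n then x i else 0"
  have "monomial_value m x = monomial_value m ?y" if "m \<in> Poly_Mapping.keys F" for m
  proof -
    have "v \<le> n" if "v \<in> Poly_Mapping.keys m" for v
      using that \<open>m \<in> Poly_Mapping.keys F\<close> assms(2) unfolding forms_def by blast
    then show ?thesis
      unfolding monomial_value_def by (simp only: if_True cong: prod.cong)
  qed
  then have "(\<Sum>m\<in>Poly_Mapping.keys F. Poly_Mapping.lookup F m * monomial_value m x) =
      (\<Sum>m\<in>Poly_Mapping.keys F. Poly_Mapping.lookup F m * monomial_value m ?y)"
    by (rule sum.cong[OF refl arg_cong])
  then have "eval_poly F x = eval_poly F ?y"
    by (simp only: eval_poly_superset[OF finite_keys subset_refl])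
  also have "\<dots> = 0"
    by (rule assms(3)) simp
  finally show "eval_poly F x = 0" .
qed

section \<open>Linear algebra\<close>

definition linear_functional :: "((nat \<Rightarrow> 'a::field) \<Rightarrow> 'a) \<Rightarrow> bool" where
  "linear_functional \<phi> \<longleftrightarrow>
    (\<forall>x y. \<phi> (x + y) = \<phi> x + \<phi> y) \<and> (\<forall>c x. \<phi> (fscale c x) = c * \<phi> x)"

lemma linear_functional_add: "linear_functional \<phi> \<Longrightarrow> \<phi> (x + y) = \<phi> x + \<phi> y"
  and linear_functional_scale: "linear_functional \<phi> \<Longrightarrow> \<phi> (fscale c x) = c * \<phi> x"
  by (auto simp: linear_functional_def)

lemma linear_functional_0: "linear_functional \<phi> \<Longrightarrow> \<phi> 0 = 0"
  using linear_functional_scale[of \<phi> 0 0] by simp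

lemma linear_functional_diff: "linear_functional \<phi> \<Longrightarrow> \<phi> (x - y) = \<phi> x - \<phi> y"
  using linear_functional_add[of \<phi> "x - y" y] by simp

definition unit_vector :: "nat \<Rightarrow> nat \<Rightarrow> 'a::field" where
  "unit_vector k = (\<lambda>i. if i = k then 1 else 0)"

lemma unit_vector_in_vecs: "k \<le> n \<Longrightarrow> unit_vector k \<in> vecs n"
  by (auto simp: unit_vector_def vecs_def)

lemma subspace_vecs: "fvs.subspace (vecs n)"
  by (auto simp: fvs.subspace_def vecs_def fscale_def)

lemma sum_fun_apply: "(\<Sum>s\<in>S. f s) i = (\<Sum>s\<in>S. f s i)"
  for f :: "'s \<Rightarrow> 'i \<Rightarrow> 'a::comm_monoid_add"
  by (induction S rule: infinite_finite_induct) auto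

lemma vecs_expansion:
  assumes "x \<in> vecs n"
  shows "x = (\<Sum>k\<le>n. fscale (x k) (unit_vector k))"
proof
  fix i
  have "(\<Sum>k\<le>n. fscale (x k) (unit_vector k)) i = (\<Sum>k\<le>n. if k = i then x k else 0)"
    unfolding sum_fun_apply by (intro sum.cong) (auto simp: fscale_def unit_vector_def)
  also have "\<dots> = x i"
    using assms by (auto simp: vecs_def)
  finally show "x i = (\<Sum>k\<le>n. fscale (x k) (unit_vector k)) i"
    by simp
qed

lemma vecs_subset_span: "vecs n \<subseteq> fvs.span (unit_vector ` {..n})"
proof
  fix x :: "nat \<Rightarrow> 'a" assume "x \<in> vecs n"
  moreover have "(\<Sum>k\<le>n. fscale (x k) (unit_vector k)) \<in> fvs.span (unit_vector ` {..n})"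
    by (intro fvs.span_sum fvs.span_scale fvs.span_base) auto
  ultimately show "x \<in> fvs.span (unit_vector ` {..n})"
    using vecs_expansion by metis
qed

lemma finite_independent_vecs:
  assumes "\<not> fvs.dependent B" "B \<subseteq> vecs n"
  shows "finite B"
  using fvs.independent_span_bound[of "unit_vector ` {..n}" B] assms vecs_subset_span[of n]
  by blast

lemma subspace_basisE:
  assumes "fvs.subspace W" "W \<subseteq> vecs n"
  obtains B where "B \<subseteq> W" "\<not> fvs.dependent B" "fvs.span B = W" "finite B" "card B = fvs.dim W"
proof -
  obtain B where B: "B \<subseteq> W" "\<not> fvs.dependent B" "W \<subseteq> fvs.span B" "card B = fvs.dim W"
    using fvs.basis_exists[of W] by blast
  then have "fvs.span B = W"
    using fvs.span_minimal[OF B(1) assms(1)] by blast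
  moreover have "finite B"
    using finite_independent_vecs B(1,2) assms(2) by blast
  ultimately show ?thesis
    using that B by blast
qed

lemma extend_basisE:
  assumes "fvs.subspace W" "W \<subseteq> vecs n" "B \<subseteq> W" "\<not> fvs.dependent B"
  obtains B' where "B \<subseteq> B'" "B' \<subseteq> W" "\<not> fvs.dependent B'" "fvs.span B' = W" "finite B'"
    "card B' = fvs.dim W"
proof -
  obtain B' where B: "B \<subseteq> B'" "B' \<subseteq> W" "\<not> fvs.dependent B'" "W \<subseteq> fvs.span B'"
    using fvs.maximal_independent_subset_extend[OF assms(3,4)] by blast
  then have "fvs.span B' = W"
    using fvs.span_minimal[OF B(2) assms(1)] by blast
  moreover have "finite B'"
    using finite_independent_vecs B(2,3) assms(2) by blast
  moreover have "card B' = fvs.dim W"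
    using fvs.basis_card_eq_dim[OF B(2) B(4) B(3)] .
  ultimately show ?thesis
    using that B by blast
qed

lemma dim_eq_0D:
  assumes "fvs.subspace W" "W \<subseteq> vecs n" "fvs.dim W = 0" "x \<in> W"
  shows "x = 0"
proof -
  obtain B where "fvs.span B = W" "finite B" "card B = fvs.dim W"
    using subspace_basisE[OF assms(1,2)] by metis
  then have "W = fvs.span {}"
    using assms(3) by simp
  then show ?thesis
    using assms(4) by simp
qed

lemma subspace_kernel:
  assumes "fvs.subspace W" "linear_functional \<phi>"
  shows "fvs.subspace {x \<in> W. \<phi> x = 0}"
  using assms(1) unfolding fvs.subspace_def
  by (auto simp: linear_functional_0[OF assms(2)] linear_functional_add[OF assms(2)]
      linear_functional_scale[OF assms(2)])

text \<open>
  A basis of the kernel together with \<open>w\<close> is a basis of \<open>W\<close>.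
\<close>

lemma dim_kernel:
  assumes W: "fvs.subspace W" "W \<subseteq> vecs n" and \<phi>: "linear_functional \<phi>"
    and w: "w \<in> W" "\<phi> w \<noteq> 0"
  shows "fvs.dim W = Suc (fvs.dim {x \<in> W. \<phi> x = 0})"
proof -
  let ?K = "{x \<in> W. \<phi> x = 0}"
  have K: "?K \<subseteq> vecs n"
    using W(2) by blast
  obtain B where B: "B \<subseteq> ?K" "\<not> fvs.dependent B" "fvs.span B = ?K" "finite B"
    "card B = fvs.dim ?K"
    by (rule subspace_basisE[OF subspace_kernel[OF W(1) \<phi>] K])
  have "w \<notin> fvs.span B"
    using w by (simp add: B(3))
  then have indep: "\<not> fvs.dependent (insert w B)"
    using B(2) by (rule fvs.independent_insertI)
  have "W \<subseteq> fvs.span (insert w B)"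
  proof
    fix x assume x: "x \<in> W"
    have "x - fscale (\<phi> x / \<phi> w) w \<in> ?K"
      using x w \<phi> fvs.subspace_diff[OF W(1) x fvs.subspace_scale[OF W(1) w(1)]]
      by (simp add: linear_functional_diff[OF \<phi>] linear_functional_scale[OF \<phi>])
    then show "x \<in> fvs.span (insert w B)"
      unfolding fvs.span_breakdown_eq B(3) by blast
  qed
  moreover have "insert w B \<subseteq> W"
    using B(1) w(1) by blast
  ultimately have "fvs.dim W = card (insert w B)"
    using fvs.dim_unique indep by metis
  moreover have "w \<notin> B"
    using \<open>w \<notin> fvs.span B\<close> fvs.span_base by blast
  ultimately show ?thesis
    using B(4,5) by simp
qed

lemma linear_functional_coord: "linear_functional (\<lambda>x. x k)"
  by (simp add: linear_functional_def fscale_def)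

lemma dim_span_singleton:
  assumes "x \<noteq> 0"
  shows "fvs.dim (fvs.span {x}) = 1"
proof -
  have "\<not> fvs.dependent {x}"
    using assms by simp
  then show ?thesis
    using fvs.dim_span_eq_card_independent[of "{x}"] by simp
qed

lemma dim_vecs: "fvs.dim (vecs n :: (nat \<Rightarrow> 'a::field) set) = n + 1"
proof (induction n)
  case 0
  let ?u = "unit_vector 0 :: nat \<Rightarrow> 'a"
  have "vecs 0 \<subseteq> fvs.span {?u}"
    using vecs_subset_span[of 0] by simp
  moreover have "fvs.span {?u} \<subseteq> vecs 0"
    by (intro fvs.span_minimal subspace_vecs) (simp add: unit_vector_in_vecs)
  moreover have "?u \<noteq> 0"
    by (auto simp: unit_vector_def fun_eq_iff)
  ultimately show ?case
    using dim_span_singleton[of ?u] by simp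
next
  case (Suc n)
  have "{x \<in> vecs (Suc n). x (Suc n) = 0} = (vecs n :: (nat \<Rightarrow> 'a) set)"
    unfolding vecs_def by (auto, metis Suc_lessI)
  moreover have "fvs.dim (vecs (Suc n) :: (nat \<Rightarrow> 'a) set) =
      Suc (fvs.dim {x \<in> vecs (Suc n) :: (nat \<Rightarrow> 'a) set. x (Suc n) = 0})"
    by (rule dim_kernel[OF subspace_vecs subset_refl linear_functional_coord
          unit_vector_in_vecs[of "Suc n" "Suc n"]]) (simp_all add: unit_vector_def)
  ultimately show ?case
    using Suc by simp
qed

lemma subspace_common_kernel:
  assumes "fvs.subspace W" "\<And>r. r \<in> R \<Longrightarrow> linear_functional (\<phi> r)"
  shows "fvs.subspace {x \<in> W. \<forall>r\<in>R. \<phi> r x = 0}"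
proof -
  have "\<phi> r 0 = 0" "\<phi> r (x + y) = \<phi> r x + \<phi> r y" "\<phi> r (fscale c x) = c * \<phi> r x"
    if "r \<in> R" for r x y c
    using assms(2)[OF that]
    by (rule linear_functional_0 linear_functional_add linear_functional_scale)+
  then show ?thesis
    using assms(1) unfolding fvs.subspace_def by auto
qed

lemma dim_common_kernel_ge:
  assumes "finite R" "\<And>r. r \<in> R \<Longrightarrow> linear_functional (\<phi> r)"
  shows "fvs.dim {x \<in> vecs n. \<forall>r\<in>R. \<phi> r x = 0} + card R \<ge> n + 1"
  using assms
proof (induction R)
  case empty
  then show ?case by (simp add: dim_vecs)
next
  case (insert s R)
  let ?W = "{x \<in> vecs n. \<forall>r\<in>R. \<phi> r x = 0}"
  have W: "fvs.subspace ?W" "?W \<subseteq> vecs n"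
    using insert.prems by (auto intro: subspace_common_kernel[OF subspace_vecs])
  have eq: "{x \<in> vecs n. \<forall>r\<in>insert s R. \<phi> r x = 0} = {x \<in> ?W. \<phi> s x = 0}"
    by auto
  have "fvs.dim ?W \<le> Suc (fvs.dim {x \<in> ?W. \<phi> s x = 0})"
  proof (cases "\<exists>w\<in>?W. \<phi> s w \<noteq> 0")
    case True
    then obtain w where w: "w \<in> ?W" "\<phi> s w \<noteq> 0"
      by blast
    have "linear_functional (\<phi> s)"
      using insert.prems by simp
    from dim_kernel[OF W this w] show ?thesis
      by simp
  next
    case False
    then have "{x \<in> ?W. \<phi> s x = 0} = ?W"
      by blast
    then show ?thesis
      by simp
  qed
  then show ?case
    using insert unfolding eq by simp
qed

lemma exists_common_zero:
  assumes "finite R" "card R \<le> n" "\<And>r. r \<in> R \<Longrightarrow> linear_functional (\<phi> r)"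
  obtains x where "x \<in> vecs n" "x \<noteq> 0" "\<And>r. r \<in> R \<Longrightarrow> \<phi> r x = 0"
proof -
  let ?W = "{x \<in> vecs n. \<forall>r\<in>R. \<phi> r x = 0}"
  have "fvs.dim ?W \<noteq> 0"
    using dim_common_kernel_ge[of R \<phi> n] assms by simp
  moreover have "fvs.dim ?W = 0" if "?W \<subseteq> {0}"
    using fvs.dim_unique[of "{}" ?W 0] fvs.independent_empty that by simp
  ultimately have "\<not> ?W \<subseteq> {0}"
    by (rule contrapos_nn)
  then show ?thesis
    using that by blast
qed

text \<open>
  If each of the \<open>n + 1\<close> functionals were nonzero somewhere on the common kernel of the others, then
  imposing them one after the other would lower the dimension by one each time, down to \<open>0\<close>; but
  \<open>z\<close> stays in the kernel.
\<close>

lemma exists_redundant_functional: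
  assumes \<phi>: "\<And>i. i \<le> n \<Longrightarrow> linear_functional (\<phi> i)"
    and z: "z \<in> vecs n" "z \<noteq> 0" "\<And>i. i \<le> n \<Longrightarrow> \<phi> i z = 0"
  shows "\<exists>k\<le>n. \<forall>x\<in>vecs n. (\<forall>i\<in>{..n} - {k}. \<phi> i x = 0) \<longrightarrow> \<phi> k x = 0"
proof (rule ccontr)
  assume no: "\<not> ?thesis"
  have ex: "\<exists>y\<in>vecs n. (\<forall>i\<in>{..n} - {k}. \<phi> i y = 0) \<and> \<phi> k y \<noteq> 0" if "k \<le> n" for k
    using no that by blast
  let ?W = "\<lambda>k. {x \<in> vecs n. \<forall>i\<in>{..<k}. \<phi> i x = 0}"
  have sub: "fvs.subspace (?W k)" if "k \<le> Suc n" for k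
    using that \<phi> by (intro subspace_common_kernel[OF subspace_vecs]) auto
  have "fvs.dim (?W k) + k = n + 1" if "k \<le> Suc n" for k
    using that
  proof (induction k)
    case 0
    then show ?case by (simp add: dim_vecs)
  next
    case (Suc k)
    then have "k \<le> n" by simp
    then obtain y where y: "y \<in> vecs n" "\<forall>i\<in>{..n} - {k}. \<phi> i y = 0" "\<phi> k y \<noteq> 0"
      using ex by blast
    have "?W (Suc k) = {x \<in> ?W k. \<phi> k x = 0}"
      by (auto simp: lessThan_Suc)
    moreover have "y \<in> ?W k"
      using y \<open>k \<le> n\<close> by auto
    ultimately show ?case
      using dim_kernel[OF sub[of k] _ \<phi>[OF \<open>k \<le> n\<close>], of n y] y(3) Suc by auto
  qed
  from this[of "Suc n"] have "fvs.dim (?W (Suc n)) = 0"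
    by simp
  then have "z = 0"
    using z by (intro dim_eq_0D[OF sub[of "Suc n"], of n]) auto
  then show False
    using z(2) by simp
qed

lemma span_pair_iff: "y \<in> fvs.span {x, v} \<longleftrightarrow> (\<exists>a b. y = fscale a x + fscale b v)"
  unfolding fvs.span_breakdown_eq fvs.span_empty
  by (auto simp: algebra_simps)

text \<open>
  Extend a basis of \<open>W\<close> to a basis of the whole space. The coordinates with respect to the additional
  basis vectors are the equations of \<open>W\<close>.
\<close>

lemma subspace_cut_out:
  assumes W: "fvs.subspace W" "W \<subseteq> vecs n" "fvs.dim W + r = n + 1"
  obtains c where "W = {x \<in> vecs n. \<forall>j<r. (\<Sum>k\<le>n. c j k * x k) = 0}"
proof -
  obtain B where B: "B \<subseteq> W" "\<not> fvs.dependent B" "fvs.span B = W" "finite B" "card B = fvs.dim W"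
    using subspace_basisE[OF W(1,2)] .
  obtain B' where B': "B \<subseteq> B'" "B' \<subseteq> vecs n" "\<not> fvs.dependent B'" "fvs.span B' = vecs n"
    "finite B'" "card B' = fvs.dim (vecs n :: (nat \<Rightarrow> 'a) set)"
    using extend_basisE[OF subspace_vecs subset_refl _ B(2), of n] B(1) W(2) by blast
  define f where "f x u = fvs.representation B' x u" for x u
  have "card (B' - B) = r"
    using B(5) B'(6) W(3) card_Diff_subset[OF B(4) B'(1)] by (simp add: dim_vecs)
  then obtain u where u: "bij_betw u {..<r} (B' - B)"
    using ex_bij_betw_nat_finite[of "B' - B"] B'(5) by (auto simp: atLeast0LessThan)
  have in_W: "x \<in> W \<longleftrightarrow> (\<forall>b\<in>B' - B. f x b = 0)" if x: "x \<in> vecs n" for x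
  proof
    assume "x \<in> W"
    then have "fvs.representation B' x = fvs.representation B x"
      using fvs.representation_extend[OF B'(3) _ B'(1)] B(3) by simp
    then show "\<forall>b\<in>B' - B. f x b = 0"
      using fvs.representation_ne_zero[of B x] by (auto simp: f_def)
  next
    assume *: "\<forall>b\<in>B' - B. f x b = 0"
    have "x = (\<Sum>b\<in>B'. fscale (f x b) b)"
      using fvs.sum_representation_eq[OF B'(3) _ B'(5) subset_refl] x B'(4) by (simp add: f_def)
    also have "\<dots> = (\<Sum>b\<in>B. fscale (f x b) b)"
      using * B' by (intro sum.mono_neutral_right) (auto simp: fscale_def fun_eq_iff)
    also have "\<dots> \<in> fvs.span B"
      by (intro fvs.span_sum fvs.span_scale fvs.span_base)
    finally show "x \<in> W"
      by (simp add: B(3))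
  qed
  have f_add: "f (x + y) b = f x b + f y b" if "x \<in> vecs n" "y \<in> vecs n" for x y b
    using fvs.representation_add[OF B'(3), of y x] that by (simp add: f_def B'(4))
  have f_scale: "f (fscale c x) b = c * f x b" if "x \<in> vecs n" for c x b
    using fvs.representation_scale[OF B'(3), of x c] that by (simp add: f_def B'(4))
  have expand: "f x b = (\<Sum>k\<le>n. f (unit_vector k) b * x k)" if x: "x \<in> vecs n" for x b
  proof -
    have "f (\<Sum>k\<in>S. fscale (x k) (unit_vector k)) b = (\<Sum>k\<in>S. f (unit_vector k) b * x k)"
      if "finite S" "S \<subseteq> {..n}" for S
      using that
    proof (induction S)
      case empty
      then show ?case
        using fvs.representation_zero[of B'] by (simp add: f_def zero_fun_def)
    next
      case (insert k S)
      have unit: "(unit_vector l :: nat \<Rightarrow> 'a) \<in> vecs n" if "l \<in> insert k S" for l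
        using that insert.prems by (auto intro: unit_vector_in_vecs)
      let ?s = "\<Sum>k\<in>S. fscale (x k) (unit_vector k)"
      have "?s \<in> vecs n"
        using unit by (intro fvs.subspace_sum subspace_vecs fvs.subspace_scale) simp
      moreover have "fscale (x k) (unit_vector k) \<in> vecs n"
        using unit by (intro subspace_vecs fvs.subspace_scale) simp
      ultimately have "f (fscale (x k) (unit_vector k) + ?s) b = f (fscale (x k) (unit_vector k)) b + f ?s b"
        by (intro f_add)
      also have "f (fscale (x k) (unit_vector k)) b = x k * f (unit_vector k) b"
        using unit by (intro f_scale) simp
      finally show ?case
        using insert by (simp add: mult.commute)
    qed
    then show ?thesis
      using vecs_expansion[OF x] by (metis finite_atMost subset_refl)
  qed
  have "W = {x \<in> vecs n. \<forall>b\<in>u ` {..<r}. f x b = 0}"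
    using in_W W(2) u unfolding bij_betw_def by auto
  also have "\<dots> = {x \<in> vecs n. \<forall>j<r. (\<Sum>k\<le>n. f (unit_vector k) (u j) * x k) = 0}"
  proof -
    have "(\<forall>b\<in>u ` {..<r}. f x b = 0) \<longleftrightarrow>
        (\<forall>j<r. (\<Sum>k\<le>n. f (unit_vector k) (u j) * x k) = 0)" if "x \<in> vecs n" for x
      using expand[OF that] by auto
    then show ?thesis
      by (intro Collect_cong conj_cong refl)
  qed
  finally show ?thesis
    by (rule that[of "\<lambda>j k. f (unit_vector k) (u j)"])
qed

section \<open>Points and lines\<close>

lemma in_span_singleton_iff: "y \<in> fvs.span {x} \<longleftrightarrow> (\<exists>c. y = fscale c x)"
  by (auto simp: fvs.span_singleton)

lemma span_singleton_subset_iff: "fvs.subspace W \<Longrightarrow> fvs.span {x} \<subseteq> W \<longleftrightarrow> x \<in> W"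
  using fvs.span_minimal[of "{x}" W] fvs.span_base[of x "{x}"] by auto

lemma proj_space_iff: "p \<in> proj_space n \<longleftrightarrow> (\<exists>x\<in>vecs n. x \<noteq> 0 \<and> p = fvs.span {x})"
proof
  assume "p \<in> proj_space n"
  then have p: "fvs.subspace p" "p \<subseteq> vecs n" "fvs.dim p = 1"
    by (auto simp: proj_space_def linear_subspaces_def)
  then obtain B where B: "B \<subseteq> p" "\<not> fvs.dependent B" "fvs.span B = p" "card B = 1"
    using subspace_basisE[of p n] by metis
  then obtain x where x: "B = {x}"
    by (auto simp: card_1_singleton_iff)
  then have "x \<noteq> 0"
    using B(2) fvs.dependent_zero by auto
  then show "\<exists>x\<in>vecs n. x \<noteq> 0 \<and> p = fvs.span {x}"
    using x B p(2) by auto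
next
  assume "\<exists>x\<in>vecs n. x \<noteq> 0 \<and> p = fvs.span {x}"
  then show "p \<in> proj_space n"
    using span_singleton_subset_iff[OF subspace_vecs]
    by (auto simp: proj_space_def linear_subspaces_def dim_span_singleton simp del: fvs.dim_span)
qed

lemma proj_iff:
  assumes "fvs.subspace W" "W \<subseteq> vecs n"
  shows "p \<in> proj n W \<longleftrightarrow> (\<exists>x\<in>W. x \<noteq> 0 \<and> p = fvs.span {x})"
proof -
  have "fvs.span {x} \<subseteq> W \<longleftrightarrow> x \<in> W" for x
    by (rule span_singleton_subset_iff[OF assms(1)])
  then show ?thesis
    using assms(2) unfolding proj_def mem_Collect_eq proj_space_iff by blast
qed

lemma subspace_dim_2E:
  assumes W: "fvs.subspace W" "W \<subseteq> vecs n" "fvs.dim W = 2" and x: "x \<in> W" "x \<noteq> 0"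
  obtains v where "v \<in> W" "v \<notin> fvs.span {x}" "W = fvs.span {x, v}"
proof -
  have "{x} \<subseteq> W" "\<not> fvs.dependent {x}"
    using x by simp_all
  then obtain B where B: "{x} \<subseteq> B" "B \<subseteq> W" "\<not> fvs.dependent B" "fvs.span B = W" "card B = 2"
    using extend_basisE[OF W(1,2), of "{x}"] W(3) by metis
  obtain v where v: "B = {x, v}" "v \<noteq> x"
    using B(1,5) by (metis card_2_iff doubleton_eq_iff insert_subset insertE singletonD)
  have "v \<notin> fvs.span {x}"
    using B(3) v fvs.independent_insert[of v "{x}"] by (simp add: insert_commute)
  then show ?thesis
    using that v B by blast
qed

lemma dim_span_pair:
  assumes "x \<noteq> 0" "v \<notin> fvs.span {x}"
  shows "fvs.dim (fvs.span {x, v}) = 2"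
proof -
  have "\<not> fvs.dependent {x}"
    using assms(1) by simp
  with assms(2) have "\<not> fvs.dependent (insert v {x})"
    by (rule fvs.independent_insertI)
  moreover have "v \<noteq> x"
    using assms(2) fvs.span_base[of x "{x}"] by blast
  ultimately show ?thesis
    using fvs.dim_span_eq_card_independent[of "{v, x}"] by (simp add: insert_commute)
qed

section \<open>Subspaces of codimension 2 and the hyperplanes joining them to points\<close>

definition equation :: "nat \<Rightarrow> (eqvar \<Rightarrow> 'a::field) \<Rightarrow> nat \<Rightarrow> nat \<Rightarrow> (nat \<Rightarrow> 'a) \<Rightarrow> 'a" where
  "equation n e i r x = (\<Sum>k\<le>n. e (i, r, k) * x k)"

definition codim2_space :: "nat \<Rightarrow> (eqvar \<Rightarrow> 'a::field) \<Rightarrow> nat \<Rightarrow> (nat \<Rightarrow> 'a) set" where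
  "codim2_space n e i = {x \<in> vecs n. \<forall>r<2. equation n e i r x = 0}"

text \<open>
  If \<open>p\<close> does not lie on the subspace, this is the equation of the hyperplane that joins \<open>p\<close> to it. If
  \<open>p\<close> lies on the subspace, then it is zero, in accordance with the fact that every line through \<open>p\<close>
  meets the subspace.
\<close>

definition joining_form :: "nat \<Rightarrow> (eqvar \<Rightarrow> 'a::field) \<Rightarrow> nat \<Rightarrow> (nat \<Rightarrow> 'a) \<Rightarrow> (nat \<Rightarrow> 'a) \<Rightarrow> 'a" where
  "joining_form n e i p x =
     equation n e i 0 p * equation n e i 1 x - equation n e i 1 p * equation n e i 0 x"

lemma vecs_nonzeroD: "x \<in> vecs n \<Longrightarrow> x c \<noteq> 0 \<Longrightarrow> c \<le> n"
  by (rule ccontr) (simp add: vecs_def)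

lemma all_less_2: "(\<forall>r<2. P r) \<longleftrightarrow> P 0 \<and> P (1::nat)"
  by (auto simp: less_2_cases_iff)

lemma equation_add: "equation n e i r (x + y) = equation n e i r x + equation n e i r y"
  by (simp add: equation_def algebra_simps sum.distrib)

lemma equation_scale: "equation n e i r (fscale c x) = c * equation n e i r x"
  by (simp add: equation_def fscale_def sum_distrib_left algebra_simps)

lemma linear_functional_equation: "linear_functional (equation n e i r)"
  unfolding linear_functional_def by (simp only: equation_add equation_scale simp_thms)

lemma equation_diff: "equation n e i r (x - y) = equation n e i r x - equation n e i r y"
  by (rule linear_functional_diff[OF linear_functional_equation])

lemma equation_0: "equation n e i r 0 = 0"
  by (rule linear_functional_0[OF linear_functional_equation])

lemma linear_functional_joining_form: "linear_functional (joining_form n e i p)"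
  unfolding linear_functional_def joining_form_def equation_add equation_scale
  by (simp add: algebra_simps)

lemma joining_form_add: "joining_form n e i p (x + y) = joining_form n e i p x + joining_form n e i p y"
  by (rule linear_functional_add[OF linear_functional_joining_form])

lemma joining_form_scale: "joining_form n e i p (fscale c x) = c * joining_form n e i p x"
  by (rule linear_functional_scale[OF linear_functional_joining_form])

lemma joining_form_diff: "joining_form n e i p (x - y) = joining_form n e i p x - joining_form n e i p y"
  by (rule linear_functional_diff[OF linear_functional_joining_form])

lemma joining_form_self: "joining_form n e i p p = 0"
  by (simp add: joining_form_def)

lemma codim2_space_iff:
  "x \<in> codim2_space n e i \<longleftrightarrow>
     x \<in> vecs n \<and> equation n e i 0 x = 0 \<and> equation n e i 1 x = 0"
  by (auto simp: codim2_space_def all_less_2)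

lemma subspace_codim2_space: "fvs.subspace (codim2_space n e i)"
proof -
  have "codim2_space n e i = {x \<in> vecs n. \<forall>r\<in>{..<2}. equation n e i r x = 0}"
    unfolding codim2_space_def by auto
  then show ?thesis
    using subspace_common_kernel[OF subspace_vecs linear_functional_equation] by simp
qed

lemma vecs_lincomb: "x \<in> vecs n \<Longrightarrow> y \<in> vecs n \<Longrightarrow> fscale a x + fscale b y \<in> vecs n"
  by (intro fvs.subspace_add fvs.subspace_scale subspace_vecs)

text \<open>
  The right-hand side says that the line through \<open>p\<close> and \<open>x\<close> meets the subspace. It does not mention
  the equations, so the zero set of the joining form depends on the subspace only.
\<close>

lemma joining_form_eq_0_iff:
  assumes "p \<in> vecs n" "x \<in> vecs n"
  shows "joining_form n e i p x = 0 \<longleftrightarrow>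
    (\<exists>a b. (a \<noteq> 0 \<or> b \<noteq> 0) \<and> fscale a p + fscale b x \<in> codim2_space n e i)"
proof
  assume *: "joining_form n e i p x = 0"
  consider "p \<in> codim2_space n e i" | "equation n e i 0 p \<noteq> 0" | "equation n e i 1 p \<noteq> 0"
    using assms(1) by (auto simp: codim2_space_iff)
  then show "\<exists>a b. (a \<noteq> 0 \<or> b \<noteq> 0) \<and> fscale a p + fscale b x \<in> codim2_space n e i"
  proof cases
    case 1
    then show ?thesis
      by (intro exI[of _ 1] exI[of _ 0]) simp
  next
    case 2
    have "fscale (- equation n e i 0 x) p + fscale (equation n e i 0 p) x \<in> codim2_space n e i"
      using * unfolding codim2_space_iff equation_add equation_scale joining_form_def
      by (intro conjI vecs_lincomb[OF assms]) (simp_all add: algebra_simps)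
    then show ?thesis
      using 2 by blast
  next
    case 3
    have "fscale (- equation n e i 1 x) p + fscale (equation n e i 1 p) x \<in> codim2_space n e i"
      using * unfolding codim2_space_iff equation_add equation_scale joining_form_def
      by (intro conjI vecs_lincomb[OF assms]) (simp_all add: algebra_simps)
    then show ?thesis
      using 3 by blast
  qed
next
  assume "\<exists>a b. (a \<noteq> 0 \<or> b \<noteq> 0) \<and> fscale a p + fscale b x \<in> codim2_space n e i"
  then obtain a b where ab: "a \<noteq> 0 \<or> b \<noteq> 0"
    and z: "a * equation n e i 0 p + b * equation n e i 0 x = 0"
      "a * equation n e i 1 p + b * equation n e i 1 x = 0"
    unfolding codim2_space_iff equation_add equation_scale by blast
  have "a * joining_form n e i p x =
      (a * equation n e i 0 p + b * equation n e i 0 x) * equation n e i 1 x -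
      (a * equation n e i 1 p + b * equation n e i 1 x) * equation n e i 0 x"
    and "b * joining_form n e i p x =
      (a * equation n e i 1 p + b * equation n e i 1 x) * equation n e i 0 p -
      (a * equation n e i 0 p + b * equation n e i 0 x) * equation n e i 1 p"
    unfolding joining_form_def by (simp_all add: algebra_simps)
  then have "a * joining_form n e i p x = 0" "b * joining_form n e i p x = 0"
    unfolding z by simp_all
  then show "joining_form n e i p x = 0"
    using ab by auto
qed

lemma equation_proportional:
  assumes "p \<in> vecs n" "p \<notin> codim2_space n e i" "joining_form n e i p v = 0"
  obtains s where "\<And>r. r < 2 \<Longrightarrow> equation n e i r v = s * equation n e i r p"
proof -
  obtain r where r: "r < 2" "equation n e i r p \<noteq> 0"
    using assms(1,2) unfolding codim2_space_def by blast
  have "equation n e i r' v = equation n e i r v / equation n e i r p * equation n e i r' p"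
    if "r' < 2" for r'
  proof -
    have "equation n e i r' v * equation n e i r p = equation n e i r v * equation n e i r' p"
      using that r(1) assms(3) unfolding joining_form_def less_2_cases_iff
      by (auto simp: mult.commute)
    then show ?thesis
      using r(2) by (simp add: nonzero_eq_divide_eq)
  qed
  then show ?thesis
    using that by blast
qed

lemma joining_form_eq_0_if_proportional:
  assumes "\<And>r. r < 2 \<Longrightarrow> equation n e i r v = s * equation n e i r p"
  shows "joining_form n e i p v = 0"
  using assms[of 0] assms[of 1] by (simp add: joining_form_def)

text \<open>
  Besides the joining forms, a coordinate that is nonzero at \<open>p\<close> is imposed; this excludes the
  multiples of \<open>p\<close>.
\<close>

lemma exists_transversal_direction:
  assumes p: "p \<in> vecs n" "p \<noteq> 0" and J: "finite J" "card J < n"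
  obtains v where "v \<in> vecs n" "v \<notin> fvs.span {p}" "\<And>i. i \<in> J \<Longrightarrow> joining_form n e i p v = 0"
proof -
  obtain c where c: "p c \<noteq> 0"
    using p(2) by (auto simp: fun_eq_iff)
  define \<phi> where "\<phi> i = (case i of None \<Rightarrow> (\<lambda>x. x c) | Some i \<Rightarrow> joining_form n e i p)" for i
  have lin: "linear_functional (\<phi> i)" for i
    unfolding \<phi>_def by (cases i) (simp_all add: linear_functional_coord linear_functional_joining_form)
  have "card (insert None (Some ` J)) \<le> n"
    using J by (simp add: card_image)
  then obtain v where v: "v \<in> vecs n" "v \<noteq> 0" "\<And>i. i \<in> insert None (Some ` J) \<Longrightarrow> \<phi> i v = 0"
    using exists_common_zero[of "insert None (Some ` J)" n \<phi>] J(1) lin by blast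
  have "v \<notin> fvs.span {p}"
  proof
    assume "v \<in> fvs.span {p}"
    then obtain a where a: "v = fscale a p"
      unfolding in_span_singleton_iff by blast
    moreover have "v c = 0"
      using v(3)[of None] by (simp add: \<phi>_def)
    ultimately have "a = 0"
      using c by (simp add: fscale_def)
    then show False
      using v(2) a by simp
  qed
  moreover have "joining_form n e i p v = 0" if "i \<in> J" for i
    using v(3)[of "Some i"] that by (simp add: \<phi>_def)
  ultimately show ?thesis
    using that v(1) by blast
qed

section \<open>The hypersurface of points on a line transversal to n subspaces\<close>

text \<open>
  The determinant of the \<open>2n\<close> linear equations \<open>a\<^sub>i(v) + t\<^sub>i a\<^sub>i(p) = 0\<close> and \<open>b\<^sub>i(v) + t\<^sub>i b\<^sub>i(p) = 0\<close> for
  \<open>i \<in> I\<close>, where the unknowns are the \<open>n + 1\<close> coordinates of \<open>v\<close> and the scalars \<open>t\<^sub>i\<close>. One of these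
  scalars is set to zero, since \<open>v = p\<close> and \<open>t\<^sub>i = -1\<close> is always a solution. Only the columns of the
  remaining \<open>n - 1\<close> scalars depend on \<open>p\<close>, and they do so linearly, so this is a form of degree
  \<open>n - 1\<close> in \<open>p\<close>. The maximal minors of the matrix of the joining forms also detect the condition, but
  they have degree \<open>n\<close>: up to sign they are the products of this form with the coordinates of \<open>p\<close>.
\<close>

definition transversal_form ::
    "nat \<Rightarrow> nat set \<Rightarrow> (eqvar \<Rightarrow> 'a::field) \<Rightarrow> (nat \<Rightarrow> 'a) \<Rightarrow> 'a" where
  "transversal_form n I e p =
     system_det (I \<times> {..<2}) (Inl ` {..n} \<union> Inr ` (I - {Min I}))
       (\<lambda>(i, r) c. case c of
          Inl k \<Rightarrow> e (i, r, k)
        | Inr m \<Rightarrow> if m = i then equation n e i r p else 0)"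

lemma card_columns:
  assumes "finite I" "card I = n" "n \<ge> 1"
  shows "card (I \<times> {..<2::nat}) = card (Inl ` {..n} \<union> Inr ` (I - {Min I}))"
proof -
  have "Min I \<in> I"
    using assms by (intro Min_in) auto
  then have "card (Inl ` {..n} \<union> Inr ` (I - {Min I})) = Suc n + (n - 1)"
    using assms by (subst card_Un_disjoint) (auto simp: card_image)
  then show ?thesis
    using assms by (simp add: card_cartesian_product)
qed

lemma transversal_form_eq_0_iff_system:
  assumes I: "finite I" "card I = n" "n \<ge> 1"
  shows "transversal_form n I e p = 0 \<longleftrightarrow>
    (\<exists>v t. v \<in> vecs n \<and> (v \<noteq> 0 \<or> (\<exists>i\<in>I. t i \<noteq> 0)) \<and> t (Min I) = 0 \<and>
       (\<forall>i\<in>I. \<forall>r<2. equation n e i r v + t i * equation n e i r p = 0))"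
    (is "_ \<longleftrightarrow> ?r")
proof -
  let ?C = "Inl ` {..n} \<union> Inr ` (I - {Min I}) :: (nat + nat) set"
  let ?M = "\<lambda>(i, r) c. case c of
          Inl k \<Rightarrow> e (i, r, k)
        | Inr m \<Rightarrow> if m = i then equation n e i r p else 0"
  have sum: "(\<Sum>c\<in>?C. ?M (i, r) c * x c) =
      (\<Sum>k\<le>n. e (i, r, k) * x (Inl k)) + (if i = Min I then 0 else x (Inr i)) * equation n e i r p"
    if "i \<in> I" for i r x
  proof -
    have "(\<Sum>c\<in>?C. ?M (i, r) c * x c) =
        (\<Sum>k\<le>n. e (i, r, k) * x (Inl k)) +
        (\<Sum>m\<in>I - {Min I}. (if m = i then equation n e i r p else 0) * x (Inr m))"
      using I(1) by (subst sum.union_disjoint) (auto simp: sum.reindex)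
    also have "(\<Sum>m\<in>I - {Min I}. (if m = i then equation n e i r p else 0) * x (Inr m)) =
        (\<Sum>m\<in>I - {Min I}. if i = m then equation n e i r p * x (Inr m) else 0)"
      by (rule sum.cong) auto
    also have "\<dots> = (if i = Min I then 0 else x (Inr i)) * equation n e i r p"
      using I(1) that by (simp add: sum.delta')
    finally show ?thesis .
  qed
  have "transversal_form n I e p = 0 \<longleftrightarrow>
      (\<exists>x. (\<exists>c\<in>?C. x c \<noteq> 0) \<and> (\<forall>ir\<in>I \<times> {..<2}. (\<Sum>c\<in>?C. ?M ir c * x c) = 0))"
    unfolding transversal_form_def
    by (rule system_det_eq_0_iff) (use I card_columns[OF I] in auto)
  also have "\<dots> \<longleftrightarrow> ?r"
  proof
    assume "\<exists>x. (\<exists>c\<in>?C. x c \<noteq> 0) \<and> (\<forall>ir\<in>I \<times> {..<2}. (\<Sum>c\<in>?C. ?M ir c * x c) = 0)"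
    then obtain x where x: "\<exists>c\<in>?C. x c \<noteq> 0"
      "\<And>i r. i \<in> I \<Longrightarrow> r < 2 \<Longrightarrow> (\<Sum>c\<in>?C. ?M (i, r) c * x c) = 0"
      by force
    define v where "v k = (if k \<le> n then x (Inl k) else 0)" for k
    define t where "t i = (if i = Min I then 0 else x (Inr i))" for i
    have "v \<in> vecs n"
      by (simp add: v_def vecs_def)
    moreover have "v \<noteq> 0 \<or> (\<exists>i\<in>I. t i \<noteq> 0)"
    proof -
      have "v k \<noteq> 0" if "k \<le> n" "x (Inl k) \<noteq> 0" for k
        using that by (simp add: v_def)
      moreover have "t i \<noteq> 0" if "i \<in> I - {Min I}" "x (Inr i) \<noteq> 0" for i
        using that by (simp add: t_def)
      ultimately show ?thesis
        using x(1) by (auto simp: fun_eq_iff)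
    qed
    moreover have "equation n e i r v + t i * equation n e i r p = 0" if "i \<in> I" "r < 2" for i r
      using x(2)[OF that] unfolding sum[OF that(1)] by (simp add: equation_def v_def t_def)
    moreover have "t (Min I) = 0"
      by (simp add: t_def)
    ultimately show ?r
      by blast
  next
    assume ?r
    then obtain v t where v: "v \<in> vecs n" and vt: "v \<noteq> 0 \<or> (\<exists>i\<in>I. t i \<noteq> 0)" and t: "t (Min I) = 0"
      and eq: "\<And>i r. i \<in> I \<Longrightarrow> r < 2 \<Longrightarrow> equation n e i r v + t i * equation n e i r p = 0"
      by blast
    define x where "x = case_sum v t"
    have "\<exists>c\<in>?C. x c \<noteq> 0"
    proof (cases "v = 0")
      case True
      then obtain i where "i \<in> I" "t i \<noteq> 0"
        using vt by blast
      then show ?thesis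
        using t by (intro bexI[of _ "Inr i"]) (auto simp: x_def)
    next
      case False
      then obtain k where "v k \<noteq> 0"
        by (auto simp: fun_eq_iff)
      moreover from this have "k \<le> n"
        by (rule vecs_nonzeroD[OF v])
      ultimately show ?thesis
        by (intro bexI[of _ "Inl k"]) (simp_all add: x_def)
    qed
    moreover have "(\<Sum>c\<in>?C. ?M (i, r) c * x c) = 0" if "i \<in> I" "r < 2" for i r
    proof -
      have "(if i = Min I then 0 else x (Inr i)) = t i"
        using t by (simp add: x_def)
      then show ?thesis
        using eq[OF that] unfolding sum[OF that(1)] by (simp add: x_def equation_def)
    qed
    ultimately show "\<exists>x. (\<exists>c\<in>?C. x c \<noteq> 0) \<and> (\<forall>ir\<in>I \<times> {..<2}. (\<Sum>c\<in>?C. ?M ir c * x c) = 0)"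
      by (intro exI[of _ x]) auto
  qed
  finally show ?thesis .
qed

text \<open>
  If \<open>p\<close> lies on the \<open>i\<close>-th subspace, the two equations with index \<open>i\<close> do not involve \<open>t\<^sub>i\<close>. So
  \<open>v = 0\<close> with \<open>t\<^sub>i\<close> as the only nonzero scalar is a solution, unless \<open>t\<^sub>i\<close> is the scalar that is set to
  zero; then the solution \<open>v = p\<close> is available.
\<close>

lemma transversal_form_vanishes_on_codim2_space:
  assumes I: "finite I" "card I = n" "n \<ge> 1" and p: "p \<noteq> 0" "p \<in> codim2_space n e i" "i \<in> I"
  shows "transversal_form n I e p = 0"
proof -
  have 0: "equation n e i r p = 0" if "r < 2" for r
    using p(2) that by (auto simp: codim2_space_def)
  let ?t = "\<lambda>m. if m = Min I then 0 else - 1"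
  consider "i = Min I" | "i \<noteq> Min I"
    by blast
  then show ?thesis
  proof cases
    case 1
    have "p \<in> vecs n"
      using p(2) by (simp add: codim2_space_iff)
    moreover have "equation n e m r p + ?t m * equation n e m r p = 0" if "r < 2" for m r
      using 0[OF that] unfolding 1[symmetric] by simp
    ultimately show ?thesis
      unfolding transversal_form_eq_0_iff_system[OF I]
      using p(1) by (intro exI[of _ p] exI[of _ ?t]) simp
  next
    case 2
    have "0 \<in> vecs n"
      by (simp add: vecs_def)
    moreover have "\<exists>m\<in>I. (if m = i then 1 else 0) \<noteq> (0::'a)"
      using p(3) by auto
    moreover have "equation n e m r 0 + (if m = i then 1 else 0) * equation n e m r p = 0"
      if "r < 2" for m r
      using 0[OF that] by (simp add: equation_0)
    ultimately show ?thesis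
      unfolding transversal_form_eq_0_iff_system[OF I]
      using 2 by (intro exI[of _ 0] exI[of _ "\<lambda>m. if m = i then 1 else 0"]) simp
  qed
qed

text \<open>
  A solution with \<open>v\<close> not proportional to \<open>p\<close> gives a common zero of the joining forms, because
  \<open>(a\<^sub>i(v), b\<^sub>i(v))\<close> is a multiple of \<open>(a\<^sub>i(p), b\<^sub>i(p))\<close>. A solution with \<open>v\<close> proportional to \<open>p\<close> forces
  \<open>p\<close> onto one of the subspaces, whose joining form is then zero, and the other \<open>n - 1\<close> joining
  forms always have a common zero off the line of \<open>p\<close>.
\<close>

lemma transversal_form_eq_0_iff:
  assumes I: "finite I" "card I = n" "n \<ge> 1" and p: "p \<in> vecs n" "p \<noteq> 0"
  shows "transversal_form n I e p = 0 \<longleftrightarrow>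
    (\<exists>v\<in>vecs n. v \<notin> fvs.span {p} \<and> (\<forall>i\<in>I. joining_form n e i p v = 0))" (is "?l \<longleftrightarrow> ?r")
proof
  assume ?l
  then obtain v t where v: "v \<in> vecs n" "v \<noteq> 0 \<or> (\<exists>i\<in>I. t i \<noteq> 0)" "t (Min I) = 0"
    and eq: "\<And>i r. i \<in> I \<Longrightarrow> r < 2 \<Longrightarrow> equation n e i r v + t i * equation n e i r p = 0"
    unfolding transversal_form_eq_0_iff_system[OF I] by blast
  have Min: "Min I \<in> I"
    using I by (intro Min_in) auto
  show ?r
  proof (cases "v \<in> fvs.span {p}")
    case False
    have "joining_form n e i p v = 0" if "i \<in> I" for i
    proof (rule joining_form_eq_0_if_proportional)
      show "equation n e i r v = - t i * equation n e i r p" if "r < 2" for r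
        using eq[OF \<open>i \<in> I\<close> that] by (simp add: eq_neg_iff_add_eq_0)
    qed
    then show ?thesis
      using v(1) False by blast
  next
    case True
    then obtain c where c: "v = fscale c p"
      unfolding in_span_singleton_iff by blast
    have eq': "(c + t i) * equation n e i r p = 0" if "i \<in> I" "r < 2" for i r
      using eq[OF that] unfolding c equation_scale by (simp add: algebra_simps)
    have "\<exists>i\<in>I. c + t i \<noteq> 0"
    proof (cases "c = 0")
      case True
      then show ?thesis
        using v(2) c by auto
    next
      case False
      then show ?thesis
        using v(3) Min by (intro bexI[of _ "Min I"]) simp_all
    qed
    then obtain i where i: "i \<in> I" "c + t i \<noteq> 0"
      by blast
    have "joining_form n e i p x = 0" for x
      using eq'[OF i(1), of 0] eq'[OF i(1), of 1] i(2) by (simp add: joining_form_def)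
    moreover have "finite (I - {i})" "card (I - {i}) < n"
      using I i(1) by simp_all
    then obtain v' where "v' \<in> vecs n" "v' \<notin> fvs.span {p}"
      "\<And>m. m \<in> I - {i} \<Longrightarrow> joining_form n e m p v' = 0"
      using exists_transversal_direction[OF p] by blast
    ultimately show ?thesis
      by (intro bexI[of _ v']) auto
  qed
next
  assume ?r
  then obtain v where v: "v \<in> vecs n" "v \<notin> fvs.span {p}" "\<And>i. i \<in> I \<Longrightarrow> joining_form n e i p v = 0"
    by blast
  show ?l
  proof (cases "\<exists>i\<in>I. p \<in> codim2_space n e i")
    case True
    then show ?thesis
      using transversal_form_vanishes_on_codim2_space[OF I p(2)] by blast
  next
    case False
    have "\<exists>s. \<forall>r<2. equation n e i r v = s * equation n e i r p" if "i \<in> I" for i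
      using equation_proportional[OF p(1) _ v(3)[OF that]] False that by metis
    then obtain s where s: "\<And>i r. i \<in> I \<Longrightarrow> r < 2 \<Longrightarrow> equation n e i r v = s i * equation n e i r p"
      by metis
    let ?u = "v - fscale (s (Min I)) p"
    have "?u \<in> vecs n"
      by (intro fvs.subspace_diff fvs.subspace_scale subspace_vecs v(1) p(1))
    moreover have "?u \<noteq> 0"
      using v(2) unfolding in_span_singleton_iff by auto
    moreover have "equation n e i r ?u + (s (Min I) - s i) * equation n e i r p = 0"
      if "i \<in> I" "r < 2" for i r
      using s[OF that] unfolding equation_diff equation_scale by (simp add: algebra_simps)
    ultimately show ?thesis
      unfolding transversal_form_eq_0_iff_system[OF I]
      by (intro exI[of _ ?u] exI[of _ "\<lambda>i. s (Min I) - s i"]) simp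
  qed
qed

lemma equation_form_function: "equation n e i r \<in> form_functions n 1"
proof -
  have "(\<lambda>x. e (i, r, k) * x k) \<in> form_functions n (0 + 1)" if "k \<le> n" for k
    by (rule form_functions.mult[OF form_functions_const form_functions_coord[OF that]])
  then have "(\<lambda>x. \<Sum>k\<le>n. e (i, r, k) * x k) \<in> form_functions n 1"
    by (intro form_functions.sum) simp
  then show ?thesis
    unfolding equation_def[abs_def] .
qed

lemma transversal_form_function:
  assumes I: "finite I" "card I = n" "n \<ge> 1"
  shows "transversal_form n I e \<in> form_functions n (n - 1)"
proof -
  let ?d = "case_sum (\<lambda>k. 0) (\<lambda>m. 1) :: nat + nat \<Rightarrow> nat"
  have "transversal_form n I e \<in>
      form_functions n (\<Sum>c\<in>Inl ` {..n} \<union> Inr ` (I - {Min I}). ?d c)"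
    unfolding transversal_form_def[abs_def]
  proof (rule form_functions.system_det)
    show "card (I \<times> {..<2::nat}) = card (Inl ` {..n} \<union> Inr ` (I - {Min I}))"
      by (rule card_columns[OF I])
    show "(\<lambda>x. (case r of (i, r) \<Rightarrow> \<lambda>c. case c of
          Inl k \<Rightarrow> e (i, r, k)
        | Inr m \<Rightarrow> if m = i then equation n e i r x else 0) c) \<in> form_functions n (?d c)"
      for r and c :: "nat + nat"
      by (cases r; cases c)
        (auto intro!: form_functions_const form_functions.if_cond form_functions.zero
          equation_form_function[unfolded One_nat_def])
  qed (use I in auto)
  also have "(\<Sum>c\<in>Inl ` {..n} \<union> Inr ` (I - {Min I}). ?d c) = card (I - {Min I})"
    using I(1) by (subst sum.union_disjoint) (auto simp: sum.reindex)
  also have "\<dots> = n - 1"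
  proof -
    have "Min I \<in> I"
      using I by (intro Min_in) auto
    then show ?thesis
      using I by simp
  qed
  finally show ?thesis .
qed

section \<open>Regular points\<close>

text \<open>
  For \<open>n - 1\<close> subspaces with indices in \<open>J\<close>, the lines through \<open>p\<close> that meet all of them lie in the
  common kernel of the joining forms. The determinant below is zero exactly if this kernel contains a
  point that is common to the subspaces with indices \<open>i\<close> and \<open>k\<close>. The joining forms of these two
  subspaces vanish on them anyway; leaving them out makes the system square.
\<close>

definition disjointness_form ::
    "nat \<Rightarrow> nat set \<Rightarrow> nat \<Rightarrow> nat \<Rightarrow> (eqvar \<Rightarrow> 'a::field) \<Rightarrow> (nat \<Rightarrow> 'a) \<Rightarrow> 'a" where
  "disjointness_form n J i k e p =
     system_det ((J - {i, k}) \<times> {0} \<union> {i, k} \<times> {..<2}) {..n}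
       (\<lambda>(m, r) c. if m \<in> {i, k} then e (m, r, c)
          else equation n e m 0 p * e (m, 1, c) - equation n e m 1 p * e (m, 0, c))"

lemma card_disjointness_rows:
  assumes "finite J" "card J = n - 1" "i \<in> J" "k \<in> J" "i \<noteq> k"
  shows "card ((J - {i, k}) \<times> {0} \<union> {i, k} \<times> {..<2::nat}) = card {..n}"
proof -
  have "card ((J - {i, k}) \<times> {0::nat}) = n - 1 - 2"
    using assms by (simp add: card_cartesian_product card_Diff_subset)
  moreover have "card ({i, k} \<times> {..<2::nat}) = 4"
    using assms(5) by (simp add: card_cartesian_product)
  moreover have "card ((J - {i, k}) \<times> {0} \<union> {i, k} \<times> {..<2::nat}) =
      card ((J - {i, k}) \<times> {0::nat}) + card ({i, k} \<times> {..<2::nat})"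
    using assms(1) by (intro card_Un_disjoint) auto
  moreover have "2 \<le> n - 1"
    using card_mono[of J "{i, k}"] assms by simp
  ultimately show ?thesis
    by simp
qed

lemma disjointness_form_eq_0_iff:
  assumes J: "finite J" "card J = n - 1" "i \<in> J" "k \<in> J" "i \<noteq> k"
  shows "disjointness_form n J i k e p = 0 \<longleftrightarrow>
    (\<exists>x. x \<noteq> 0 \<and> x \<in> codim2_space n e i \<and> x \<in> codim2_space n e k \<and>
      (\<forall>m\<in>J - {i, k}. joining_form n e m p x = 0))" (is "_ \<longleftrightarrow> (\<exists>x. ?P x)")
proof -
  let ?R = "(J - {i, k}) \<times> {0} \<union> {i, k} \<times> {..<2::nat}"
  let ?M = "\<lambda>(m, r) c. if m \<in> {i, k} then e (m, r, c)
          else equation n e m 0 p * e (m, 1, c) - equation n e m 1 p * e (m, 0, c)"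
  define S where "S m r x = (\<Sum>c\<le>n. ?M (m, r) c * x c)" for m r x
  have sum1: "S m r x = equation n e m r x" if "m \<in> {i, k}" for m r x
    using that by (simp add: equation_def S_def)
  have sum2: "S m r x = joining_form n e m p x" if "m \<notin> {i, k}" for m r x
  proof -
    have "S m r x = (\<Sum>c\<le>n. equation n e m 0 p * (e (m, 1, c) * x c) -
        equation n e m 1 p * (e (m, 0, c) * x c))"
      using that unfolding S_def by (intro sum.cong) (auto simp: algebra_simps)
    also have "\<dots> = joining_form n e m p x"
      unfolding joining_form_def by (simp only: sum_subtractf sum_distrib_left equation_def[of n e m _ x])
    finally show ?thesis .
  qed
  have rows: "(\<forall>mr\<in>?R. (\<Sum>c\<le>n. ?M mr c * x c) = 0) \<longleftrightarrow>
      (\<forall>m\<in>J - {i, k}. joining_form n e m p x = 0) \<and> (\<forall>m\<in>{i, k}. \<forall>r<2. equation n e m r x = 0)"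
    (is "?A \<longleftrightarrow> ?B") for x
  proof -
    have "?A \<longleftrightarrow> (\<forall>mr\<in>?R. S (fst mr) (snd mr) x = 0)"
      unfolding S_def by simp
    also have "\<dots> \<longleftrightarrow> (\<forall>m\<in>J - {i, k}. S m 0 x = 0) \<and> (\<forall>m\<in>{i, k}. \<forall>r<2. S m r x = 0)"
      unfolding ball_Un split_paired_Ball_Sigma by (simp add: Ball_def)
    also have "\<dots> \<longleftrightarrow> ?B"
      using sum1 sum2 by simp
    finally show ?thesis .
  qed
  have "disjointness_form n J i k e p = 0 \<longleftrightarrow>
      (\<exists>x. (\<exists>c\<in>{..n}. x c \<noteq> 0) \<and> (\<forall>mr\<in>?R. (\<Sum>c\<le>n. ?M mr c * x c) = 0))"
    unfolding disjointness_form_def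
    by (rule system_det_eq_0_iff) (use J card_disjointness_rows[OF J] in auto)
  also have "\<dots> \<longleftrightarrow> (\<exists>x. ?P x)"
    unfolding rows
  proof
    assume "\<exists>x. (\<exists>c\<in>{..n}. x c \<noteq> 0) \<and> (\<forall>m\<in>J - {i, k}. joining_form n e m p x = 0) \<and>
      (\<forall>m\<in>{i, k}. \<forall>r<2. equation n e m r x = 0)"
    then obtain x where x: "\<exists>c\<in>{..n}. x c \<noteq> 0" "\<forall>m\<in>J - {i, k}. joining_form n e m p x = 0"
      "\<forall>m\<in>{i, k}. \<forall>r<2. equation n e m r x = 0"
      by blast
    let ?y = "\<lambda>c. if c \<le> n then x c else 0"
    have eq: "equation n e m r ?y = equation n e m r x" for m r
      by (simp add: equation_def)
    then have "joining_form n e m p ?y = joining_form n e m p x" for m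
      by (simp add: joining_form_def)
    moreover have "?y \<noteq> 0"
      using x(1) by (auto simp: fun_eq_iff)
    moreover have "?y \<in> vecs n"
      by (simp add: vecs_def)
    ultimately have "?P ?y"
      using x(2,3) eq by (simp add: codim2_space_def)
    then show "\<exists>x. ?P x"
      by (rule exI[of _ ?y])
  next
    assume "\<exists>x. ?P x"
    then obtain x where x: "?P x" ..
    then have "x \<in> vecs n"
      by (simp add: codim2_space_iff)
    moreover obtain c where "x c \<noteq> 0"
      using x by (auto simp: fun_eq_iff)
    ultimately have "\<exists>c\<in>{..n}. x c \<noteq> 0"
      using vecs_nonzeroD by blast
    then show "\<exists>x. (\<exists>c\<in>{..n}. x c \<noteq> 0) \<and> (\<forall>m\<in>J - {i, k}. joining_form n e m p x = 0) \<and>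
      (\<forall>m\<in>{i, k}. \<forall>r<2. equation n e m r x = 0)"
      using x unfolding codim2_space_def by blast
  qed
  finally show ?thesis .
qed

text \<open>
  For each \<open>l \<in> I\<close> there is then exactly one line through \<open>p\<close> that meets all the subspaces with indices
  in \<open>I - {l}\<close>, and it meets them in distinct points. Without the second condition the hypersurface
  need not be unique: if two of three lines in space intersect, then the plane that they span, together with any
  plane through the third line, is a quadric that contains all three.
\<close>

definition regular :: "nat \<Rightarrow> nat set \<Rightarrow> (eqvar \<Rightarrow> 'a::field) \<Rightarrow> (nat \<Rightarrow> 'a) \<Rightarrow> bool" where
  "regular n I e p \<longleftrightarrow> transversal_form n I e p \<noteq> 0 \<and>
     (\<forall>l\<in>I. \<forall>i\<in>I - {l}. \<forall>k\<in>I - {l}. i \<noteq> k \<longrightarrow> disjointness_form n (I - {l}) i k e p \<noteq> 0)"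

lemma plus_fscale_eq: "p + fscale s y = (\<lambda>i. p i + s * y i)"
  by (simp add: fscale_def fun_eq_iff)

lemma equation_on_line: "(\<lambda>s. equation n e i r (p + fscale s y)) \<in> univariate 1"
  unfolding equation_add equation_scale by (rule univariate_linear)

lemma disjointness_form_on_line:
  assumes J: "finite J" "card J = n - 1" "i \<in> J" "k \<in> J" "i \<noteq> k"
  shows "(\<lambda>s. disjointness_form n J i k e (p + fscale s y)) \<in> univariate (\<Sum>c\<le>n. 1)"
  unfolding disjointness_form_def
proof (rule univariate.system_det)
  fix mr :: "nat \<times> nat" and c :: nat
  have *: "(\<lambda>s. equation n e i r (p + fscale s y) * b) \<in> univariate 1" for i r b
    using univariate.mult[OF equation_on_line univariate_const, of n e i r p y b 0] by simp
  show "(\<lambda>s. (case mr of (m, r) \<Rightarrow> \<lambda>c. if m \<in> {i, k} then e (m, r, c)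
          else equation n e m 0 (p + fscale s y) * e (m, 1, c) -
            equation n e m 1 (p + fscale s y) * e (m, 0, c)) c) \<in> univariate 1"
    by (cases mr) (auto intro!: univariate.if_cond univariate.diff * univariate_const simp del: One_nat_def)
qed (use J card_disjointness_rows[OF J] in auto)

lemma regular_on_line:
  assumes I: "finite I" "card I = n" "n \<ge> 1" and p: "regular n I e p"
  shows "finite {s. \<not> regular n I e (p + fscale s y)}"
proof -
  let ?T = "{(l, i, k). l \<in> I \<and> i \<in> I - {l} \<and> k \<in> I - {l} \<and> i \<noteq> k}"
  let ?Z = "{s. transversal_form n I e (p + fscale s y) = 0}"
  let ?D = "\<lambda>(l, i, k). {s. disjointness_form n (I - {l}) i k e (p + fscale s y) = 0}"
  have p0: "p + fscale 0 y = p"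
    by simp
  have "finite ?T"
    by (rule finite_subset[of _ "I \<times> I \<times> I"]) (use I(1) in auto)
  moreover have "finite (?D t)" if "t \<in> ?T" for t
  proof -
    obtain l i k where t: "t = (l, i, k)"
      by (cases t)
    have "l \<in> I" "i \<in> I - {l}" "k \<in> I - {l}" "i \<noteq> k"
      using that t by auto
    moreover from this have "disjointness_form n (I - {l}) i k e (p + fscale 0 y) \<noteq> 0"
      using p unfolding p0 regular_def by blast
    moreover have "finite (I - {l})" "card (I - {l}) = n - 1"
      using I \<open>l \<in> I\<close> by simp_all
    ultimately have "finite {s. disjointness_form n (I - {l}) i k e (p + fscale s y) = 0}"
      by (intro univariate_finite_zeros[OF disjointness_form_on_line])
    then show ?thesis
      by (simp add: t)
  qed
  moreover have "finite ?Z"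
  proof (rule univariate_finite_zeros)
    show "(\<lambda>s. transversal_form n I e (p + fscale s y)) \<in> univariate (n - 1)"
      unfolding plus_fscale_eq by (rule form_functions_on_line[OF transversal_form_function[OF I]])
    show "transversal_form n I e (p + fscale 0 y) \<noteq> 0"
      using p unfolding p0 regular_def by blast
  qed
  ultimately have "finite (?Z \<union> (\<Union>t\<in>?T. ?D t))"
    by blast
  then show ?thesis
    by (rule rev_finite_subset) (auto simp: regular_def)
qed

section \<open>Forms vanishing on n subspaces and at a regular point\<close>

lemma regular_imp_nonzero:
  assumes "finite I" "card I = n" "n \<ge> 2" "regular n I e p"
  shows "p \<noteq> 0"
proof
  assume "p = 0"
  then have "p = (\<lambda>i. 0 * p i)"
    by (simp add: fun_eq_iff)
  moreover have "transversal_form n I e (\<lambda>i. 0 * p i) = 0 ^ (n - 1) * transversal_form n I e p"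
    using assms by (intro form_functions_scale[where n = n] transversal_form_function) auto
  ultimately have "transversal_form n I e p = 0"
    using assms(3) by (simp add: power_0_left)
  then show False
    using assms(4) unfolding regular_def by blast
qed

locale regular_point =
  fixes n :: nat and I :: "nat set" and e :: "eqvar \<Rightarrow> 'a::field" and p :: "nat \<Rightarrow> 'a"
  assumes finite_I: "finite I" and card_I: "card I = n" and n_ge_2: "n \<ge> 2"
    and p_in: "p \<in> vecs n" and regular: "regular n I e p"
begin

lemma n_ge_1: "n \<ge> 1"
  using n_ge_2 by simp

lemma p_nonzero: "p \<noteq> 0"
  by (rule regular_imp_nonzero[OF finite_I card_I n_ge_2 regular])

lemma transversal_form_nonzero: "transversal_form n I e p \<noteq> 0"
  using regular unfolding regular_def by blast

lemma common_kernel: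
  assumes "v \<in> vecs n" "\<And>i. i \<in> I \<Longrightarrow> joining_form n e i p v = 0"
  shows "v \<in> fvs.span {p}"
  using transversal_form_nonzero assms
  unfolding transversal_form_eq_0_iff[OF finite_I card_I n_ge_1 p_in p_nonzero] by blast

lemma not_in_codim2_space: "i \<in> I \<Longrightarrow> p \<notin> codim2_space n e i"
  using transversal_form_nonzero p_nonzero
    transversal_form_vanishes_on_codim2_space[OF finite_I card_I n_ge_1] by blast

lemma disjoint:
  assumes "l \<in> I" "i \<in> I - {l}" "k \<in> I - {l}" "i \<noteq> k"
    and x: "x \<in> codim2_space n e i" "x \<in> codim2_space n e k"
      "\<And>m. m \<in> I - {l} \<Longrightarrow> joining_form n e m p x = 0"
  shows "x = 0"
proof (rule ccontr)
  assume "x \<noteq> 0"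
  have J: "finite (I - {l})" "card (I - {l}) = n - 1"
    using finite_I card_I assms(1) by simp_all
  have "disjointness_form n (I - {l}) i k e p = 0"
    unfolding disjointness_form_eq_0_iff[OF J assms(2-4)]
    using x \<open>x \<noteq> 0\<close> by blast
  then show False
    using regular assms(1-4) unfolding regular_def by blast
qed

lemma proportional:
  assumes "i \<in> I" "joining_form n e i p v = 0"
  shows "\<exists>s. \<forall>r<2. equation n e i r v = s * equation n e i r p"
  using equation_proportional[OF p_in not_in_codim2_space[OF assms(1)] assms(2)] by metis

text \<open>
  The form has degree \<open>n - 1\<close>, and on the line through \<open>p\<close> that meets the \<open>n - 1\<close> subspaces with
  indices in \<open>I - {l}\<close> it has \<open>n\<close> zeros: \<open>p\<close> itself and the distinct points on the subspaces.
\<close>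

lemma form_vanishes_on_line:
  assumes inf: "infinite (UNIV :: 'a set)" and l: "l \<in> I"
    and F: "F \<in> form_functions n (n - 1)" "\<And>i x. i \<in> I \<Longrightarrow> x \<in> codim2_space n e i \<Longrightarrow> F x = 0"
    and Fp: "F p = 0"
  obtains v where "v \<in> vecs n" "joining_form n e l p v \<noteq> 0"
    "\<And>i. i \<in> I - {l} \<Longrightarrow> joining_form n e i p v = 0" "\<And>s. F (p + fscale s v) = 0"
proof -
  let ?J = "I - {l}"
  have J: "finite ?J" "card ?J < n" "card ?J = n - 1"
    using finite_I card_I n_ge_2 l by simp_all
  obtain v0 where v0: "v0 \<in> vecs n" "v0 \<notin> fvs.span {p}"
    "\<And>i. i \<in> ?J \<Longrightarrow> joining_form n e i p v0 = 0"
    using exists_transversal_direction[OF p_in p_nonzero J(1,2)] by blast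
  have l_v0: "joining_form n e l p v0 \<noteq> 0"
    using common_kernel[OF v0(1)] v0(2,3) by blast
  have "\<exists>s. \<forall>r<2. equation n e i r v0 = s * equation n e i r p" if "i \<in> ?J" for i
    using proportional v0(3) that by blast
  then obtain \<tau> where \<tau>: "\<And>i r. i \<in> ?J \<Longrightarrow> r < 2 \<Longrightarrow> equation n e i r v0 = \<tau> i * equation n e i r p"
    by metis
  have inj: "inj_on \<tau> ?J"
  proof (rule inj_onI, rule ccontr)
    fix i k assume ik: "i \<in> ?J" "k \<in> ?J" "\<tau> i = \<tau> k" "i \<noteq> k"
    define x where "x = v0 - fscale (\<tau> i) p"
    have x_in: "x \<in> vecs n"
      unfolding x_def by (intro fvs.subspace_diff fvs.subspace_scale subspace_vecs v0(1) p_in)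
    have "equation n e i r x = 0" if "r < 2" for r
      unfolding x_def equation_diff equation_scale \<tau>[OF ik(1) that] by simp
    moreover have "equation n e k r x = 0" if "r < 2" for r
      unfolding x_def equation_diff equation_scale \<tau>[OF ik(2) that] ik(3) by simp
    moreover have "joining_form n e m p x = 0" if "m \<in> ?J" for m
      unfolding x_def joining_form_diff joining_form_scale joining_form_self v0(3)[OF that] by simp
    ultimately have "x = 0"
      using disjoint[OF l ik(1,2,4)] x_in unfolding codim2_space_def by blast
    then show False
      using v0(2) unfolding x_def in_span_singleton_iff by simp
  qed
  \<comment> \<open>The direction of the line is changed by a multiple of p so that none of its points on the
    subspaces is at infinity.\<close>
  obtain c where c: "c \<notin> (\<lambda>i. - \<tau> i) ` ?J"
    using ex_new_if_finite[OF inf finite_imageI[OF J(1)]] by blast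
  have nz: "\<tau> i + c \<noteq> 0" if "i \<in> ?J" for i
    using c that by (auto simp: eq_neg_iff_add_eq_0 add.commute)
  define v where "v = v0 + fscale c p"
  have v_in: "v \<in> vecs n"
    unfolding v_def by (intro fvs.subspace_add fvs.subspace_scale subspace_vecs v0(1) p_in)
  define \<sigma> where "\<sigma> i = - (1 / (\<tau> i + c))" for i
  have zero: "F (p + fscale (\<sigma> i) v) = 0" if i: "i \<in> ?J" for i
  proof -
    have "equation n e i r (p + fscale (\<sigma> i) v) = 0" if "r < 2" for r
    proof -
      have "equation n e i r (p + fscale (\<sigma> i) v) =
          equation n e i r p + \<sigma> i * ((\<tau> i + c) * equation n e i r p)"
        unfolding v_def equation_add equation_scale \<tau>[OF i that] by (simp add: algebra_simps)
      also have "\<sigma> i * ((\<tau> i + c) * equation n e i r p) = - equation n e i r p"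
        using nz[OF i] by (simp add: \<sigma>_def)
      finally show ?thesis
        by (simp only: add.right_inverse)
    qed
    moreover have "p + fscale (\<sigma> i) v \<in> vecs n"
      by (intro fvs.subspace_add fvs.subspace_scale subspace_vecs v_in p_in)
    ultimately show ?thesis
      using F(2)[of i] i unfolding codim2_space_def by blast
  qed
  have "inj_on \<sigma> ?J"
  proof (rule inj_onI)
    fix i k assume ik: "i \<in> ?J" "k \<in> ?J" "\<sigma> i = \<sigma> k"
    then have "\<tau> i = \<tau> k"
      unfolding \<sigma>_def by simp
    then show "i = k"
      using inj ik(1,2) by (simp add: inj_on_def)
  qed
  moreover have "0 \<notin> \<sigma> ` ?J"
  proof -
    have "\<sigma> i \<noteq> 0" if "i \<in> ?J" for i
      using nz[OF that] by (simp add: \<sigma>_def)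
    then show ?thesis
      by (metis imageE)
  qed
  ultimately have "card (insert 0 (\<sigma> ` ?J)) > n - 1"
    using J by (simp add: card_image)
  moreover have "(\<lambda>s. F (p + fscale s v)) \<in> univariate (n - 1)"
    unfolding plus_fscale_eq by (rule form_functions_on_line[OF F(1)])
  moreover have "F (p + fscale s v) = 0" if "s \<in> insert 0 (\<sigma> ` ?J)" for s
    using that zero Fp by auto
  ultimately have "F (p + fscale s v) = 0" for s
    using J(1) univariate_eq_0[of "\<lambda>s. F (p + fscale s v)" "n - 1" "insert 0 (\<sigma> ` ?J)"] by blast
  moreover have "joining_form n e l p v \<noteq> 0"
    using l_v0 unfolding v_def joining_form_add joining_form_scale joining_form_self by simp
  moreover have "joining_form n e i p v = 0" if "i \<in> ?J" for i
    unfolding v_def joining_form_add joining_form_scale joining_form_self v0(3)[OF that] by simp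
  ultimately show ?thesis
    using that v_in by blast
qed

end

text \<open>
  Cramer's rule in the plane: the values of the two equations at \<open>p\<close> and at \<open>v\<close> form a basis, because
  the joining form is the determinant of these two vectors.
\<close>

lemma equation_decompose:
  assumes "joining_form n e l p v \<noteq> 0" "r < 2"
  shows "equation n e l r x =
    - joining_form n e l v x / joining_form n e l p v * equation n e l r p +
    joining_form n e l p x / joining_form n e l p v * equation n e l r v"
proof -
  have "joining_form n e l p v * equation n e l r x =
      - joining_form n e l v x * equation n e l r p + joining_form n e l p x * equation n e l r v"
    using assms(2) unfolding joining_form_def less_2_cases_iff by (auto simp: algebra_simps)
  then have "equation n e l r x =
      (- joining_form n e l v x * equation n e l r p + joining_form n e l p x * equation n e l r v) /
        joining_form n e l p v"
    using assms(1) by (simp add: nonzero_eq_divide_eq mult.commute)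
  then show ?thesis
    by (simp add: add_divide_distrib diff_divide_distrib)
qed

text \<open>
  Induction on the number of joining forms that are not imposed. If all are imposed, then only the
  multiples of \<open>p\<close> are left. Otherwise choose an index \<open>l\<close> that is not in \<open>K\<close> and take the line
  through \<open>p\<close> that meets all subspaces except the \<open>l\<close>-th. The form vanishes on this line, so the
  induction hypothesis applies to every regular point \<open>p'\<close> of the line and to \<open>K\<close> together with \<open>l\<close>.
  The joining forms with index in \<open>K\<close> have the same kernels at \<open>p'\<close> as at \<open>p\<close>, whereas the hyperplane
  that joins \<open>p'\<close> to the \<open>l\<close>-th subspace turns around this subspace as \<open>p'\<close> moves along the line, and so
  these hyperplanes sweep out the common kernel for \<open>K\<close>.
\<close>

lemma form_vanishes_on_common_kernel:
  fixes e :: "eqvar \<Rightarrow> 'a::field"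
  assumes inf: "infinite (UNIV :: 'a set)" and I: "finite I" "card I = n" "n \<ge> 2"
    and F: "F \<in> form_functions n (n - 1)" "\<And>i x. i \<in> I \<Longrightarrow> x \<in> codim2_space n e i \<Longrightarrow> F x = 0"
    and p: "p \<in> vecs n" "regular n I e p" "F p = 0"
    and K: "K \<subseteq> I" and x: "x \<in> vecs n" "\<And>i. i \<in> K \<Longrightarrow> joining_form n e i p x = 0"
  shows "F x = 0"
  using K p x
proof (induction "card (I - K)" arbitrary: K p x)
  case 0
  then interpret regular_point n I e p
    using I by unfold_locales
  have "I - K = {}"
    using "0.hyps" I(1) by simp
  then have "x \<in> fvs.span {p}"
    using "0.prems" by (intro common_kernel) blast+
  then obtain c where "x = (\<lambda>i. c * p i)"
    unfolding in_span_singleton_iff fscale_def by blast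
  then show ?case
    using form_functions_scale[OF F(1), of c p] "0.prems"(4) by simp
next
  case (Suc m)
  then interpret regular_point n I e p
    using I by unfold_locales
  note K = Suc.prems(1) and Fp = Suc.prems(4) and x = Suc.prems(5,6)
  obtain l where l: "l \<in> I" "l \<notin> K"
    using Suc.hyps(2) by (metis Diff_eq_empty_iff card.empty nat.distinct(1) subsetI)
  obtain v where v: "v \<in> vecs n" "joining_form n e l p v \<noteq> 0"
    "\<And>i. i \<in> I - {l} \<Longrightarrow> joining_form n e i p v = 0" "\<And>s. F (p + fscale s v) = 0"
    using form_vanishes_on_line[OF inf l(1) F(1) _ Fp] F(2) by blast
  define bad where "bad = {s. \<not> regular n I e (p + fscale s v)}"
  have "finite bad"
    unfolding bad_def using regular_on_line[OF finite_I card_I n_ge_1 regular] .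
  have "0 \<notin> bad"
    using regular by (simp add: bad_def)
  define \<alpha> where "\<alpha> = - joining_form n e l v x / joining_form n e l p v"
  define \<beta> where "\<beta> = joining_form n e l p x / joining_form n e l p v"
  have decompose: "equation n e l r x = \<alpha> * equation n e l r p + \<beta> * equation n e l r v"
    if "r < 2" for r
    unfolding \<alpha>_def \<beta>_def by (rule equation_decompose[OF v(2) that])
  \<comment> \<open>For the vector x + u p the point p' sits at the parameter \<beta> / (\<alpha> + u) of the line; these are
    the u for which this parameter is infinite or bad. A bad parameter is nonzero and is hit by
    only one u.\<close>
  define exceptional where "exceptional = insert (- \<alpha>) ((\<lambda>s. \<beta> / s - \<alpha>) ` bad)"
  have "finite exceptional"
    unfolding exceptional_def using \<open>finite bad\<close> by simp
  have zero: "F (x + fscale u p) = 0" if u: "u \<notin> exceptional" for u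
  proof -
    have \<alpha>u: "\<alpha> + u \<noteq> 0"
      using u unfolding exceptional_def by (auto simp: add_eq_0_iff)
    define s where "s = \<beta> / (\<alpha> + u)"
    have \<beta>: "\<beta> = (\<alpha> + u) * s"
      using \<alpha>u by (simp add: s_def)
    have "s \<notin> bad"
    proof
      assume "s \<in> bad"
      then have "s \<noteq> 0"
        using \<open>0 \<notin> bad\<close> by blast
      then have "u = \<beta> / s - \<alpha>"
        using \<alpha>u unfolding s_def by simp
      then show False
        using u \<open>s \<in> bad\<close> unfolding exceptional_def by blast
    qed
    define p' where "p' = p + fscale s v"
    have p'_in: "p' \<in> vecs n"
      unfolding p'_def by (intro fvs.subspace_add fvs.subspace_scale subspace_vecs v(1) p_in)
    have p': "regular n I e p'" "F p' = 0"
      using \<open>s \<notin> bad\<close> v(4) unfolding bad_def p'_def by auto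
    have y_in: "x + fscale u p \<in> vecs n"
      by (intro fvs.subspace_add fvs.subspace_scale subspace_vecs x(1) p_in)
    have "joining_form n e i p' (x + fscale u p) = 0" if "i \<in> insert l K" for i
    proof (cases "i = l")
      case True
      have "equation n e l r (x + fscale u p) = (\<alpha> + u) * equation n e l r p'" if "r < 2" for r
        unfolding p'_def equation_add equation_scale decompose[OF that] \<beta>
        by (simp add: algebra_simps)
      then show ?thesis
        unfolding True by (rule joining_form_eq_0_if_proportional)
    next
      case False
      then have i: "i \<in> K" "i \<in> I - {l}"
        using that K by auto
      obtain t where t: "\<And>r. r < 2 \<Longrightarrow> equation n e i r v = t * equation n e i r p"
        using proportional[of i v] v(3) i by blast
      obtain t' where t': "\<And>r. r < 2 \<Longrightarrow> equation n e i r x = t' * equation n e i r p"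
        using proportional[of i x] x(2) i by blast
      have "equation n e i r p' = (1 + s * t) * equation n e i r p"
        "equation n e i r (x + fscale u p) = (t' + u) * equation n e i r p" if "r < 2" for r
        unfolding p'_def equation_add equation_scale t[OF that] t'[OF that]
        by (simp_all add: algebra_simps)
      then show ?thesis
        unfolding joining_form_def by simp
    qed
    moreover have "m = card (I - insert l K)"
    proof -
      have "I - insert l K = (I - K) - {l}"
        by blast
      then show ?thesis
        using Suc.hyps(2) l I(1) by simp
    qed
    ultimately show ?thesis
      using Suc.hyps(1)[of "insert l K" p' "x + fscale u p"] l(1) K p'_in p' y_in by blast
  qed
  show ?case
  proof (rule ccontr)
    assume "F x \<noteq> 0"
    have "finite {u. F (x + fscale u p) = 0}"
    proof (rule univariate_finite_zeros)
      show "(\<lambda>u. F (x + fscale u p)) \<in> univariate (n - 1)"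
        unfolding plus_fscale_eq by (rule form_functions_on_line[OF F(1)])
      show "F (x + fscale 0 p) \<noteq> 0"
        using \<open>F x \<noteq> 0\<close> by simp
    qed
    then have "finite (exceptional \<union> {u. F (x + fscale u p) = 0})"
      using \<open>finite exceptional\<close> by blast
    moreover have "exceptional \<union> {u. F (x + fscale u p) = 0} = UNIV"
      using zero by blast
    ultimately show False
      using inf by simp
  qed
qed

text \<open>
  The combination of the two forms that vanishes at \<open>p\<close> is zero.
\<close>

lemma forms_proportional:
  fixes e :: "eqvar \<Rightarrow> 'a::field"
  assumes inf: "infinite (UNIV :: 'a set)" and I: "finite I" "card I = n" "n \<ge> 2"
    and p: "p \<in> vecs n" "regular n I e p"
    and F: "F \<in> form_functions n (n - 1)"
      "\<And>i x. i \<in> I \<Longrightarrow> x \<in> codim2_space n e i \<Longrightarrow> x \<noteq> 0 \<Longrightarrow> F x = 0"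
    and x: "x \<in> vecs n"
  shows "transversal_form n I e p * F x = F p * transversal_form n I e x"
proof -
  interpret regular_point n I e p
    using I p by unfold_locales
  let ?q = "transversal_form n I e"
  define G where "G x = ?q p * F x - F p * ?q x" for x
  have q: "?q \<in> form_functions n (n - 1)"
    by (rule transversal_form_function[OF finite_I card_I n_ge_1])
  have smult: "(\<lambda>x. c * f x) \<in> form_functions n (n - 1)" if "f \<in> form_functions n (n - 1)"
    for c and f :: "(nat \<Rightarrow> 'a) \<Rightarrow> 'a"
    using form_functions.mult[OF form_functions_const that, of c] by simp
  have G: "G \<in> form_functions n (n - 1)"
    unfolding G_def[abs_def] by (intro form_functions.diff smult q F(1))
  have "G x = 0" if "i \<in> I" "x \<in> codim2_space n e i" for i x
  proof (cases "x = 0")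
    case True
    then have "x = (\<lambda>i. 0 * x i)"
      by (simp add: fun_eq_iff)
    moreover have "G (\<lambda>i. 0 * x i) = 0 ^ (n - 1) * G x"
      by (rule form_functions_scale[OF G])
    ultimately show ?thesis
      using n_ge_2 by (simp add: power_0_left)
  next
    case False
    then show ?thesis
      using F(2)[OF that] transversal_form_vanishes_on_codim2_space[OF finite_I card_I n_ge_1 False that(2,1)]
      by (simp add: G_def)
  qed
  moreover have "G p = 0"
    by (simp add: G_def)
  ultimately have "G x = 0"
    using form_vanishes_on_common_kernel[OF inf I G _ p(1,2), of "{}" x] x by blast
  then show ?thesis
    by (simp add: G_def)
qed

section \<open>Hypersurfaces\<close>

definition hypersurface_of :: "(nat, 'a::field) multipoly \<Rightarrow> (nat, 'a) multipoly set" where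
  "hypersurface_of F = {Poly_Mapping.map ((*) c) F | c. c \<noteq> 0}"

lemma hypersurfaces_eq: "hypersurfaces n d = hypersurface_of ` (forms n d - {0})"
  by (simp add: hypersurfaces_def hypersurface_of_def)

lemma lookup_map_mult:
  "Poly_Mapping.lookup (Poly_Mapping.map ((*) c) F) m = c * Poly_Mapping.lookup F m"
  for c :: "'a::comm_ring_1"
  by (rule lookup_map_0) simp

lemma eval_poly_map_mult: "eval_poly (Poly_Mapping.map ((*) c) F) x = c * eval_poly F x"
  for c :: "'a::comm_ring_1"
proof -
  have "eval_poly (Poly_Mapping.map ((*) c) F) x =
      (\<Sum>m\<in>Poly_Mapping.keys F. c * Poly_Mapping.lookup F m * monomial_value m x)"
    by (rule eval_poly_map) simp
  also have "\<dots> = c * eval_poly F x"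
    unfolding eval_poly_superset[OF finite_keys subset_refl] sum_distrib_left
    by (simp only: mult.assoc)
  finally show ?thesis .
qed

lemma map_mult_in_forms:
  "F \<in> forms n d \<Longrightarrow> Poly_Mapping.map ((*) c) F \<in> forms n d" for c :: "'a::comm_ring_1"
proof -
  have "Poly_Mapping.keys (Poly_Mapping.map ((*) c) F) \<subseteq> Poly_Mapping.keys F"
    by (metis in_keys_iff lookup_map_mult mult_zero_right subsetI)
  then show "F \<in> forms n d \<Longrightarrow> Poly_Mapping.map ((*) c) F \<in> forms n d"
    unfolding forms_iff by blast
qed

lemma hypersurface_of_map_mult:
  fixes c :: "'a::field"
  assumes "c \<noteq> 0"
  shows "hypersurface_of (Poly_Mapping.map ((*) c) F) = hypersurface_of F"
proof -
  have map_map: "Poly_Mapping.map ((*) a) (Poly_Mapping.map ((*) c) F) = Poly_Mapping.map ((*) (a * c)) F"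
    for a
    by (rule poly_mapping_eqI) (simp only: lookup_map_mult mult.assoc)
  have "Poly_Mapping.map ((*) b) F \<in> hypersurface_of (Poly_Mapping.map ((*) c) F)" if "b \<noteq> 0" for b
    unfolding hypersurface_of_def mem_Collect_eq map_map using that assms
    by (intro exI[of _ "b / c"]) simp
  moreover have "Poly_Mapping.map ((*) a) (Poly_Mapping.map ((*) c) F) \<in> hypersurface_of F"
    if "a \<noteq> 0" for a
    unfolding hypersurface_of_def mem_Collect_eq map_map using that assms
    by (intro exI[of _ "a * c"]) simp
  ultimately show ?thesis
    unfolding hypersurface_of_def[of "Poly_Mapping.map ((*) c) F"] hypersurface_of_def[of F] by blast
qed

lemma eval_form_scale:
  assumes "F \<in> forms n d"
  shows "eval_poly F (fscale c x) = c ^ d * eval_poly F x"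
  using form_functions_scale[of "eval_poly F" n d c x] assms
  unfolding form_functions_def fscale_def by blast

lemma span_in_locus_iff:
  assumes F: "F \<in> forms n d" and x: "x \<in> vecs n" "x \<noteq> 0"
  shows "fvs.span {x} \<in> locus n (hypersurface_of F) \<longleftrightarrow> eval_poly F x = 0"
    and "fvs.span {x} \<in> locus n {F} \<longleftrightarrow> eval_poly F x = 0"
proof -
  have space: "fvs.span {x} \<in> proj_space n"
    using x unfolding proj_space_iff by blast
  have x_in: "x \<in> fvs.span {x}"
    by (rule fvs.span_base) simp
  have zero: "eval_poly F y = 0" if "eval_poly F x = 0" "y \<in> fvs.span {x}" for y
    using that eval_form_scale[OF F] unfolding in_span_singleton_iff by auto
  show "fvs.span {x} \<in> locus n {F} \<longleftrightarrow> eval_poly F x = 0"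
    using space x_in zero unfolding locus_def by blast
  have "Poly_Mapping.map ((*) 1) F \<in> hypersurface_of F"
    unfolding hypersurface_of_def by (intro CollectI exI[of _ 1]) simp
  then have "eval_poly F x = 0" if "fvs.span {x} \<in> locus n (hypersurface_of F)"
    using that x_in eval_poly_map_mult[of 1 F x] unfolding locus_def by fastforce
  moreover have "eval_poly G y = 0" if "eval_poly F x = 0" "y \<in> fvs.span {x}" "G \<in> hypersurface_of F"
    for G y
    using that zero unfolding hypersurface_of_def by (auto simp: eval_poly_map_mult)
  ultimately show "fvs.span {x} \<in> locus n (hypersurface_of F) \<longleftrightarrow> eval_poly F x = 0"
    using space unfolding locus_def by blast
qed

lemma codim2_space_subset: "codim2_space n e i \<subseteq> vecs n"
  by (auto simp: codim2_space_def)

lemma family_of_eq: "i \<le> n \<Longrightarrow> family_of n e i = proj n (codim2_space n e i)"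
  unfolding family_of_def codim2_space_def equation_def by simp

lemma in_family_of_iff:
  assumes "i \<le> n"
  shows "q \<in> family_of n e i \<longleftrightarrow> (\<exists>x\<in>codim2_space n e i. x \<noteq> 0 \<and> q = fvs.span {x})"
  unfolding family_of_eq[OF assms] by (rule proj_iff[OF subspace_codim2_space codim2_space_subset])

lemma is_Q_hypersurface_of_iff:
  assumes F: "F \<in> forms n (n - 1)" "F \<noteq> 0"
  shows "is_Q n (family_of n e) j (hypersurface_of F) \<longleftrightarrow>
    (\<forall>i\<in>{..n} - {j}. \<forall>x\<in>codim2_space n e i. x \<noteq> 0 \<longrightarrow> eval_poly F x = 0)"
proof -
  have "family_of n e i \<subseteq> locus n (hypersurface_of F) \<longleftrightarrow>
      (\<forall>x\<in>codim2_space n e i. x \<noteq> 0 \<longrightarrow> eval_poly F x = 0)" if "i \<le> n" for i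
  proof -
    have "family_of n e i \<subseteq> locus n (hypersurface_of F) \<longleftrightarrow>
        (\<forall>x\<in>codim2_space n e i. x \<noteq> 0 \<longrightarrow> fvs.span {x} \<in> locus n (hypersurface_of F))"
      unfolding subset_eq Ball_def in_family_of_iff[OF that] by blast
    also have "\<dots> \<longleftrightarrow> (\<forall>x\<in>codim2_space n e i. x \<noteq> 0 \<longrightarrow> eval_poly F x = 0)"
      using span_in_locus_iff(1)[OF F(1)] codim2_space_subset[of n e i] by blast
    finally show ?thesis .
  qed
  moreover have "hypersurface_of F \<in> hypersurfaces n (n - 1)"
    using F unfolding hypersurfaces_eq by blast
  ultimately show ?thesis
    unfolding is_Q_def by (metis DiffD1 atMost_iff)
qed

text \<open>
  The field is infinite, so a form is determined by its values, and forms with proportional values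
  are proportional.
\<close>

lemma unique_Q:
  fixes e :: "eqvar \<Rightarrow> 'a::field"
  assumes inf: "infinite (UNIV :: 'a set)" and n: "n \<ge> 2" "j \<le> n"
    and p: "p \<in> vecs n" "regular n ({..n} - {j}) e p"
  obtains F where "F \<in> forms n (n - 1)" "eval_poly F = transversal_form n ({..n} - {j}) e"
    "\<And>H. is_Q n (family_of n e) j H \<longleftrightarrow> H = hypersurface_of F"
proof -
  let ?I = "{..n} - {j}"
  have card_I: "card ?I = n"
    using n(2) by simp
  interpret regular_point n ?I e p
    using n p card_I by unfold_locales simp_all
  let ?q = "transversal_form n ?I e"
  obtain Q where Q: "Q \<in> forms n (n - 1)" "eval_poly Q = ?q"
    using transversal_form_function[OF finite_I card_I n_ge_1, of e] unfolding form_functions_def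
    by (metis imageE)
  have "Q \<noteq> 0"
    using transversal_form_nonzero Q(2) eval_poly_0 by metis
  have "is_Q n (family_of n e) j (hypersurface_of Q)"
    unfolding is_Q_hypersurface_of_iff[OF Q(1) \<open>Q \<noteq> 0\<close>] Q(2)
    using transversal_form_vanishes_on_codim2_space[OF finite_I card_I n_ge_1] by blast
  moreover have "H = hypersurface_of Q" if H: "is_Q n (family_of n e) j H" for H
  proof -
    obtain F where F: "F \<in> forms n (n - 1)" "F \<noteq> 0" "H = hypersurface_of F"
      using H unfolding is_Q_def hypersurfaces_eq by blast
    have "eval_poly F \<in> form_functions n (n - 1)"
      using F(1) unfolding form_functions_def by blast
    moreover have "eval_poly F x = 0" if "i \<in> ?I" "x \<in> codim2_space n e i" "x \<noteq> 0" for i x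
      using H that unfolding F(3) is_Q_hypersurface_of_iff[OF F(1,2)] by blast
    ultimately have proportional_q: "?q p * eval_poly F x = eval_poly F p * ?q x" if "x \<in> vecs n" for x
      using forms_proportional[OF inf finite_I card_I n_ge_2 p_in regular _ _ that] by blast
    define c where "c = eval_poly F p / ?q p"
    \<comment> \<open>The difference F - c Q, written without subtraction.\<close>
    let ?G = "F + Poly_Mapping.map ((*) (- c)) Q"
    have "Poly_Mapping.keys ?G \<subseteq> Poly_Mapping.keys F \<union> Poly_Mapping.keys (Poly_Mapping.map ((*) (- c)) Q)"
      by (rule keys_add)
    then have "?G \<in> forms n (n - 1)"
      using F(1) map_mult_in_forms[OF Q(1), of "- c"] unfolding forms_iff by blast
    moreover have "eval_poly ?G x = 0" if "\<forall>i>n. x i = 0" for x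
    proof -
      have "x \<in> vecs n"
        using that by (simp add: vecs_def)
      from proportional_q[OF this] have "eval_poly F x = c * ?q x"
        using transversal_form_nonzero by (simp add: c_def nonzero_eq_divide_eq mult.commute)
      then show ?thesis
        unfolding eval_poly_add eval_poly_map_mult Q(2) by simp
    qed
    ultimately have "?G = 0"
      by (rule form_eq_0[OF inf])
    have F_eq: "F = Poly_Mapping.map ((*) c) Q"
    proof (rule poly_mapping_eqI)
      fix m
      have "Poly_Mapping.lookup ?G m = 0"
        unfolding \<open>?G = 0\<close> by simp
      then show "Poly_Mapping.lookup F m = Poly_Mapping.lookup (Poly_Mapping.map ((*) c) Q) m"
        unfolding lookup_add lookup_map_mult by simp
    qed
    have "c \<noteq> 0"
    proof
      assume "c = 0"
      have "F = 0"
        by (rule poly_mapping_eqI) (simp add: F_eq lookup_map_mult \<open>c = 0\<close>)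
      then show False
        using F(2) by simp
    qed
    then show ?thesis
      unfolding F(3) F_eq by (rule hypersurface_of_map_mult)
  qed
  ultimately show ?thesis
    using that[OF Q] by blast
qed

section \<open>The union of the transversal lines\<close>

text \<open>
  If \<open>x\<close> and \<open>v\<close> span a line, then a nonzero combination of them lies in the \<open>i\<close>-th subspace exactly
  if the \<open>i\<close>-th joining form at \<open>x\<close> vanishes at \<open>v\<close>. As the right-hand side turns out to be a closed
  condition on \<open>x\<close>, the union of the transversal lines is closed.
\<close>

lemma transversal_point_iff:
  "q \<in> \<Union>(transversal_lines n (family_of n e)) \<longleftrightarrow>
    (\<exists>x\<in>vecs n. x \<noteq> 0 \<and> q = fvs.span {x} \<and>
      (\<exists>v\<in>vecs n. v \<notin> fvs.span {x} \<and> (\<forall>i\<le>n. joining_form n e i x v = 0)))" (is "?l \<longleftrightarrow> ?r")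
proof
  assume ?l
  then obtain W where W: "fvs.subspace W" "W \<subseteq> vecs n" "fvs.dim W = 2" and q: "q \<in> proj n W"
    and meets: "\<And>i. i \<le> n \<Longrightarrow> proj n W \<inter> family_of n e i \<noteq> {}"
    unfolding transversal_lines_def proj_lines_def linear_subspaces_def by blast
  obtain x where x: "x \<in> W" "x \<noteq> 0" "q = fvs.span {x}"
    using q unfolding proj_iff[OF W(1,2)] by blast
  obtain v where v: "v \<in> W" "v \<notin> fvs.span {x}" "W = fvs.span {x, v}"
    using subspace_dim_2E[OF W x(1,2)] .
  have in_vecs: "x \<in> vecs n" "v \<in> vecs n"
    using x(1) v(1) W(2) by blast+
  have "joining_form n e i x v = 0" if i: "i \<le> n" for i
  proof -
    obtain y where y: "y \<in> proj n W" "y \<in> family_of n e i"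
      using meets[OF i] by blast
    obtain z where z: "z \<in> codim2_space n e i" "z \<noteq> 0" "y = fvs.span {z}"
      using y(2) unfolding in_family_of_iff[OF i] by blast
    have "fvs.span {z} \<subseteq> W"
      using y(1) z(3) unfolding proj_def by blast
    then have "z \<in> fvs.span {x, v}"
      using span_singleton_subset_iff[OF W(1)] v(3) by blast
    then obtain a b where ab: "z = fscale a x + fscale b v"
      unfolding span_pair_iff by blast
    have "a \<noteq> 0 \<or> b \<noteq> 0"
      using z(2) unfolding ab by auto
    then show ?thesis
      unfolding joining_form_eq_0_iff[OF in_vecs] using z(1) ab by blast
  qed
  then show ?r
    using x v in_vecs by blast
next
  assume ?r
  then obtain x v where x: "x \<in> vecs n" "x \<noteq> 0" "q = fvs.span {x}" and v: "v \<in> vecs n" "v \<notin> fvs.span {x}"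
    and joining: "\<And>i. i \<le> n \<Longrightarrow> joining_form n e i x v = 0"
    by blast
  let ?W = "fvs.span {x, v}"
  have W: "fvs.subspace ?W" "?W \<subseteq> vecs n"
    using x(1) v(1) fvs.span_minimal[OF _ subspace_vecs, of "{x, v}" n] by simp_all
  have W_in: "?W \<in> linear_subspaces n 2"
    unfolding linear_subspaces_def using W dim_span_pair[OF x(2) v(2)] by blast
  have "x \<in> ?W"
    by (rule fvs.span_base) simp
  then have q_in: "q \<in> proj n ?W"
    unfolding proj_iff[OF W] using x by blast
  have "proj n ?W \<inter> family_of n e i \<noteq> {}" if i: "i \<le> n" for i
  proof -
    obtain a b where ab: "a \<noteq> 0 \<or> b \<noteq> 0" "fscale a x + fscale b v \<in> codim2_space n e i"
      using joining[OF i] unfolding joining_form_eq_0_iff[OF x(1) v(1)] by blast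
    let ?z = "fscale a x + fscale b v"
    have "?z \<noteq> 0"
    proof
      assume z: "?z = 0"
      show False
      proof (cases "b = 0")
        case True
        then show ?thesis
          using z ab(1) x(2) by simp
      next
        case False
        have "v = fscale (- a / b) x"
        proof
          fix i
          have "a * x i + b * v i = 0"
            using fun_cong[OF z, of i] by (simp add: fscale_def)
          then show "v i = fscale (- a / b) x i"
            using False by (simp add: fscale_def field_simps eq_neg_iff_add_eq_0)
        qed
        then show ?thesis
          using v(2) unfolding in_span_singleton_iff by blast
      qed
    qed
    moreover have "?z \<in> ?W"
      unfolding span_pair_iff by blast
    ultimately have "fvs.span {?z} \<in> proj n ?W" "fvs.span {?z} \<in> family_of n e i"
      unfolding proj_iff[OF W] in_family_of_iff[OF i] using ab(2) by blast+
    then show ?thesis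
      by blast
  qed
  then have "proj n ?W \<in> transversal_lines n (family_of n e)"
    unfolding transversal_lines_def proj_lines_def using W_in by blast
  then show ?l
    using q_in by blast
qed

text \<open>
  Among the \<open>n + 1\<close> joining forms at \<open>x\<close>, which all vanish at \<open>x\<close>, one is redundant; the transversal
  form that leaves it out already yields a common zero of all of them.
\<close>

lemma all_transversal_forms_eq_0_iff:
  assumes n: "n \<ge> 1" and x: "x \<in> vecs n" "x \<noteq> 0"
  shows "(\<forall>j\<le>n. transversal_form n ({..n} - {j}) e x = 0) \<longleftrightarrow>
    (\<exists>v\<in>vecs n. v \<notin> fvs.span {x} \<and> (\<forall>i\<le>n. joining_form n e i x v = 0))" (is "?l \<longleftrightarrow> ?r")
proof -
  have zero_iff: "transversal_form n ({..n} - {j}) e x = 0 \<longleftrightarrow>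
      (\<exists>v\<in>vecs n. v \<notin> fvs.span {x} \<and> (\<forall>i\<in>{..n} - {j}. joining_form n e i x v = 0))"
    if "j \<le> n" for j
    using that n by (intro transversal_form_eq_0_iff x) simp_all
  show ?thesis
  proof
    assume ?l
    have "\<exists>k\<le>n. \<forall>v\<in>vecs n. (\<forall>i\<in>{..n} - {k}. joining_form n e i x v = 0) \<longrightarrow>
        joining_form n e k x v = 0"
      by (rule exists_redundant_functional[of n "\<lambda>i. joining_form n e i x",
            OF linear_functional_joining_form x joining_form_self])
    then obtain k where k: "k \<le> n"
      "\<forall>v\<in>vecs n. (\<forall>i\<in>{..n} - {k}. joining_form n e i x v = 0) \<longrightarrow>
        joining_form n e k x v = 0"
      by blast
    obtain v where v: "v \<in> vecs n" "v \<notin> fvs.span {x}"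
      "\<And>i. i \<in> {..n} - {k} \<Longrightarrow> joining_form n e i x v = 0"
    proof -
      have "transversal_form n ({..n} - {k}) e x = 0"
        using \<open>?l\<close> k(1) by blast
      then show ?thesis
        using that unfolding zero_iff[OF k(1)] by blast
    qed
    have "joining_form n e i x v = 0" if "i \<le> n" for i
      using k(2) v(1,3) that by (cases "i = k") blast+
    then show ?r
      using v(1,2) by blast
  next
    assume ?r
    then obtain v where v: "v \<in> vecs n" "v \<notin> fvs.span {x}"
      "\<And>i. i \<le> n \<Longrightarrow> joining_form n e i x v = 0"
      by blast
    have "transversal_form n ({..n} - {j}) e x = 0" if "j \<le> n" for j
      unfolding zero_iff[OF that] using v by (intro bexI[of _ v]) simp_all
    then show ?l
      by blast
  qed
qed

lemma topspace_zariski_proj: "topspace (zariski_proj n) = (proj_space n :: 'a::field point set)"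
proof -
  define F :: "(nat, 'a) multipoly" where "F = Poly_Mapping.single 0 1"
  have "F \<in> forms n 0"
    unfolding forms_iff F_def by simp
  moreover have "0 \<in> q" if "q \<in> proj_space n" for q :: "'a point"
    using that unfolding proj_space_def linear_subspaces_def by (simp add: fvs.subspace_0)
  then have "q \<notin> locus n {F}" for q
  proof -
    have "eval_poly F x = 1" for x
      unfolding F_def eval_poly_single by simp
    then show ?thesis
      using \<open>\<And>q. q \<in> proj_space n \<Longrightarrow> 0 \<in> q\<close> unfolding locus_def
      by (metis (mono_tags, lifting) mem_Collect_eq singletonI zero_neq_one)
  qed
  then have "locus n {F} = {}"
    by blast
  ultimately have "\<exists>F d. proj_space n = (proj_space n - locus n {F} :: 'a point set) \<and> F \<in> forms n d"
    by (metis Diff_empty)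
  then have "proj_space n \<in> {proj_space n - locus n {F} | F d. F \<in> (forms n d :: (nat, 'a) multipoly set)}"
    by (rule CollectI)
  then show ?thesis
    unfolding zariski_proj_def topology_generated_by_topspace by blast
qed

lemma closedin_locus:
  assumes "F \<in> forms n d"
  shows "closedin (zariski_proj n) (locus n {F})"
proof -
  have "openin (zariski_proj n) (proj_space n - locus n {F})"
    unfolding zariski_proj_def using assms by (intro topology_generated_by_Basis) blast
  then show ?thesis
    unfolding closedin_def topspace_zariski_proj by (auto simp: locus_def)
qed

text \<open>
  The single point \<open>p\<close> serves as a regular point for each choice of \<open>n\<close> of the \<open>n + 1\<close> subspaces.
\<close>

lemma T_locus_eq_R_locus:
  fixes e :: "eqvar \<Rightarrow> 'a::field"
  assumes inf: "infinite (UNIV :: 'a set)" and n: "n \<ge> 2"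
    and p: "p \<in> vecs n" "\<And>j. j \<le> n \<Longrightarrow> regular n ({..n} - {j}) e p"
  shows "\<forall>j\<le>n. \<exists>!H. is_Q n (family_of n e) j H"
    and "T_locus n (family_of n e) = R_locus n (family_of n e)"
proof -
  let ?S = "family_of n e"
  have "\<exists>F. F \<in> forms n (n - 1) \<and> eval_poly F = transversal_form n ({..n} - {j}) e \<and>
      (\<forall>H. is_Q n ?S j H \<longleftrightarrow> H = hypersurface_of F)" if "j \<le> n" for j
    using unique_Q[OF inf n that p(1) p(2)[OF that]] by metis
  then obtain F where F: "\<And>j. j \<le> n \<Longrightarrow> F j \<in> forms n (n - 1)"
    "\<And>j. j \<le> n \<Longrightarrow> eval_poly (F j) = transversal_form n ({..n} - {j}) e"
    "\<And>j H. j \<le> n \<Longrightarrow> is_Q n ?S j H \<longleftrightarrow> H = hypersurface_of (F j)"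
    by metis
  show "\<forall>j\<le>n. \<exists>!H. is_Q n ?S j H"
    using F(3) by simp
  have Q_hyp: "Q_hyp n ?S j = hypersurface_of (F j)" if "j \<le> n" for j
    unfolding Q_hyp_def using F(3)[OF that] by (intro the_equality) simp_all
  have locus_eq: "locus n (hypersurface_of (F j)) = locus n {F j}" if "j \<le> n" for j
  proof -
    have "q \<in> locus n (hypersurface_of (F j)) \<longleftrightarrow> q \<in> locus n {F j}" if q: "q \<in> proj_space n" for q
    proof -
      obtain x where "x \<in> vecs n" "x \<noteq> 0" "q = fvs.span {x}"
        using q unfolding proj_space_iff by blast
      then show ?thesis
        using span_in_locus_iff[OF F(1)[OF \<open>j \<le> n\<close>]] by simp
    qed
    then show ?thesis
      unfolding locus_def by blast
  qed
  have R: "R_locus n ?S = (\<Inter>j\<le>n. locus n {F j})"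
    unfolding R_locus_def using Q_hyp locus_eq by simp
  have "closedin (zariski_proj n) (R_locus n ?S)"
    unfolding R using closedin_locus[OF F(1)] by (intro closedin_INT) auto
  moreover have "\<Union>(transversal_lines n ?S) = R_locus n ?S"
  proof -
    have R_iff: "q \<in> R_locus n ?S \<longleftrightarrow> (\<exists>x\<in>vecs n. x \<noteq> 0 \<and> q = fvs.span {x} \<and>
        (\<forall>j\<le>n. transversal_form n ({..n} - {j}) e x = 0))" for q
    proof -
      have "q \<in> R_locus n ?S \<longleftrightarrow> (\<exists>x\<in>vecs n. x \<noteq> 0 \<and> q = fvs.span {x}) \<and> (\<forall>j\<le>n. q \<in> locus n {F j})"
        unfolding R proj_space_iff[symmetric] by (auto simp: locus_def)
      also have "\<dots> \<longleftrightarrow> (\<exists>x\<in>vecs n. x \<noteq> 0 \<and> q = fvs.span {x} \<and> (\<forall>j\<le>n. fvs.span {x} \<in> locus n {F j}))"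
        by blast
      also have "\<dots> \<longleftrightarrow> (\<exists>x\<in>vecs n. x \<noteq> 0 \<and> q = fvs.span {x} \<and>
          (\<forall>j\<le>n. transversal_form n ({..n} - {j}) e x = 0))"
        using span_in_locus_iff(2)[OF F(1)] F(2) by (intro bex_cong refl) auto
      finally show ?thesis .
    qed
    have "q \<in> \<Union>(transversal_lines n ?S) \<longleftrightarrow> q \<in> R_locus n ?S" for q
      unfolding transversal_point_iff R_iff
      using all_transversal_forms_eq_0_iff[of n _ e] n by (intro bex_cong refl) auto
    then show ?thesis
      by blast
  qed
  ultimately show "T_locus n ?S = R_locus n ?S"
    unfolding T_locus_def by (simp add: closure_of_closedin)
qed

section \<open>Regularity is a property of the subspaces\<close>

lemma joining_form_eq_0_cong:
  assumes "codim2_space n e i = codim2_space n e' i" "p \<in> vecs n" "x \<in> vecs n"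
  shows "joining_form n e i p x = 0 \<longleftrightarrow> joining_form n e' i p x = 0"
  using assms by (simp add: joining_form_eq_0_iff)

text \<open>
  Both kinds of determinants are characterized by conditions on the subspaces and on the kernels of
  the joining forms, which depend on the subspaces only.
\<close>

lemma regular_cong:
  assumes I: "finite I" "card I = n" "n \<ge> 1" and p: "p \<in> vecs n" "p \<noteq> 0"
    and eq: "\<And>i. i \<in> I \<Longrightarrow> codim2_space n e i = codim2_space n e' i"
  shows "regular n I e p \<longleftrightarrow> regular n I e' p"
proof -
  have cong: "joining_form n e i p x = 0 \<longleftrightarrow> joining_form n e' i p x = 0"
    if "i \<in> I" "x \<in> vecs n" for i x
    using eq[OF that(1)] p(1) that(2) by (rule joining_form_eq_0_cong)
  have "transversal_form n I e p = 0 \<longleftrightarrow> transversal_form n I e' p = 0"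
    unfolding transversal_form_eq_0_iff[OF I p] using cong by (intro bex_cong conj_cong ball_cong refl)
  moreover have "disjointness_form n (I - {l}) i k e p = 0 \<longleftrightarrow> disjointness_form n (I - {l}) i k e' p = 0"
    if l: "l \<in> I" and ik: "i \<in> I - {l}" "k \<in> I - {l}" "i \<noteq> k" for l i k
  proof -
    have J: "finite (I - {l})" "card (I - {l}) = n - 1"
      using I l by simp_all
    have "codim2_space n e i = codim2_space n e' i" "codim2_space n e k = codim2_space n e' k"
      using eq ik by simp_all
    moreover have "(\<forall>m\<in>I - {l} - {i, k}. joining_form n e m p x = 0) \<longleftrightarrow>
        (\<forall>m\<in>I - {l} - {i, k}. joining_form n e' m p x = 0)" if "x \<in> codim2_space n e' i" for x
      using cong that codim2_space_subset[of n e' i] by (intro ball_cong refl) blast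
    ultimately show ?thesis
      unfolding disjointness_form_eq_0_iff[OF J ik] by (metis (no_types, lifting))
  qed
  ultimately show ?thesis
    unfolding regular_def by blast
qed

lemma proj_inject:
  assumes W: "fvs.subspace W" "W \<subseteq> vecs n" and W': "fvs.subspace W'" "W' \<subseteq> vecs n"
    and eq: "proj n W = proj n W'"
  shows "W = W'"
proof -
  have "U \<subseteq> U'" if U: "fvs.subspace U" "U \<subseteq> vecs n" "fvs.subspace U'" "proj n U = proj n U'" for U U'
  proof
    fix x assume x: "x \<in> U"
    show "x \<in> U'"
    proof (cases "x = 0")
      case True
      then show ?thesis
        using U(3) by (simp add: fvs.subspace_0)
    next
      case False
      then have "fvs.span {x} \<in> proj n U'"
        using x U(4) proj_iff[OF U(1,2)] by blast
      then have "fvs.span {x} \<subseteq> U'"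
        unfolding proj_def by blast
      then show ?thesis
        using span_singleton_subset_iff[OF U(3)] by blast
    qed
  qed
  then show ?thesis
    using assms by (metis subset_antisym)
qed

lemma codim2_space_of_family:
  assumes "family_of n e = family_of n e'" "i \<le> n"
  shows "codim2_space n e i = codim2_space n e' i"
proof (rule proj_inject)
  show "proj n (codim2_space n e i) = proj n (codim2_space n e' i)"
    using assms by (metis family_of_eq)
qed (rule subspace_codim2_space codim2_space_subset)+

text \<open>
  A nonzero joining form shows that the two equations are linearly independent.
\<close>

lemma dim_codim2_space:
  assumes "p \<in> vecs n" "v \<in> vecs n" "joining_form n e i p v \<noteq> 0"
  shows "fvs.dim (codim2_space n e i) = n - 1"
proof -
  let ?f = "equation n e i 0" and ?g = "equation n e i 1"
  let ?K = "{x \<in> vecs n. ?f x = 0}"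
  have K: "fvs.subspace ?K" "?K \<subseteq> vecs n"
    by (rule subspace_kernel[OF subspace_vecs linear_functional_equation]) blast
  have two_steps: "fvs.dim (codim2_space n e i) = n - 1"
    if w: "w \<in> vecs n" "?f w \<noteq> 0" and y: "y \<in> vecs n" "?f y = 0" "?g y \<noteq> 0" for w y
  proof -
    have "codim2_space n e i = {x \<in> ?K. ?g x = 0}"
      by (auto simp: codim2_space_iff)
    moreover have "fvs.dim (vecs n :: (nat \<Rightarrow> 'a) set) = Suc (fvs.dim ?K)"
      by (rule dim_kernel[OF subspace_vecs subset_refl linear_functional_equation w])
    moreover have "fvs.dim ?K = Suc (fvs.dim {x \<in> ?K. ?g x = 0})"
      by (rule dim_kernel[OF K linear_functional_equation]) (use y in auto)
    ultimately show ?thesis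
      by (simp add: dim_vecs)
  qed
  show ?thesis
  proof (cases "?f p = 0")
    case True
    then have "?f v \<noteq> 0" "?g p \<noteq> 0"
      using assms(3) unfolding joining_form_def by auto
    then show ?thesis
      using two_steps[of v p] assms(1,2) True by blast
  next
    case False
    define y where "y = v - fscale (?f v / ?f p) p"
    have "y \<in> vecs n"
      unfolding y_def by (intro fvs.subspace_diff fvs.subspace_scale subspace_vecs assms(1,2))
    moreover have "?f y = 0"
      unfolding y_def equation_diff equation_scale using False by simp
    moreover have "?f p * ?g y = joining_form n e i p v"
      unfolding y_def equation_diff equation_scale joining_form_def using False
      by (simp add: right_diff_distrib mult.commute)
    then have "?g y \<noteq> 0"
      using assms(3) by auto
    ultimately show ?thesis
      using two_steps[of p y] assms(1) False by blast
  qed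
qed

section \<open>Regularity is a generic condition\<close>

text \<open>
  Regularity is tested at one fixed point that is rational over the prime field. Thus the condition
  on the equations is the nonvanishing of polynomials over the ground field.
\<close>

abbreviation base_point :: "nat \<Rightarrow> 'a::field" where
  "base_point \<equiv> unit_vector 0"

lemma base_point_in_vecs: "base_point \<in> vecs n"
  by (rule unit_vector_in_vecs) simp

lemma base_point_nonzero: "base_point \<noteq> (0 :: nat \<Rightarrow> 'a::field)"
  by (auto simp: unit_vector_def fun_eq_iff)

lemma equation_base_point: "equation n e i r base_point = e (i, r, 0)"
proof -
  have "equation n e i r base_point = (\<Sum>k\<le>n. if k = 0 then e (i, r, k) else 0)"
    unfolding equation_def unit_vector_def by (intro sum.cong) auto
  then show ?thesis
    by simp
qed

context comm_ring_hom
begin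

lemma graded_poly_functions_UNIV: "graded_functions (\<lambda>d. poly_functions hom UNIV)"
  by (rule graded_poly_functions) simp_all

end

lemma transversal_form_polynomial:
  fixes \<phi> :: "'k::comm_ring_1 \<Rightarrow> 'a::field"
  assumes \<phi>: "comm_ring_hom \<phi>" and I: "finite I" "card I = n" "n \<ge> 1"
  shows "(\<lambda>e. transversal_form n I e base_point) \<in> poly_functions \<phi> UNIV"
  unfolding transversal_form_def equation_base_point
proof (rule graded_functions.system_det[OF comm_ring_hom.graded_poly_functions_UNIV[OF \<phi>]])
  show "card (I \<times> {..<2::nat}) = card (Inl ` {..n} \<union> Inr ` (I - {Min I}))"
    by (rule card_columns[OF I])
  show "(\<lambda>e. (case r of (i, r) \<Rightarrow> \<lambda>c. case c of
        Inl k \<Rightarrow> e (i, r, k)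
      | Inr m \<Rightarrow> if m = i then e (i, r, 0) else 0) c) \<in> poly_functions \<phi> UNIV"
    for r and c :: "nat + nat"
    by (cases r; cases c)
      (auto intro!: graded_functions.if_cond[OF comm_ring_hom.graded_poly_functions_UNIV[OF \<phi>]]
        comm_ring_hom.poly_functions_var[OF \<phi>] comm_ring_hom.poly_functions_0[OF \<phi>])
qed (use I in auto)

lemma disjointness_form_polynomial:
  fixes \<phi> :: "'k::comm_ring_1 \<Rightarrow> 'a::field"
  assumes \<phi>: "comm_ring_hom \<phi>" and J: "finite J" "card J = n - 1" "i \<in> J" "k \<in> J" "i \<noteq> k"
  shows "(\<lambda>e. disjointness_form n J i k e base_point) \<in> poly_functions \<phi> UNIV"
  unfolding disjointness_form_def equation_base_point
proof (rule graded_functions.system_det[OF comm_ring_hom.graded_poly_functions_UNIV[OF \<phi>]])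
  note closure = comm_ring_hom.graded_poly_functions_UNIV[OF \<phi>]
  show "(\<lambda>e. (case mr of (m, r) \<Rightarrow> \<lambda>c. if m \<in> {i, k} then e (m, r, c)
        else e (m, 0, 0) * e (m, 1, c) - e (m, 1, 0) * e (m, 0, c)) c) \<in> poly_functions \<phi> UNIV"
    for mr and c :: nat
    by (cases mr)
      (auto intro!: graded_functions.if_cond[OF closure] graded_functions.diff[OF closure]
        graded_functions.mult[OF closure] comm_ring_hom.poly_functions_var[OF \<phi>])
  show "card ((J - {i, k}) \<times> {0} \<union> {i, k} \<times> {..<2::nat}) = card {..n}"
    by (rule card_disjointness_rows[OF J])
qed (use J in auto)

text \<open>
  The \<open>r\<close>-th equation of the \<open>i\<close>-th subspace is the vanishing of the coordinate with index \<open>\<sigma> i r\<close>. If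
  \<open>\<sigma> i 0 = 0\<close>, then the joining form at the base point is the coordinate with index \<open>\<sigma> i 1\<close>, so
  determinants of joining forms are easily seen to be nonzero.
\<close>

definition coordinate_equations :: "nat \<Rightarrow> (nat \<Rightarrow> nat \<Rightarrow> nat) \<Rightarrow> eqvar \<Rightarrow> 'a::field" where
  "coordinate_equations n \<sigma> =
    (\<lambda>(i, r, k). if i \<le> n \<and> r < 2 \<and> k \<le> n \<and> k = \<sigma> i r then 1 else 0)"

lemma coordinate_equations_in: "coordinate_equations n \<sigma> \<in> eq_space n"
  unfolding eq_space_def coordinate_equations_def by auto

lemma equation_coordinate_equations:
  assumes "i \<le> n" "r < 2" "\<sigma> i r \<le> n"
  shows "equation n (coordinate_equations n \<sigma>) i r x = x (\<sigma> i r)"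
proof -
  have "equation n (coordinate_equations n \<sigma>) i r x = (\<Sum>k\<le>n. if k = \<sigma> i r then x k else 0)"
    unfolding equation_def coordinate_equations_def using assms by (intro sum.cong) auto
  then show ?thesis
    using assms(3) by simp
qed

lemma joining_form_coordinate_equations:
  assumes "i \<le> n" "\<sigma> i 0 = 0" "\<sigma> i 1 \<le> n" "\<sigma> i 1 \<noteq> 0"
  shows "joining_form n (coordinate_equations n \<sigma>) i base_point x = x (\<sigma> i 1)"
  unfolding joining_form_def using assms
  by (simp add: equation_coordinate_equations unit_vector_def del: One_nat_def)

lemma exists_transversal_form_nonzero:
  assumes I: "I \<subseteq> {..n}" "card I = n" "n \<ge> 1"
  shows "\<exists>e\<in>eq_space n. transversal_form n I e base_point \<noteq> (0 :: 'a::field)"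
proof -
  have fin: "finite I"
    using I(1) finite_subset by blast
  have "card I = card {1..n}"
    using I(2) by simp
  then obtain \<rho> where \<rho>: "bij_betw \<rho> I {1..n}"
    using finite_same_card_bij[OF fin] by blast
  define e :: "eqvar \<Rightarrow> 'a" where
    "e = coordinate_equations n (\<lambda>i r. if r = 0 then 0 else \<rho> i)"
  have joining: "joining_form n e i base_point x = x (\<rho> i)" if "i \<in> I" for i x
  proof -
    have "\<rho> i \<in> {1..n}"
      using \<rho> that unfolding bij_betw_def by blast
    then show ?thesis
      unfolding e_def using that I(1) by (subst joining_form_coordinate_equations) auto
  qed
  have "transversal_form n I e base_point \<noteq> 0"
  proof
    assume "transversal_form n I e base_point = 0"
    then obtain v where v: "v \<in> vecs n" "v \<notin> fvs.span {base_point}"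
      "\<And>i. i \<in> I \<Longrightarrow> joining_form n e i base_point v = 0"
      unfolding transversal_form_eq_0_iff[OF fin I(2,3) base_point_in_vecs base_point_nonzero] by blast
    have "v k = 0" if "k \<noteq> 0" for k
    proof (cases "k \<le> n")
      case True
      then have "k \<in> \<rho> ` I"
        using \<rho> that unfolding bij_betw_def by simp
      then show ?thesis
        using v(3) joining by auto
    next
      case False
      then show ?thesis
        using v(1) by (simp add: vecs_def)
    qed
    then have "v = fscale (v 0) base_point"
      by (auto simp: fscale_def unit_vector_def fun_eq_iff)
    then show False
      using v(2) unfolding in_span_singleton_iff by blast
  qed
  then show ?thesis
    using coordinate_equations_in e_def by blast
qed

lemma exists_disjointness_form_nonzero:
  assumes J: "J \<subseteq> {..n}" "card J = n - 1" "i \<in> J" "k \<in> J" "i \<noteq> k"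
  shows "\<exists>e\<in>eq_space n. disjointness_form n J i k e base_point \<noteq> (0 :: 'a::field)"
proof -
  have fin: "finite J"
    using J(1) finite_subset by blast
  have "2 \<le> n - 1"
    using card_mono[OF fin, of "{i, k}"] J by simp
  have "card (J - {i, k}) = n - 1 - 2"
    using J fin by (simp add: card_Diff_subset)
  then have "card (J - {i, k}) = card {4..n}"
    by simp
  then obtain \<rho> where \<rho>: "bij_betw \<rho> (J - {i, k}) {4..n}"
    using finite_same_card_bij[of "J - {i, k}" "{4..n}"] fin by blast
  define \<sigma> :: "nat \<Rightarrow> nat \<Rightarrow> nat" where
    "\<sigma> m r = (if m = i then r else if m = k then 2 + r else if r = 0 then 0 else \<rho> m)" for m r
  define e :: "eqvar \<Rightarrow> 'a" where "e = coordinate_equations n \<sigma>"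
  have joining: "joining_form n e m base_point x = x (\<rho> m)" if m: "m \<in> J - {i, k}" for m x
  proof -
    have "\<rho> m \<in> {4..n}"
      using \<rho> m unfolding bij_betw_def by blast
    then have "\<sigma> m 1 = \<rho> m" "\<sigma> m 0 = 0" "\<rho> m \<le> n" "\<rho> m \<noteq> 0" "m \<le> n"
      using m J(1) by (auto simp: \<sigma>_def)
    then show ?thesis
      unfolding e_def using joining_form_coordinate_equations[of m n \<sigma> x] by simp
  qed
  have eq: "equation n e m r x = x (\<sigma> m r)" if "m \<in> {i, k}" "r < 2" for m r x
    unfolding e_def
    by (rule equation_coordinate_equations) (use that J \<open>2 \<le> n - 1\<close> in \<open>auto simp: \<sigma>_def\<close>)
  have "disjointness_form n J i k e base_point \<noteq> 0"
  proof
    assume "disjointness_form n J i k e base_point = 0"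
    then obtain x where x: "x \<noteq> 0" "x \<in> codim2_space n e i" "x \<in> codim2_space n e k"
      "\<And>m. m \<in> J - {i, k} \<Longrightarrow> joining_form n e m base_point x = 0"
      unfolding disjointness_form_eq_0_iff[OF fin J(2-5)] by blast
    have "x c = 0" for c
    proof -
      have "x (\<sigma> m r) = 0" if "m \<in> {i, k}" "r < 2" for m r
        using x(2,3) that eq[OF that, of x] unfolding codim2_space_def by auto
      then have "x 0 = 0" "x 1 = 0" "x 2 = 0" "x 3 = 0"
        using J(5) by (force simp: \<sigma>_def eval_nat_numeral)+
      moreover have "x c = 0" if c: "4 \<le> c" "c \<le> n"
      proof -
        have "c \<in> \<rho> ` (J - {i, k})"
          using \<rho> c unfolding bij_betw_def by simp
        then show ?thesis
          using x(4) joining by auto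
      qed
      moreover have "x c = 0" if "n < c"
        using x(2) that by (simp add: codim2_space_iff vecs_def)
      moreover have "c = 0 \<or> c = 1 \<or> c = 2 \<or> c = 3 \<or> (4 \<le> c \<and> c \<le> n) \<or> n < c"
        by linarith
      ultimately show ?thesis
        by blast
    qed
    then show False
      using x(1) by (simp add: fun_eq_iff)
  qed
  then show ?thesis
    using coordinate_equations_in e_def by blast
qed

definition regular_family :: "nat \<Rightarrow> (eqvar \<Rightarrow> 'a::field) \<Rightarrow> bool" where
  "regular_family n e \<longleftrightarrow> (\<forall>j\<le>n. regular n ({..n} - {j}) e base_point)"

text \<open>
  Each polynomial comes with equations of its own at which it is nonzero. Equations at which all of
  them are nonzero exist by irreducibility.
\<close>

lemma regular_family_iff_polynomials_nonzero:
  fixes \<phi> :: "'k::comm_ring_1 \<Rightarrow> 'a::field"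
  assumes \<phi>: "comm_ring_hom \<phi>" and n: "n \<ge> 1"
  shows "\<exists>G. finite G \<and> G \<subseteq> poly_functions \<phi> UNIV \<and> (\<forall>g\<in>G. \<exists>e\<in>eq_space n. g e \<noteq> 0) \<and>
    (\<forall>e. regular_family n e \<longleftrightarrow> (\<forall>g\<in>G. g e \<noteq> 0))"
proof -
  let ?I = "\<lambda>j. {..n} - {j}"
  let ?t = "\<lambda>j e. transversal_form n (?I j) e base_point :: 'a"
  let ?d = "\<lambda>(j, l, i, k) e. disjointness_form n (?I j - {l}) i k e base_point :: 'a"
  let ?T = "{(j, l, i, k). j \<le> n \<and> l \<in> ?I j \<and> i \<in> ?I j - {l} \<and> k \<in> ?I j - {l} \<and> i \<noteq> k}"
  let ?G = "?t ` {..n} \<union> ?d ` ?T"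
  have I: "finite (?I j)" "card (?I j) = n" "?I j \<subseteq> {..n}" if "j \<le> n" for j
    using that by auto
  have J: "finite (?I j - {l})" "card (?I j - {l}) = n - 1" "?I j - {l} \<subseteq> {..n}"
    if "j \<le> n" "l \<in> ?I j" for j l
    using card_Diff_singleton[OF that(2)] I[OF that(1)] by auto
  have "finite ?T"
    by (rule finite_subset[of _ "{..n} \<times> {..n} \<times> {..n} \<times> {..n}"]) auto
  then have finite_G: "finite ?G"
    by blast
  have in_G: "g \<in> poly_functions \<phi> UNIV \<and> (\<exists>e\<in>eq_space n. g e \<noteq> 0)" if "g \<in> ?G" for g
  proof -
    from that show ?thesis
    proof (rule UnE)
      assume "g \<in> ?t ` {..n}"
      then obtain j where g: "g = ?t j" and "j \<in> {..n}"
        by (rule imageE)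
      then have j: "j \<le> n"
        by simp
      show ?thesis
        unfolding g using transversal_form_polynomial[OF \<phi> I(1,2)[OF j] n]
          exists_transversal_form_nonzero[OF I(3,2)[OF j] n] by (rule conjI)
    next
      assume "g \<in> ?d ` ?T"
      then obtain t where t_in: "g = ?d t" "t \<in> ?T"
        by (rule imageE)
      obtain j l i k where t: "t = (j, l, i, k)"
        by (cases t)
      have jl: "j \<le> n" "l \<in> ?I j" and ik: "i \<in> ?I j - {l}" "k \<in> ?I j - {l}" "i \<noteq> k"
        using t_in(2) unfolding t by simp_all
      have g: "g = (\<lambda>e. disjointness_form n (?I j - {l}) i k e base_point)"
        using t_in(1) unfolding t by simp
      show ?thesis
        unfolding g
        using disjointness_form_polynomial[OF \<phi> J(1,2)[OF jl] ik]
          exists_disjointness_form_nonzero[OF J(3,2)[OF jl] ik] by (rule conjI)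
    qed
  qed
  have iff: "regular_family n e \<longleftrightarrow> (\<forall>g\<in>?G. g e \<noteq> 0)" for e
  proof -
    define A where "A j \<longleftrightarrow> transversal_form n (?I j) e base_point \<noteq> 0" for j
    define B where "B j \<longleftrightarrow> (\<forall>l\<in>?I j. \<forall>i\<in>?I j - {l}. \<forall>k\<in>?I j - {l}.
        i \<noteq> k \<longrightarrow> disjointness_form n (?I j - {l}) i k e base_point \<noteq> 0)" for j
    have "(\<forall>g\<in>?G. g e \<noteq> 0) \<longleftrightarrow> (\<forall>j\<le>n. ?t j e \<noteq> 0) \<and> (\<forall>t\<in>?T. ?d t e \<noteq> 0)"
      by (simp only: ball_Un ball_simps atMost_iff Ball_def[of "{..n}"])
    also have "(\<forall>t\<in>?T. ?d t e \<noteq> 0) \<longleftrightarrow> (\<forall>j\<le>n. B j)"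
      unfolding B_def by auto
    also have "(\<forall>j\<le>n. ?t j e \<noteq> 0) \<longleftrightarrow> (\<forall>j\<le>n. A j)"
      unfolding A_def ..
    also have "(\<forall>j\<le>n. A j) \<and> (\<forall>j\<le>n. B j) \<longleftrightarrow> (\<forall>j\<le>n. A j \<and> B j)"
      by blast
    also have "\<dots> \<longleftrightarrow> regular_family n e"
      unfolding A_def B_def regular_family_def regular_def ..
    finally show ?thesis ..
  qed
  show ?thesis
  proof (intro exI[of _ ?G] conjI allI)
    show "finite ?G"
      by (rule finite_G)
    show "?G \<subseteq> poly_functions \<phi> UNIV"
      by (rule subsetI) (rule conjunct1[OF in_G])
    show "\<forall>g\<in>?G. \<exists>e\<in>eq_space n. g e \<noteq> 0"
      by (rule ballI) (rule conjunct2[OF in_G])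
    show "regular_family n e \<longleftrightarrow> (\<forall>g\<in>?G. g e \<noteq> 0)" for e
      by (rule iff)
  qed
qed

lemma regular_family_cong:
  assumes "n \<ge> 1" "family_of n e = family_of n e'"
  shows "regular_family n e \<longleftrightarrow> regular_family n e'"
  unfolding regular_family_def using assms
  by (intro all_cong1 imp_cong refl regular_cong base_point_in_vecs base_point_nonzero
      codim2_space_of_family[OF assms(2)]) auto

lemma regular_family_indep_eqs:
  assumes n: "n \<ge> 2" and e: "e \<in> eq_space n" "regular_family n e"
  shows "e \<in> indep_eqs n"
proof -
  have "family_of n e i \<in> codim2_subspaces n" if i: "i \<le> n" for i
  proof -
    obtain j where j: "j \<le> n" "j \<noteq> i"
    proof (cases "i = 0")
      case True
      then show ?thesis
        using that[of 1] n by simp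
    next
      case False
      then show ?thesis
        using that[of 0] by simp
    qed
    interpret regular_point n "{..n} - {j}" e base_point
      using n j(1) e(2) base_point_in_vecs unfolding regular_family_def
      by unfold_locales simp_all
    have i_in: "i \<in> {..n} - {j}"
      using i j by simp
    have J: "finite ({..n} - {j} - {i})" "card ({..n} - {j} - {i}) < n"
      using card_Diff_singleton[OF i_in] card_I n finite_I by simp_all
    obtain v where v: "v \<in> vecs n" "v \<notin> fvs.span {base_point}"
      "\<And>m. m \<in> {..n} - {j} - {i} \<Longrightarrow> joining_form n e m base_point v = 0"
      using exists_transversal_direction[OF base_point_in_vecs base_point_nonzero J] by blast
    have "joining_form n e i base_point v \<noteq> 0"
      using common_kernel[OF v(1)] v(2,3) by blast
    then have "fvs.dim (codim2_space n e i) = n - 1"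
      by (rule dim_codim2_space[OF base_point_in_vecs v(1)])
    then have "codim2_space n e i \<in> linear_subspaces n (n - 1)"
      unfolding linear_subspaces_def using subspace_codim2_space codim2_space_subset by blast
    then show ?thesis
      unfolding codim2_subspaces_def family_of_eq[OF i] by blast
  qed
  then have "family_of n e \<in> families n"
    unfolding families_def PiE_def extensional_def by (auto simp: family_of_def)
  then show ?thesis
    using e(1) by (simp add: indep_eqs_def)
qed

lemma exists_equations:
  fixes S :: "nat \<Rightarrow> 'a::field point set"
  assumes n: "n \<ge> 1" and S: "S \<in> families n"
  obtains e where "e \<in> indep_eqs n" "family_of n e = S"
proof -
  define cut_out where "cut_out U c \<longleftrightarrow>
      U = proj n {x \<in> vecs n. \<forall>r<2. (\<Sum>k\<le>n. c r k * x k) = 0}" for U and c :: "nat \<Rightarrow> nat \<Rightarrow> 'a"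
  have "\<exists>c. cut_out (S i) c" if "i \<le> n" for i
  proof -
    have "S i \<in> codim2_subspaces n"
      using S that unfolding families_def by auto
    then obtain W where W: "fvs.subspace W" "W \<subseteq> vecs n" "fvs.dim W = n - 1" "S i = proj n W"
      unfolding codim2_subspaces_def linear_subspaces_def by blast
    have dim: "fvs.dim W + 2 = n + 1"
      using W(3) n by simp
    obtain c :: "nat \<Rightarrow> nat \<Rightarrow> 'a" where "W = {x \<in> vecs n. \<forall>r<2. (\<Sum>k\<le>n. c r k * x k) = 0}"
      by (rule subspace_cut_out[OF W(1,2) dim])
    from arg_cong[OF this, of "proj n"] have "cut_out (proj n W) c"
      unfolding cut_out_def .
    then show ?thesis
      unfolding W(4) by (rule exI[of _ c])
  qed
  then obtain c where "\<And>i. i \<le> n \<Longrightarrow> cut_out (S i) (c i)"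
    by metis
  then have c: "S i = proj n {x \<in> vecs n. \<forall>r<2. (\<Sum>k\<le>n. c i r k * x k) = 0}" if "i \<le> n" for i
    using that unfolding cut_out_def by blast
  define e where "e = (\<lambda>(i, r, k). if i \<le> n \<and> r < 2 \<and> k \<le> n then c i r k else 0)"
  have "family_of n e i = S i" for i
  proof (cases "i \<le> n")
    case True
    have "(\<Sum>k\<le>n. e (i, r, k) * x k) = (\<Sum>k\<le>n. c i r k * x k)" if "r < 2" for r x
      using True that by (intro sum.cong) (auto simp: e_def)
    then have "{x \<in> vecs n. \<forall>r<2. (\<Sum>k\<le>n. e (i, r, k) * x k) = 0} =
        {x \<in> vecs n. \<forall>r<2. (\<Sum>k\<le>n. c i r k * x k) = 0}"
      by (intro Collect_cong conj_cong all_cong refl) simp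
    then show ?thesis
      unfolding family_of_def c[OF True] using True by simp
  next
    case False
    then show ?thesis
      using S unfolding families_def family_of_def by (auto simp: PiE_def extensional_def)
  qed
  then have "family_of n e = S"
    by blast
  moreover have "e \<in> eq_space n"
    unfolding eq_space_def e_def by auto
  ultimately show ?thesis
    using S that unfolding indep_eqs_def by blast
qed

section \<open>The space of equations is irreducible\<close>

text \<open>
  The topology of the affine space of all coefficients. Lines between two points stay inside this space,
  although they may leave the subset of independent equations.
\<close>

definition zariski_eq_space :: "nat \<Rightarrow> (eqvar \<Rightarrow> 'k::field alg_closure) topology" where
  "zariski_eq_space n = topology_generated_by
     (range (\<lambda>f :: (eqvar, 'k) multipoly.
        {e \<in> eq_space n. eval_poly (Poly_Mapping.map to_ac f) e \<noteq> 0}))"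

lemma zariski_eqs_eq: "zariski_eqs n = subtopology (zariski_eq_space n) (indep_eqs n)"
  unfolding zariski_eqs_def zariski_eq_space_def ..

lemma comm_ring_hom_to_ac: "comm_ring_hom (to_ac :: 'k::field \<Rightarrow> 'k alg_closure)"
  by unfold_locales simp_all

lemma openin_nonzero_locus:
  fixes g :: "(eqvar \<Rightarrow> 'k::field alg_closure) \<Rightarrow> 'k alg_closure"
  assumes "g \<in> poly_functions to_ac UNIV"
  shows "openin (zariski_eq_space n) {e \<in> eq_space n. g e \<noteq> 0}"
  using assms unfolding zariski_eq_space_def poly_functions_def
  by (intro topology_generated_by_Basis) blast

lemma topspace_zariski_eq_space:
  "topspace (zariski_eq_space n) = (eq_space n :: (eqvar \<Rightarrow> 'k::field alg_closure) set)"
proof -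
  have "(\<lambda>e. to_ac (1 :: 'k)) \<in> poly_functions to_ac UNIV"
    by (rule comm_ring_hom.poly_functions_const[OF comm_ring_hom_to_ac]) simp
  from openin_subset[OF openin_nonzero_locus[OF this, of n]]
  have "eq_space n \<subseteq> topspace (zariski_eq_space n :: (eqvar \<Rightarrow> 'k alg_closure) topology)"
    by simp
  then show ?thesis
    unfolding zariski_eq_space_def topology_generated_by_topspace by blast
qed

lemma line_in_eq_space:
  assumes "a \<in> eq_space n" "b \<in> eq_space n"
  shows "(\<lambda>v. a v + s * (b v - a v)) \<in> eq_space n"
  using assms unfolding eq_space_def by simp

text \<open>
  For a basic open set this is the finiteness of the zeros of a nonzero univariate polynomial, and it is
  inherited by finite intersections and by unions.
\<close>

lemma line_meets_open_cofinitely: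
  fixes a b :: "eqvar \<Rightarrow> 'k::field alg_closure"
  assumes "openin (zariski_eq_space n) V" "a \<in> V" "b \<in> eq_space n"
  shows "finite {s. (\<lambda>v. a v + s * (b v - a v)) \<notin> V}"
proof -
  have a: "a \<in> eq_space n"
    using openin_subset[OF assms(1)] assms(2) topspace_zariski_eq_space by blast
  have "generate_topology_on (range (\<lambda>f :: (eqvar, 'k) multipoly.
        {e \<in> eq_space n. eval_poly (Poly_Mapping.map to_ac f) e \<noteq> 0})) V"
    using assms(1) unfolding zariski_eq_space_def openin_topology_generated_by_iff .
  then show ?thesis
    using assms(2)
  proof (induction V)
    case Empty
    then show ?case by simp
  next
    case (Int U V)
    then have "finite ({s. (\<lambda>v. a v + s * (b v - a v)) \<notin> U} \<union> {s. (\<lambda>v. a v + s * (b v - a v)) \<notin> V})"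
      by simp
    then show ?case
      by (rule rev_finite_subset) blast
  next
    case (UN K)
    then obtain U where "U \<in> K" "a \<in> U"
      by blast
    then have "finite {s. (\<lambda>v. a v + s * (b v - a v)) \<notin> U}"
      using UN by blast
    then show ?case
      by (rule rev_finite_subset) (use \<open>U \<in> K\<close> in blast)
  next
    case (Basis U)
    then obtain f where f: "U = {e \<in> eq_space n. eval_poly (Poly_Mapping.map to_ac f) e \<noteq> 0}"
      by blast
    have "eval_poly (Poly_Mapping.map to_ac f) (\<lambda>v. a v + 0 * (b v - a v)) \<noteq> 0"
      using Basis(2) unfolding f by simp
    from eval_poly_finite_zeros_on_line[OF this] show ?case
      unfolding f using line_in_eq_space[OF a assms(3)] by simp
  qed
qed

text \<open>
  Of the line through a point of one set and a point of the other, each set misses only finitely many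
  points.
\<close>

lemma open_sets_meet:
  fixes V V' :: "(eqvar \<Rightarrow> 'k::field alg_closure) set"
  assumes inf: "infinite (UNIV :: 'k alg_closure set)"
    and V: "openin (zariski_eq_space n) V" "V \<noteq> {}"
    and V': "openin (zariski_eq_space n) V'" "V' \<noteq> {}"
  shows "V \<inter> V' \<noteq> {}"
proof -
  obtain a b where ab: "a \<in> V" "b \<in> V'"
    using V(2) V'(2) by blast
  have in_space: "a \<in> eq_space n" "b \<in> eq_space n"
    using openin_subset[OF V(1)] openin_subset[OF V'(1)] ab topspace_zariski_eq_space by blast+
  let ?line = "\<lambda>s v. a v + s * (b v - a v)"
  have "finite {s. ?line s \<notin> V}"
    by (rule line_meets_open_cofinitely[OF V(1) ab(1) in_space(2)])
  moreover have "finite {s. ?line s \<notin> V'}"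
  proof -
    have "?line s = (\<lambda>v. b v + (1 - s) * (a v - b v))" for s
      by (simp add: fun_eq_iff algebra_simps)
    then have eq: "{s. ?line s \<notin> V'} = (\<lambda>s. 1 - s) -` {s. (\<lambda>v. b v + s * (a v - b v)) \<notin> V'}"
      by auto
    have "inj (\<lambda>s :: 'k alg_closure. 1 - s)"
      by (simp add: inj_on_def)
    then show ?thesis
      unfolding eq by (rule finite_vimageI[OF line_meets_open_cofinitely[OF V'(1) ab(2) in_space(1)]])
  qed
  ultimately have "finite ({s. ?line s \<notin> V} \<union> {s. ?line s \<notin> V'})"
    by blast
  then obtain s where "s \<notin> {s. ?line s \<notin> V} \<union> {s. ?line s \<notin> V'}"
    using ex_new_if_finite[OF inf] by blast
  then show ?thesis
    by blast
qed

lemma open_set_meets_nonzero_loci: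
  fixes V :: "(eqvar \<Rightarrow> 'k::field alg_closure) set"
  assumes inf: "infinite (UNIV :: 'k alg_closure set)"
    and "finite G" "G \<subseteq> poly_functions to_ac UNIV" "\<And>g. g \<in> G \<Longrightarrow> \<exists>e\<in>eq_space n. g e \<noteq> 0"
    and V: "openin (zariski_eq_space n) V" "V \<noteq> {}"
  shows "\<exists>e\<in>V. \<forall>g\<in>G. g e \<noteq> 0"
  using assms(2-)
proof (induction G arbitrary: V)
  case empty
  then show ?case by blast
next
  case (insert g G)
  let ?D = "{e \<in> eq_space n. g e \<noteq> 0}"
  have D: "openin (zariski_eq_space n) ?D" "?D \<noteq> {}"
    using openin_nonzero_locus[of g n] insert.prems(1,2) by blast+
  have "openin (zariski_eq_space n) (V \<inter> ?D)"
    using insert.prems(3) D(1) by (rule openin_Int)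
  moreover have "V \<inter> ?D \<noteq> {}"
    by (rule open_sets_meet[OF inf insert.prems(3,4) D])
  ultimately have "\<exists>e\<in>V \<inter> ?D. \<forall>g\<in>G. g e \<noteq> 0"
    using insert.prems(1,2) by (intro insert.IH) blast+
  then show ?case
    by blast
qed

section \<open>General families\<close>

lemma topspace_zariski_families:
  "topspace (zariski_families n) = (families n :: (nat \<Rightarrow> 'k::field alg_closure point set) set)"
proof
  have "{e \<in> indep_eqs n. family_of n e \<in> families n} =
      (indep_eqs n :: (eqvar \<Rightarrow> 'k alg_closure) set)"
    unfolding indep_eqs_def by blast
  moreover have "openin (zariski_eqs n) (indep_eqs n :: (eqvar \<Rightarrow> 'k alg_closure) set)"
  proof -
    have "topspace (zariski_eqs n) = (indep_eqs n :: (eqvar \<Rightarrow> 'k alg_closure) set)"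
      unfolding zariski_eqs_eq topspace_subtopology topspace_zariski_eq_space indep_eqs_def by blast
    then show ?thesis
      by (metis openin_topspace)
  qed
  ultimately have "openin (zariski_families n) (families n :: (nat \<Rightarrow> 'k alg_closure point set) set)"
    unfolding openin_zariski_families by simp
  then show "families n \<subseteq> topspace (zariski_families n :: (nat \<Rightarrow> 'k alg_closure point set) topology)"
    by (rule openin_subset)
next
  have "openin (zariski_families n) (topspace (zariski_families n :: (nat \<Rightarrow> 'k alg_closure point set) topology))"
    by (rule openin_topspace)
  then show "topspace (zariski_families n) \<subseteq> (families n :: (nat \<Rightarrow> 'k alg_closure point set) set)"
    unfolding openin_zariski_families by blast
qed

text \<open>
  The open set consists of the families that have equations for which the base point is regular; all
  equations of such a family then have this property, so its preimage in the space of equations is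
  the locus where finitely many polynomials are nonzero.
\<close>

lemma general_family_is_regular:
  assumes n: "n \<ge> 2" and inf: "infinite (UNIV :: 'k::field alg_closure set)"
    and P: "\<And>e :: eqvar \<Rightarrow> 'k alg_closure. regular_family n e \<Longrightarrow> P (family_of n e)"
  shows "for_general_family n P"
proof -
  let ?R = "{e \<in> indep_eqs n. regular_family n e} :: (eqvar \<Rightarrow> 'k alg_closure) set"
  let ?U = "family_of n ` ?R"
  have "n \<ge> 1"
    using n by simp
  obtain G :: "((eqvar \<Rightarrow> 'k alg_closure) \<Rightarrow> 'k alg_closure) set" where G: "finite G"
    "G \<subseteq> poly_functions to_ac UNIV" "\<forall>g\<in>G. \<exists>e\<in>eq_space n. g e \<noteq> 0"
    "\<And>e. regular_family n e \<longleftrightarrow> (\<forall>g\<in>G. g e \<noteq> 0)"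
    using regular_family_iff_polynomials_nonzero[OF comm_ring_hom_to_ac \<open>n \<ge> 1\<close>] by blast
  have U_sub: "?U \<subseteq> families n"
    unfolding indep_eqs_def by blast
  have preimage: "{e \<in> indep_eqs n. family_of n e \<in> ?U} = ?R"
    using regular_family_cong[OF \<open>n \<ge> 1\<close>] by blast
  have "openin (zariski_eq_space n) {e \<in> eq_space n. \<forall>g\<in>H. g e \<noteq> 0}" if "finite H" "H \<subseteq> G" for H
    using that
  proof (induction H)
    case empty
    then show ?case
      using openin_topspace[of "zariski_eq_space n"] by (simp add: topspace_zariski_eq_space)
  next
    case (insert g H)
    have "{e \<in> eq_space n. \<forall>g\<in>insert g H. g e \<noteq> 0} =
        {e \<in> eq_space n. g e \<noteq> 0} \<inter> {e \<in> eq_space n. \<forall>g\<in>H. g e \<noteq> 0}"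
      by blast
    moreover have "g \<in> poly_functions to_ac UNIV"
      using insert.prems G(2) by blast
    moreover have "openin (zariski_eq_space n) {e \<in> eq_space n. \<forall>g\<in>H. g e \<noteq> 0}"
      using insert.IH insert.prems by simp
    ultimately show ?case
      using openin_Int[OF openin_nonzero_locus] by simp
  qed
  from this[OF G(1) subset_refl] have "openin (zariski_eq_space n) {e \<in> eq_space n. \<forall>g\<in>G. g e \<noteq> 0}" .
  moreover have "?R = {e \<in> eq_space n. \<forall>g\<in>G. g e \<noteq> 0} \<inter> indep_eqs n"
    unfolding G(4)[symmetric] indep_eqs_def by blast
  ultimately have "openin (zariski_eqs n) ?R"
    unfolding zariski_eqs_eq openin_subtopology by blast
  then have "?U \<subseteq> families n \<and> openin (zariski_eqs n) {e \<in> indep_eqs n. family_of n e \<in> ?U}"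
    unfolding preimage by (rule conjI[OF U_sub])
  then have open_U: "openin (zariski_families n) ?U"
    unfolding openin_zariski_families .
  have "S \<in> zariski_families n closure_of ?U" if S: "S \<in> families n" for S
    unfolding in_closure_of topspace_zariski_families
  proof (intro conjI allI impI S)
    fix T assume T: "S \<in> T \<and> openin (zariski_families n) T"
    obtain a where a: "a \<in> indep_eqs n" "family_of n a = S"
      using exists_equations[OF \<open>n \<ge> 1\<close> S] .
    have "openin (zariski_eqs n) {e \<in> indep_eqs n. family_of n e \<in> T}"
      using T unfolding openin_zariski_families by blast
    then obtain V where V: "openin (zariski_eq_space n) V"
      "{e \<in> indep_eqs n. family_of n e \<in> T} = V \<inter> indep_eqs n"
      unfolding zariski_eqs_eq openin_subtopology by blast
    have "V \<noteq> {}"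
      using V(2) a T by blast
    then obtain e where e: "e \<in> V" "\<forall>g\<in>G. g e \<noteq> 0"
      using open_set_meets_nonzero_loci[OF inf G(1,2) _ V(1)] G(3) by blast
    have "e \<in> eq_space n"
      using e(1) openin_subset[OF V(1)] topspace_zariski_eq_space by blast
    moreover have "regular_family n e"
      using e(2) G(4) by blast
    ultimately have "e \<in> ?R"
      using regular_family_indep_eqs[OF n] by blast
    moreover from this have "family_of n e \<in> T"
      using V(2) e(1) by blast
    ultimately show "\<exists>y. y \<in> ?U \<and> y \<in> T"
      by blast
  qed
  then have "zariski_families n closure_of ?U = families n"
    using closure_of_subset_topspace[of "zariski_families n" ?U] topspace_zariski_families by blast
  then show ?thesis
    unfolding for_general_family_def using open_U P by blast
qed

theorem proposition3p4:
  fixes n :: nat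
  assumes "n \<ge> 2"
  shows "for_general_family n
    (\<lambda>S :: nat \<Rightarrow> 'k::field_char_0 alg_closure point set.
       (\<forall>j\<le>n. \<exists>!H. is_Q n S j H) \<and> T_locus n S = R_locus n S)"
proof (rule general_family_is_regular[OF assms])
  show inf: "infinite (UNIV :: 'k alg_closure set)"
    by (rule infinite_UNIV_char_0)
  fix e :: "eqvar \<Rightarrow> 'k alg_closure"
  assume "regular_family n e"
  then have "regular n ({..n} - {j}) e base_point" if "j \<le> n" for j
    using that unfolding regular_family_def by blast
  then show "(\<forall>j\<le>n. \<exists>!H. is_Q n (family_of n e) j H) \<and>
      T_locus n (family_of n e) = R_locus n (family_of n e)"
    using T_locus_eq_R_locus[OF inf assms base_point_in_vecs, of e] by blast
qed

end
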